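(* Over $\mathsf{ACA}_0$, each of the following items is implied by $\Sigma^1_1\text{-}\mathsf{AC}_0$ and implies $\mathsf{weak}\text{-}\Sigma^1_1\text{-}\mathsf{AC}_0$: (i) For every sequence $(A_n)_{n\in\mathbb{N}}$ of analytic codes such that each $A_n$ is enumerable and non-empty, there is a sequence $(X_n)_n$ with $X_n\in\overline{A_n}$ for all $n$. (ii) For every sequence $(A_n)_n$ of analytic codes such that each $A_n$ is enumerable and $\overline{A_n}$ has positive measure, there is $(X_n)_n$ with $X_n\in\overline{A_n}$ for all $n$. (iii) For every sequence $(A_n)_n$ of analytic codes such that each $A_n$ is enumerable and $\overline{A_n}$ is not enumerable, there is $(X_n)_n$ with $X_n\in\overline{A_n}$ for all $n$. (iv) For every sequence $(A_n)_n$ of analytic codes such that each $A_n$ is non-empty and RM-open, there is $(X_n)_n$ with $X_n\in A_n$ for all $n$.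
   Context: Second-order arithmetic. Subsets $X\subseteq\mathbb{N}$ are identified with elements of $2^\mathbb{N}$; $\overline{X}k$ denotes the initial segment of $X$ of length $k$. An analytic code is a code (in the sense of Simpson, Subsystems of Second Order Arithmetic, Def.\ V.1.1) for an analytic subset of $2^\mathbb{N}$; membership $X\in A$ is a $\Sigma^1_1$ formula, and (provably in $\mathsf{ACA}_0$) every (sequence of) $\Sigma^1_1$ formula(s) with parameters determines a (sequence of) analytic code(s) for the set it defines. $A_n$ is enumerable if there is a sequence $(Y_m)_m$ containing every element of $A_n$. "$X\in\overline{A_n}$" abbreviates: there is a sequence $(Y_m)_m$ containing all elements of $A_n$ such that $(\forall k)(\exists l)(\overline{X}k=\overline{Y_l}k\wedge Y_l\in A_n)$. Measure refers to the standard (fair coin) measure on $2^\mathbb{N}$. $A_n$ is RM-open if it coincides with a set coded by an open code in the sense of reverse mathematics (a union of a sequence of basic open sets of $2^\mathbb{N}$). $\Sigma^1_1\text{-}\mathsf{AC}_0$: for every $\Sigma^1_1$ formula $\varphi$, $(\forall n)(\exists X)\varphi(n,X)\to(\exists(X_n)_n)(\forall n)\varphi(n,X_n)$. $\mathsf{weak}\text{-}\Sigma^1_1\text{-}\mathsf{AC}_0$: for every arithmetical $\varphi$, $(\forall n)(\exists!X)\varphi(n,X)\to(\exists(X_n)_n)(\forall n)\varphi(n,X_n)$. *)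

theory Defs
  imports Main
begin

text \<open>Structures for the two-sorted language of second-order arithmetic (Henkin semantics).  The
  number sort is the whole type \<open>'m\<close>; it need not be standard.  The set sort is a
  collection \<open>\<S>\<close> of subsets of \<open>'m\<close>.\<close>

record 'm l2 =
  l2_zero :: 'm  ("\<zero>\<index>")
  l2_one :: 'm  ("\<one>\<index>")
  l2_add :: "'m \<Rightarrow> 'm \<Rightarrow> 'm"  (infixl "\<oplus>\<index>" 65)
  l2_mul :: "'m \<Rightarrow> 'm \<Rightarrow> 'm"  (infixl "\<otimes>\<index>" 70)
  l2_less :: "'m \<Rightarrow> 'm \<Rightarrow> bool"  (infix "\<prec>\<index>" 50)
  l2_sets :: "'m set set"  ("\<S>\<index>")

datatype trm = NVar nat | Zero | One | Add trm trm | Mul trm trm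

datatype fm =
    Eq trm trm
  | Less trm trm
  | Mem trm nat
  | Neg fm
  | And fm fm
  | Or fm fm
  | Imp fm fm
  | Iff fm fm
  | AllN nat fm
  | ExN nat fm
  | AllS nat fm
  | ExS nat fm

primrec tval :: "'m l2 \<Rightarrow> (nat \<Rightarrow> 'm) \<Rightarrow> trm \<Rightarrow> 'm" where
  "tval M e (NVar x) = e x"
| "tval M e Zero = \<zero>\<^bsub>M\<^esub>"
| "tval M e One = \<one>\<^bsub>M\<^esub>"
| "tval M e (Add s t) = tval M e s \<oplus>\<^bsub>M\<^esub> tval M e t"
| "tval M e (Mul s t) = tval M e s \<otimes>\<^bsub>M\<^esub> tval M e t"

primrec sat :: "'m l2 \<Rightarrow> (nat \<Rightarrow> 'm) \<Rightarrow> (nat \<Rightarrow> 'm set) \<Rightarrow> fm \<Rightarrow> bool" where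
  "sat M e E (Eq s t) \<longleftrightarrow> tval M e s = tval M e t"
| "sat M e E (Less s t) \<longleftrightarrow> tval M e s \<prec>\<^bsub>M\<^esub> tval M e t"
| "sat M e E (Mem t X) \<longleftrightarrow> tval M e t \<in> E X"
| "sat M e E (Neg \<phi>) \<longleftrightarrow> \<not> sat M e E \<phi>"
| "sat M e E (And \<phi> \<psi>) \<longleftrightarrow> sat M e E \<phi> \<and> sat M e E \<psi>"
| "sat M e E (Or \<phi> \<psi>) \<longleftrightarrow> sat M e E \<phi> \<or> sat M e E \<psi>"
| "sat M e E (Imp \<phi> \<psi>) \<longleftrightarrow> (sat M e E \<phi> \<longrightarrow> sat M e E \<psi>)"
| "sat M e E (Iff \<phi> \<psi>) \<longleftrightarrow> (sat M e E \<phi> \<longleftrightarrow> sat M e E \<psi>)"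
| "sat M e E (AllN x \<phi>) \<longleftrightarrow> (\<forall>a. sat M (e(x := a)) E \<phi>)"
| "sat M e E (ExN x \<phi>) \<longleftrightarrow> (\<exists>a. sat M (e(x := a)) E \<phi>)"
| "sat M e E (AllS X \<phi>) \<longleftrightarrow> (\<forall>Z \<in> \<S>\<^bsub>M\<^esub>. sat M e (E(X := Z)) \<phi>)"
| "sat M e E (ExS X \<phi>) \<longleftrightarrow> (\<exists>Z \<in> \<S>\<^bsub>M\<^esub>. sat M e (E(X := Z)) \<phi>)"

primrec arithmetical :: "fm \<Rightarrow> bool" where
  "arithmetical (Eq s t) \<longleftrightarrow> True"
| "arithmetical (Less s t) \<longleftrightarrow> True"
| "arithmetical (Mem t X) \<longleftrightarrow> True"
| "arithmetical (Neg \<phi>) \<longleftrightarrow> arithmetical \<phi>"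
| "arithmetical (And \<phi> \<psi>) \<longleftrightarrow> arithmetical \<phi> \<and> arithmetical \<psi>"
| "arithmetical (Or \<phi> \<psi>) \<longleftrightarrow> arithmetical \<phi> \<and> arithmetical \<psi>"
| "arithmetical (Imp \<phi> \<psi>) \<longleftrightarrow> arithmetical \<phi> \<and> arithmetical \<psi>"
| "arithmetical (Iff \<phi> \<psi>) \<longleftrightarrow> arithmetical \<phi> \<and> arithmetical \<psi>"
| "arithmetical (AllN x \<phi>) \<longleftrightarrow> arithmetical \<phi>"
| "arithmetical (ExN x \<phi>) \<longleftrightarrow> arithmetical \<phi>"
| "arithmetical (AllS X \<phi>) \<longleftrightarrow> False"
| "arithmetical (ExS X \<phi>) \<longleftrightarrow> False"

definition sigma11 :: "fm \<Rightarrow> bool" where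
  "sigma11 \<phi> \<longleftrightarrow> (\<exists>X \<theta>. \<phi> = ExS X \<theta> \<and> arithmetical \<theta>)"

definition basic_axioms :: "'m l2 \<Rightarrow> bool" where
  "basic_axioms M \<longleftrightarrow>
     (\<forall>n. n \<oplus> \<one> \<noteq> \<zero>) \<and>
     (\<forall>m n. m \<oplus> \<one> = n \<oplus> \<one> \<longrightarrow> m = n) \<and>
     (\<forall>m. m \<oplus> \<zero> = m) \<and>
     (\<forall>m n. m \<oplus> (n \<oplus> \<one>) = (m \<oplus> n) \<oplus> \<one>) \<and>
     (\<forall>m. m \<otimes> \<zero> = \<zero>) \<and>
     (\<forall>m n. m \<otimes> (n \<oplus> \<one>) = (m \<otimes> n) \<oplus> m) \<and>
     (\<forall>m. \<not> m \<prec> \<zero>) \<and>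
     (\<forall>m n. m \<prec> n \<oplus> \<one> \<longleftrightarrow> m \<prec> n \<or> m = n)"
  for M (structure)

definition induction_axiom :: "'m l2 \<Rightarrow> bool" where
  "induction_axiom M \<longleftrightarrow>
     (\<forall>X \<in> \<S>. \<zero> \<in> X \<and> (\<forall>n. n \<in> X \<longrightarrow> n \<oplus> \<one> \<in> X) \<longrightarrow> (\<forall>n. n \<in> X))"
  for M (structure)

text \<open>In the schemes below the assignments \<open>e\<close> and \<open>E\<close> supply all number and set
  parameters, so an instance holds iff its universal closure does.  The set whose existence is
  asserted is bound outside the object language and hence cannot occur in \<open>\<phi>\<close>.\<close>

definition arithmetical_comprehension :: "'m l2 \<Rightarrow> bool" where
  "arithmetical_comprehension M \<longleftrightarrow>
     (\<forall>\<phi> x e E. arithmetical \<phi> \<longrightarrow> range E \<subseteq> \<S> \<longrightarrow>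
       (\<exists>Z \<in> \<S>. \<forall>n. n \<in> Z \<longleftrightarrow> sat M (e(x := n)) E \<phi>))"
  for M (structure)

text \<open>Nonemptiness of \<open>\<S>\<close> belongs to the notion of structure; without it the schemes would
  hold vacuously, for lack of assignments.\<close>

definition ACA0 :: "'m l2 \<Rightarrow> bool" where
  "ACA0 M \<longleftrightarrow> \<S> \<noteq> {} \<and> basic_axioms M \<and> induction_axiom M \<and> arithmetical_comprehension M"
  for M (structure)

text \<open>The pairing map \<open>(i,j) = (i+j)\<^sup>2 + i\<close>, and the \<open>n\<close>-th member
  \<open>{i. (i,n) \<in> Z}\<close> of the sequence of sets coded by \<open>Z\<close>.\<close>

definition pair :: "'m l2 \<Rightarrow> 'm \<Rightarrow> 'm \<Rightarrow> 'm" where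
  "pair M i j = (i \<oplus> j) \<otimes> (i \<oplus> j) \<oplus> i"
  for M (structure)

definition nth_set :: "'m l2 \<Rightarrow> 'm set \<Rightarrow> 'm \<Rightarrow> 'm set" where
  "nth_set M Z n = {i. pair M i n \<in> Z}"

definition Sigma11_AC :: "'m l2 \<Rightarrow> bool" where
  "Sigma11_AC M \<longleftrightarrow>
     (\<forall>\<phi> x X e E. sigma11 \<phi> \<longrightarrow> range E \<subseteq> \<S> \<longrightarrow>
       (\<forall>n. \<exists>Z \<in> \<S>. sat M (e(x := n)) (E(X := Z)) \<phi>) \<longrightarrow>
       (\<exists>Z \<in> \<S>. \<forall>n. sat M (e(x := n)) (E(X := nth_set M Z n)) \<phi>))"
  for M (structure)

definition weak_Sigma11_AC :: "'m l2 \<Rightarrow> bool" where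
  "weak_Sigma11_AC M \<longleftrightarrow>
     (\<forall>\<phi> x X e E. arithmetical \<phi> \<longrightarrow> range E \<subseteq> \<S> \<longrightarrow>
       (\<forall>n. \<exists>!Z. Z \<in> \<S> \<and> sat M (e(x := n)) (E(X := Z)) \<phi>) \<longrightarrow>
       (\<exists>Z \<in> \<S>. \<forall>n. sat M (e(x := n)) (E(X := nth_set M Z n)) \<phi>))"
  for M (structure)

text \<open>Elements of Baire space in the sense of the structure: functions whose graph is a set of the
  structure.\<close>

definition funs :: "'m l2 \<Rightarrow> ('m \<Rightarrow> 'm) set" where
  "funs M = {f. range (\<lambda>i. pair M i (f i)) \<in> \<S>}"
  for M (structure)

text \<open>Coding of finite sets by numbers: \<open>c = (k,(m,n))\<close> describes the set of all \<open>i < k\<close> such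
  that \<open>m(i+1)+1\<close> divides \<open>n\<close>, and the code of a finite set is the least
  number describing it.  A finite sequence is coded as the finite set of pairs
  \<open>(i, s\<^sub>i)\<close>.\<close>

definition coded_set :: "'m l2 \<Rightarrow> 'm \<Rightarrow> 'm set" where
  "coded_set M c = {i. \<exists>k m n q. c = pair M k (pair M m n) \<and> i \<prec> k \<and>
                   n = (m \<otimes> (i \<oplus> \<one>) \<oplus> \<one>) \<otimes> q}"
  for M (structure)

definition is_code :: "'m l2 \<Rightarrow> 'm \<Rightarrow> bool" where
  "is_code M c \<longleftrightarrow> (\<forall>c'. c' \<prec> c \<longrightarrow> coded_set M c' \<noteq> coded_set M c)"
  for M (structure)

definition is_seq :: "'m l2 \<Rightarrow> 'm \<Rightarrow> 'm \<Rightarrow> bool" where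
  "is_seq M s l \<longleftrightarrow> is_code M s \<and>
     (\<forall>p \<in> coded_set M s. \<exists>i x. i \<prec> l \<and> p = pair M i x) \<and>
     (\<forall>i. i \<prec> l \<longrightarrow> (\<exists>!x. pair M i x \<in> coded_set M s))"
  for M (structure)

definition is_bin_seq :: "'m l2 \<Rightarrow> 'm \<Rightarrow> 'm \<Rightarrow> bool" where
  "is_bin_seq M s l \<longleftrightarrow> is_seq M s l \<and>
     (\<forall>i. i \<prec> l \<longrightarrow> pair M i \<zero> \<in> coded_set M s \<or> pair M i \<one> \<in> coded_set M s)"
  for M (structure)

text \<open>\<open>s\<close> codes the initial segment of length \<open>k\<close> of \<open>f\<close>.\<close>

definition is_initial :: "'m l2 \<Rightarrow> ('m \<Rightarrow> 'm) \<Rightarrow> 'm \<Rightarrow> 'm \<Rightarrow> bool" where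
  "is_initial M f k s \<longleftrightarrow> is_seq M s k \<and> (\<forall>i. i \<prec> k \<longrightarrow> pair M i (f i) \<in> coded_set M s)"
  for M (structure)

definition chi :: "'m l2 \<Rightarrow> 'm set \<Rightarrow> 'm \<Rightarrow> 'm" where
  "chi M X i = (if i \<in> X then \<one> else \<zero>)"
  for M (structure)

definition l2_le :: "'m l2 \<Rightarrow> 'm \<Rightarrow> 'm \<Rightarrow> bool" where
  "l2_le M a b \<longleftrightarrow> a \<prec> b \<or> a = b"
  for M (structure)

text \<open>An analytic code is a tree of pairs \<open>(s,t)\<close> of equally long sequences, \<open>s\<close> binary; it
  represents the projection to Cantor space of the closed set of paths through the tree.\<close>

definition analytic_code :: "'m l2 \<Rightarrow> 'm set \<Rightarrow> bool" where
  "analytic_code M A \<longleftrightarrow> A \<in> \<S> \<and>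
     (\<forall>p \<in> A. \<exists>s t l. p = pair M s t \<and> is_bin_seq M s l \<and> is_seq M t l \<and>
        (\<forall>k s' t'. l2_le M k l \<and> is_seq M s' k \<and> is_seq M t' k \<and>
           coded_set M s' \<subseteq> coded_set M s \<and> coded_set M t' \<subseteq> coded_set M t \<longrightarrow> pair M s' t' \<in> A))"
  for M (structure)

definition points :: "'m l2 \<Rightarrow> 'm set \<Rightarrow> 'm set set" where
  "points M A = {X \<in> \<S>. \<exists>f \<in> funs M. \<forall>k. \<exists>s t.
      is_initial M (chi M X) k s \<and> is_initial M f k t \<and> pair M s t \<in> A}"
  for M (structure)

definition analytic_code_seq :: "'m l2 \<Rightarrow> 'm set \<Rightarrow> bool" where
  "analytic_code_seq M A \<longleftrightarrow> A \<in> \<S> \<and> (\<forall>n. analytic_code M (nth_set M A n))"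
  for M (structure)

definition lists_all :: "'m l2 \<Rightarrow> 'm set \<Rightarrow> 'm set set \<Rightarrow> bool" where
  "lists_all M Y C \<longleftrightarrow> (\<forall>X \<in> C. \<exists>m. X = nth_set M Y m)"

definition enumerable :: "'m l2 \<Rightarrow> 'm set set \<Rightarrow> bool" where
  "enumerable M C \<longleftrightarrow> (\<exists>Y \<in> \<S>. lists_all M Y C)"
  for M (structure)

text \<open>The enumerating sequence \<open>Y\<close> may also have members outside \<open>C\<close>, since
  \<open>{l. nth_set M Y l \<in> C}\<close> need not be a set of the structure.\<close>

definition seq_closure :: "'m l2 \<Rightarrow> 'm set set \<Rightarrow> 'm set set" where
  "seq_closure M C = {X \<in> \<S>. \<exists>Y \<in> \<S>. lists_all M Y C \<and>
      (\<forall>k. \<exists>l. (\<forall>i. i \<prec> k \<longrightarrow> (i \<in> X \<longleftrightarrow> i \<in> nth_set M Y l)) \<and> nth_set M Y l \<in> C)}"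
  for M (structure)

text \<open>A sequence of basic open sets of Cantor space is given by a sequence of binary
  sequences.\<close>

definition basic_open_seq :: "'m l2 \<Rightarrow> ('m \<Rightarrow> 'm) \<Rightarrow> bool" where
  "basic_open_seq M \<sigma> \<longleftrightarrow> \<sigma> \<in> funs M \<and> (\<forall>i. \<exists>l. is_bin_seq M (\<sigma> i) l)"

definition open_union :: "'m l2 \<Rightarrow> ('m \<Rightarrow> 'm) \<Rightarrow> 'm set set" where
  "open_union M \<sigma> = {X \<in> \<S>. \<exists>i k. is_initial M (chi M X) k (\<sigma> i)}"
  for M (structure)

definition RM_open :: "'m l2 \<Rightarrow> 'm set set \<Rightarrow> bool" where
  "RM_open M C \<longleftrightarrow> (\<exists>\<sigma>. basic_open_seq M \<sigma> \<and> C = open_union M \<sigma>)"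

text \<open>The inequality \<open>(\<Sum>i<l. 2^(-|\<sigma> i|)) \<le> 2^(-k)\<close>, where \<open>|\<sigma> i|\<close> is the length
  of \<open>\<sigma> i\<close>, with denominators cleared by some \<open>N\<close> bounding these lengths: \<open>e\<close> is the
  map \<open>n \<mapsto> 2^n\<close>, and \<open>p j\<close> is the sum of \<open>2^(N - |\<sigma> i|)\<close> over all \<open>i < j\<close>.\<close>

definition sum_bounded :: "'m l2 \<Rightarrow> ('m \<Rightarrow> 'm) \<Rightarrow> 'm \<Rightarrow> 'm \<Rightarrow> bool" where
  "sum_bounded M \<sigma> l k \<longleftrightarrow> (\<exists>N. \<exists>e \<in> funs M. \<exists>p \<in> funs M.
      e \<zero> = \<one> \<and> (\<forall>n. e (n \<oplus> \<one>) = e n \<oplus> e n) \<and>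
      p \<zero> = \<zero> \<and>
      (\<forall>i. i \<prec> l \<longrightarrow> (\<exists>d. is_seq M (\<sigma> i) d \<and> l2_le M d N)) \<and>
      (\<forall>i d r. i \<prec> l \<and> is_seq M (\<sigma> i) r \<and> d \<oplus> r = N \<longrightarrow> p (i \<oplus> \<one>) = p i \<oplus> e d) \<and>
      l2_le M (e k \<otimes> p l) (e N))"
  for M (structure)

text \<open>Measure zero for the fair coin measure, for classes which need not be coded by a set of the
  structure: for every \<open>k\<close> there is a cover by a sequence of basic open sets of total
  measure at most \<open>2\<^sup>-\<^sup>k\<close>.\<close>

definition measure_zero :: "'m l2 \<Rightarrow> 'm set set \<Rightarrow> bool" where
  "measure_zero M C \<longleftrightarrow>
     (\<forall>k. \<exists>\<sigma>. basic_open_seq M \<sigma> \<and> C \<subseteq> open_union M \<sigma> \<and> (\<forall>l. sum_bounded M \<sigma> l k))"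

definition positive_measure :: "'m l2 \<Rightarrow> 'm set set \<Rightarrow> bool" where
  "positive_measure M C \<longleftrightarrow> \<not> measure_zero M C"

definition choice_nonempty :: "'m l2 \<Rightarrow> bool" where
  "choice_nonempty M \<longleftrightarrow>
     (\<forall>A. analytic_code_seq M A \<and>
          (\<forall>n. enumerable M (points M (nth_set M A n)) \<and> points M (nth_set M A n) \<noteq> {}) \<longrightarrow>
       (\<exists>X \<in> \<S>. \<forall>n. nth_set M X n \<in> seq_closure M (points M (nth_set M A n))))"
  for M (structure)

definition choice_positive_measure :: "'m l2 \<Rightarrow> bool" where
  "choice_positive_measure M \<longleftrightarrow>
     (\<forall>A. analytic_code_seq M A \<and>
          (\<forall>n. enumerable M (points M (nth_set M A n)) \<and>
               positive_measure M (seq_closure M (points M (nth_set M A n)))) \<longrightarrow>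
       (\<exists>X \<in> \<S>. \<forall>n. nth_set M X n \<in> seq_closure M (points M (nth_set M A n))))"
  for M (structure)

definition choice_not_enumerable :: "'m l2 \<Rightarrow> bool" where
  "choice_not_enumerable M \<longleftrightarrow>
     (\<forall>A. analytic_code_seq M A \<and>
          (\<forall>n. enumerable M (points M (nth_set M A n)) \<and>
               \<not> enumerable M (seq_closure M (points M (nth_set M A n)))) \<longrightarrow>
       (\<exists>X \<in> \<S>. \<forall>n. nth_set M X n \<in> seq_closure M (points M (nth_set M A n))))"
  for M (structure)

definition choice_open :: "'m l2 \<Rightarrow> bool" where
  "choice_open M \<longleftrightarrow>
     (\<forall>A. analytic_code_seq M A \<and>
          (\<forall>n. points M (nth_set M A n) \<noteq> {} \<and> RM_open M (points M (nth_set M A n))) \<longrightarrow>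
       (\<exists>X \<in> \<S>. \<forall>n. nth_set M X n \<in> points M (nth_set M A n)))"
  for M (structure)

end

(* Sigma^1_1 choice picks a member of each non-empty analytic class, and a member of an enumerable class
   lies in its closure; a class whose closure has positive measure or is not enumerable is non-empty.

   Conversely, let X_n be the unique solution of phi(n, X). No single member of a closure of positive
   measure can be expected to compute X_n, so X_n is encoded bit by bit: for m = (i, n), the class of all
   sets Y with (0 in Y iff i in X_n) is open, not null and not enumerable, and its finite members are
   enumerable and dense in it. Any choice of members reveals one bit of X_n for each m. The classes are
   analytic because an arithmetical formula has a normal form "exists g, for all k, Q(k, g)" whose matrix
   Q(k, g) depends continuously on g and on the set variables. *)

theory Submission
  imports Defs
begin

section \<open>Definability with parameters\<close>

text \<open>The number sort may be nonstandard: every induction must run over a set of the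
  structure, and recursion has to be built from coded finite sequences. Definability is handled
  semantically, as a property of HOL predicates closed under the logical operations, so that long
  formulas need not be written out. Uniqueness of the solution is what makes the encoding by bits
  sound: "some solution contains i" and "every solution contains i" coincide, so bits chosen for
  different m belong to one and the same set. Once they are listed in a sequence of the structure,
  arithmetical comprehension assembles all solutions. Continuity of the matrix matters because an
  analytic code is a tree: membership must be tested on finite initial segments of the point and of
  its witness. The quantifier over solutions is absorbed into the same witness. Finite members serve
  the first three principles because the class must be enumerable while its closure is large. The
  closure is not null since covers of total measure 1/4 fail: prescribing one bit at most doubles
  their relative measure, to 1/2, and the avoiding point keeps it there.\<close>

primrec rename_trm :: "(nat \<Rightarrow> nat) \<Rightarrow> trm \<Rightarrow> trm" where
  "rename_trm f (NVar x) = NVar (f x)"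
| "rename_trm f Zero = Zero"
| "rename_trm f One = One"
| "rename_trm f (Add s t) = Add (rename_trm f s) (rename_trm f t)"
| "rename_trm f (Mul s t) = Mul (rename_trm f s) (rename_trm f t)"

primrec rename_fm :: "(nat \<Rightarrow> nat) \<Rightarrow> (nat \<Rightarrow> nat) \<Rightarrow> fm \<Rightarrow> fm" where
  "rename_fm f g (Eq s t) = Eq (rename_trm f s) (rename_trm f t)"
| "rename_fm f g (Less s t) = Less (rename_trm f s) (rename_trm f t)"
| "rename_fm f g (Mem t X) = Mem (rename_trm f t) (g X)"
| "rename_fm f g (Neg \<phi>) = Neg (rename_fm f g \<phi>)"
| "rename_fm f g (And \<phi> \<psi>) = And (rename_fm f g \<phi>) (rename_fm f g \<psi>)"
| "rename_fm f g (Or \<phi> \<psi>) = Or (rename_fm f g \<phi>) (rename_fm f g \<psi>)"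
| "rename_fm f g (Imp \<phi> \<psi>) = Imp (rename_fm f g \<phi>) (rename_fm f g \<psi>)"
| "rename_fm f g (Iff \<phi> \<psi>) = Iff (rename_fm f g \<phi>) (rename_fm f g \<psi>)"
| "rename_fm f g (AllN x \<phi>) = AllN (f x) (rename_fm f g \<phi>)"
| "rename_fm f g (ExN x \<phi>) = ExN (f x) (rename_fm f g \<phi>)"
| "rename_fm f g (AllS X \<phi>) = AllS (g X) (rename_fm f g \<phi>)"
| "rename_fm f g (ExS X \<phi>) = ExS (g X) (rename_fm f g \<phi>)"

lemma tval_rename_trm: "tval M e (rename_trm f t) = tval M (e \<circ> f) t"
  by (induction t) auto

lemma fun_upd_comp_inj: "inj f \<Longrightarrow> (e(f x := a)) \<circ> f = (e \<circ> f)(x := a)"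
  by (auto simp: fun_eq_iff inj_eq)

text \<open>Injectivity keeps a renamed bound variable distinct from all other renamed variables, so
  updating an assignment commutes with composing it (\<open>fun_upd_comp_inj\<close>) and no capture
  occurs.\<close>

lemma sat_rename_fm:
  assumes "inj f" "inj g"
  shows "sat M e E (rename_fm f g \<phi>) = sat M (e \<circ> f) (E \<circ> g) \<phi>"
  using assms by (induction \<phi> arbitrary: e E) (simp_all add: tval_rename_trm fun_upd_comp_inj)

lemma arithmetical_rename_fm [simp]: "arithmetical (rename_fm f g \<phi>) = arithmetical \<phi>"
  by (induction \<phi>) auto

definition mix :: "(nat \<Rightarrow> 'a) \<Rightarrow> (nat \<Rightarrow> 'a) \<Rightarrow> nat \<Rightarrow> 'a" where
  "mix v e i = (if even i then v (i div 2) else e (i div 2))"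

lemma mix_even [simp]: "mix v e (2 * i) = v i"
  and mix_odd [simp]: "mix v e (Suc (2 * i)) = e i"
  by (auto simp: mix_def)

lemma range_mix: "range (mix v e) \<subseteq> A \<longleftrightarrow> range v \<subseteq> A \<and> range e \<subseteq> A"
proof
  assume a: "range (mix v e) \<subseteq> A"
  have "v i \<in> A" "e i \<in> A" for i
    using a mix_even[of v e i] mix_odd[of v e i] by (metis rangeI subsetD)+
  then show "range v \<subseteq> A \<and> range e \<subseteq> A" by auto
qed (auto simp: mix_def)

lemma mix_upd_0: "(mix v e)(0 := a) = mix (v(0 := a)) e"
  by (auto simp: mix_def fun_eq_iff elim!: evenE)

lemma fun_eq_mixI:
  assumes "\<And>i. f (2 * i) = v i" "\<And>i. f (Suc (2 * i)) = e i"
  shows "f = mix v e"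
proof
  fix n
  show "f n = mix v e n"
    using assms by (cases "even n") (auto elim!: evenE oddE)
qed

named_theorems definable_intros

locale aca =
  fixes M :: "'m l2" (structure)
  assumes ACA0: "ACA0 M"
begin

text \<open>Definability with parameters, for predicates of a number assignment \<open>v\<close> and a set
  assignment \<open>w\<close> which list the free variables in de Bruijn order.  The odd variables of the
  defining formula are reserved for the parameters.\<close>

definition definable :: "((nat \<Rightarrow> 'm) \<Rightarrow> (nat \<Rightarrow> 'm set) \<Rightarrow> bool) \<Rightarrow> bool" where
  "definable P \<longleftrightarrow> (\<exists>\<phi> e E. arithmetical \<phi> \<and> range E \<subseteq> \<S> \<and>
     (\<forall>v w. sat M (mix v e) (mix w E) \<phi> = P v w))"

text \<open>Definability goes through the graph, with the value at position 0, so functions without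
  a term of the language, such as truncated subtraction or minimization, are covered too.\<close>

definition definable_term :: "((nat \<Rightarrow> 'm) \<Rightarrow> (nat \<Rightarrow> 'm set) \<Rightarrow> 'm) \<Rightarrow> bool" where
  "definable_term t \<longleftrightarrow> definable (\<lambda>v w. v 0 = t (\<lambda>i. v (Suc i)) w)"

definition definable_set :: "((nat \<Rightarrow> 'm) \<Rightarrow> (nat \<Rightarrow> 'm set) \<Rightarrow> 'm set) \<Rightarrow> bool" where
  "definable_set U \<longleftrightarrow> definable (\<lambda>v w. v 0 \<in> U (\<lambda>i. v (Suc i)) w)"

lemma definableE:
  assumes "definable P"
  obtains \<phi> E e where "arithmetical \<phi>" "range E \<subseteq> \<S>" "\<forall>v w. sat M (mix v e) (mix w E) \<phi> = P v w"
proof -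
  from assms obtain \<phi> e E where "arithmetical \<phi> \<and> range E \<subseteq> \<S> \<and> (\<forall>v w. sat M (mix v e) (mix w E) \<phi> = P v w)"
    unfolding definable_def by (elim exE)
  then show ?thesis by (intro that[of \<phi> E e]) auto
qed

lemma definableI:
  assumes "arithmetical \<phi>" "range E \<subseteq> \<S>" "\<And>v w. sat M (mix v e) (mix w E) \<phi> = P v w"
  shows "definable P"
  using assms unfolding definable_def by (intro exI[of _ \<phi>] exI[of _ e] exI[of _ E]) simp

text \<open>Binary connectives need one parameter list for both formulas. The two lists are
  interleaved: \<open>f\<close> sends the parameter variable 2i+1 to 4i+1 and \<open>g\<close> sends
  it to 4i+3, while the free variables stay fixed.\<close>

lemma definable_pair:
  assumes "definable P" "definable Q"
  obtains \<phi> \<psi> e E where "arithmetical \<phi>" "arithmetical \<psi>" "range E \<subseteq> \<S>"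
    "\<And>v w. sat M (mix v e) (mix w E) \<phi> = P v w" "\<And>v w. sat M (mix v e) (mix w E) \<psi> = Q v w"
proof -
  from assms(1) obtain \<phi> e E where 1: "arithmetical \<phi>" "range E \<subseteq> \<S>"
    "\<forall>v w. sat M (mix v e) (mix w E) \<phi> = P v w" by (rule definableE)
  from assms(2) obtain \<psi> e' E' where 2: "arithmetical \<psi>" "range E' \<subseteq> \<S>"
    "\<forall>v w. sat M (mix v e') (mix w E') \<psi> = Q v w" by (rule definableE)
  define f :: "nat \<Rightarrow> nat" where "f n = (if even n then n else 2 * n - 1)" for n
  define g :: "nat \<Rightarrow> nat" where "g n = (if even n then n else 2 * n + 1)" for n
  have inj: "inj f" "inj g"
    by (auto simp: inj_def f_def g_def elim!: oddE split: if_splits)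
  have odd_f: "f (Suc (2 * i)) = Suc (2 * (2 * i))" and odd_g: "g (Suc (2 * i)) = Suc (2 * Suc (2 * i))"
    for i by (auto simp: f_def g_def)
  have f: "mix v (mix e e') \<circ> f = mix v e" for v :: "nat \<Rightarrow> 'b" and e e'
    by (rule fun_eq_mixI) (simp_all only: comp_def odd_f mix_odd mix_even, simp add: f_def)
  have g: "mix v (mix e e') \<circ> g = mix v e'" for v :: "nat \<Rightarrow> 'b" and e e'
    by (rule fun_eq_mixI) (simp_all only: comp_def odd_g mix_odd mix_even, simp add: g_def)
  show ?thesis
    by (rule that[of "rename_fm f f \<phi>" "rename_fm g g \<psi>" "mix E E'" "mix e e'"])
      (simp_all add: 1 2 range_mix sat_rename_fm inj f g)
qed

lemma ex_set: "\<exists>X. X \<in> \<S>"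
  using ACA0 by (auto simp: ACA0_def)

lemma definable_not: "definable P \<Longrightarrow> definable (\<lambda>v w. \<not> P v w)"
  by (erule definableE, rule_tac \<phi> = "Neg \<phi>" and e = e and E = E in definableI) simp_all

lemma definable_conj: "definable P \<Longrightarrow> definable Q \<Longrightarrow> definable (\<lambda>v w. P v w \<and> Q v w)"
  by (erule (1) definable_pair, rule_tac \<phi> = "And \<phi> \<psi>" and e = e and E = E in definableI) simp_all

lemma definable_disj: "definable P \<Longrightarrow> definable Q \<Longrightarrow> definable (\<lambda>v w. P v w \<or> Q v w)"
  by (erule (1) definable_pair, rule_tac \<phi> = "Or \<phi> \<psi>" and e = e and E = E in definableI) simp_all

lemma definable_imp: "definable P \<Longrightarrow> definable Q \<Longrightarrow> definable (\<lambda>v w. P v w \<longrightarrow> Q v w)"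
  by (erule (1) definable_pair, rule_tac \<phi> = "Imp \<phi> \<psi>" and e = e and E = E in definableI) simp_all

lemma definable_iff: "definable P \<Longrightarrow> definable Q \<Longrightarrow> definable (\<lambda>v w. P v w \<longleftrightarrow> Q v w)"
  by (erule (1) definable_pair, rule_tac \<phi> = "Iff \<phi> \<psi>" and e = e and E = E in definableI) simp_all

lemma definable_all:
  assumes "definable (\<lambda>v w. P (v 0) (\<lambda>i. v (Suc i)) w)"
  shows "definable (\<lambda>v w. \<forall>a. P a v w)"
proof -
  from assms(1) obtain \<phi> e E where 1: "arithmetical \<phi>" "range E \<subseteq> \<S>"
    "\<forall>v w. sat M (mix v e) (mix w E) \<phi> = P (v 0) (\<lambda>i. v (Suc i)) w" by (rule definableE)
  \<comment> \<open>Variable 0 is to be bound, so it moves to the odd variable 1; the other even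
    variables move down by 2 and the parameters up by 2 to make room. The list
    \<open>case_nat (e 0) e\<close> just fills the freed slot.\<close>
  define f :: "nat \<Rightarrow> nat" where "f n = (if n = 0 then 1 else if even n then n - 2 else n + 2)" for n
  have inj: "inj f"
    unfolding inj_def f_def by presburger
  have f: "((mix v (case_nat (e 0) e))(Suc 0 := a)) \<circ> f = mix (case_nat a v) e" for v a
  proof (rule fun_eq_mixI)
    fix i
    show "(((mix v (case_nat (e 0) e))(Suc 0 := a)) \<circ> f) (2 * i) = (case i of 0 \<Rightarrow> a | Suc x \<Rightarrow> v x)"
      by (cases i) (auto simp: f_def)
    have "f (Suc (2 * i)) = Suc (2 * Suc i)" by (simp add: f_def)
    then show "(((mix v (case_nat (e 0) e))(Suc 0 := a)) \<circ> f) (Suc (2 * i)) = e i"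
      by (simp only: comp_def fun_upd_def mix_odd) simp
  qed
  show ?thesis
    by (rule definableI[of "AllN (Suc 0) (rename_fm f id \<phi>)" E "case_nat (e 0) e"])
      (simp_all add: 1 sat_rename_fm inj f)
qed

lemma definable_ex:
  assumes "definable (\<lambda>v w. P (v 0) (\<lambda>i. v (Suc i)) w)"
  shows "definable (\<lambda>v w. \<exists>a. P a v w)"
  using definable_not[OF definable_all[of "\<lambda>a v w. \<not> P a v w", OF definable_not[OF assms]]] by simp

lemma definable_rename:
  assumes "definable P" "inj r"
  shows "definable (\<lambda>v w. P (\<lambda>i. v (r i)) w)"
proof -
  from assms(1) obtain \<phi> e E where 1: "arithmetical \<phi>" "range E \<subseteq> \<S>"
    "\<forall>v w. sat M (mix v e) (mix w E) \<phi> = P v w" by (rule definableE)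
  define f :: "nat \<Rightarrow> nat" where "f n = (if even n then 2 * r (n div 2) else n)" for n
  have inj: "inj f"
  proof (rule injI)
    fix a b assume eq: "f a = f b"
    have "even (f n) = even n" for n by (simp add: f_def)
    from this[of a] this[of b] eq have "even a = even b" by simp
    then show "a = b"
      using eq injD[OF assms(2), of "a div 2" "b div 2"] by (cases "even a") (auto simp: f_def elim!: evenE)
  qed
  have f: "mix v e \<circ> f = mix (\<lambda>i. v (r i)) e" for v
    by (rule fun_eq_mixI) (auto simp: f_def)
  show ?thesis
    by (rule definableI[of "rename_fm f id \<phi>" E e]) (simp_all add: 1 sat_rename_fm inj f)
qed

lemma definable_shift: "definable P \<Longrightarrow> definable (\<lambda>v w. P (\<lambda>i. v (Suc i)) w)"
  by (erule definable_rename) auto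

lemma definable_atom:
  assumes "arithmetical \<phi>" "\<And>v w X. sat M (mix v (\<lambda>_. c)) (mix w (\<lambda>_. X)) \<phi> = P v w"
  shows "definable P"
proof -
  obtain X where "X \<in> \<S>" using ex_set by blast
  then show ?thesis
    using assms by (intro definableI[of \<phi> "\<lambda>_. X" "\<lambda>_. c"]) auto
qed

lemma definable_var_eq: "definable (\<lambda>v w. v i = v j)"
  by (rule definable_atom[of "Eq (NVar (2 * i)) (NVar (2 * j))"]) simp_all

lemma definable_var_less: "definable (\<lambda>v w. v i \<prec> v j)"
  by (rule definable_atom[of "Less (NVar (2 * i)) (NVar (2 * j))"]) simp_all

lemma definable_var_eq_add: "definable (\<lambda>v w. v i = v j \<oplus> v k)"
  by (rule definable_atom[of "Eq (NVar (2 * i)) (Add (NVar (2 * j)) (NVar (2 * k)))"]) simp_all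

lemma definable_var_eq_mul: "definable (\<lambda>v w. v i = v j \<otimes> v k)"
  by (rule definable_atom[of "Eq (NVar (2 * i)) (Mul (NVar (2 * j)) (NVar (2 * k)))"]) simp_all

lemma definable_var_eq_const: "definable (\<lambda>v w. v i = c)"
  by (rule definable_atom[of "Eq (NVar (2 * i)) (NVar (Suc (2 * 0)))" c])
    (simp_all only: mix_even mix_odd sat.simps tval.simps arithmetical.simps)

lemma definable_var_mem_var: "definable (\<lambda>v w. v i \<in> w j)"
  by (rule definable_atom[of "Mem (NVar (2 * i)) (2 * j)"]) simp_all

lemma definable_var_mem_const: "X \<in> \<S> \<Longrightarrow> definable (\<lambda>v w. v i \<in> X)"
  by (rule definableI[of "Mem (NVar (2 * i)) (Suc (2 * 0))" "\<lambda>_. X" undefined])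
    (simp_all only: mix_even mix_odd sat.simps tval.simps arithmetical.simps, auto)

lemma definable_const: "definable (\<lambda>v w. b)"
  by (rule definable_atom[of "if b then Eq Zero Zero else Neg (Eq Zero Zero)"]) simp_all

lemma definable_subst_term:
  assumes "definable_term t" "definable (\<lambda>v w. P (v 0) (\<lambda>i. v (Suc i)) w)"
  shows "definable (\<lambda>v w. P (t v w) v w)"
proof -
  have "definable (\<lambda>v w. \<exists>a. a = t v w \<and> P a v w)"
    using assms unfolding definable_term_def by (intro definable_ex definable_conj)
  then show ?thesis by simp
qed

lemma definable_term_shift:
  assumes "definable_term t"
  shows "definable_term (\<lambda>v w. t (\<lambda>i. v (Suc i)) w)"
proof -
  \<comment> \<open>This renaming keeps the value at position 0 and skips position 1, where the new
    variable enters.\<close>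
  have "inj (case_nat 0 (\<lambda>i. Suc (Suc i)))"
    by (auto simp: inj_def split: nat.splits)
  from definable_rename[OF assms[unfolded definable_term_def] this] show ?thesis
    unfolding definable_term_def by simp
qed

lemma definable_term_var: "definable_term (\<lambda>v w. v i)"
  unfolding definable_term_def by (rule definable_var_eq)

lemma definable_term_const: "definable_term (\<lambda>v w. c)"
  unfolding definable_term_def by (rule definable_var_eq_const)

lemma definable_eq: "definable_term s \<Longrightarrow> definable_term t \<Longrightarrow> definable (\<lambda>v w. s v w = t v w)"
  by (rule definable_subst_term[where t = s]) (simp_all add: definable_term_def)

lemma definable_less:
  assumes "definable_term s" "definable_term t"
  shows "definable (\<lambda>v w. s v w \<prec> t v w)"
  by (rule definable_subst_term[OF assms(1)], 
      rule definable_subst_term[OF definable_term_shift[OF assms(2)]])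
    (rule definable_var_less)

lemma definable_term_add:
  assumes "definable_term s" "definable_term t"
  shows "definable_term (\<lambda>v w. s v w \<oplus> t v w)"
  unfolding definable_term_def
  by (rule definable_subst_term[OF definable_term_shift[OF assms(1)]], 
      rule definable_subst_term[OF definable_term_shift[OF definable_term_shift[OF assms(2)]]])
    (rule definable_var_eq_add)

lemma definable_term_mul:
  assumes "definable_term s" "definable_term t"
  shows "definable_term (\<lambda>v w. s v w \<otimes> t v w)"
  unfolding definable_term_def
  by (rule definable_subst_term[OF definable_term_shift[OF assms(1)]], 
      rule definable_subst_term[OF definable_term_shift[OF definable_term_shift[OF assms(2)]]])
    (rule definable_var_eq_mul)

lemma definable_mem: "definable_term t \<Longrightarrow> definable_set U \<Longrightarrow> definable (\<lambda>v w. t v w \<in> U v w)"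
  by (rule definable_subst_term[where t = t]) (simp_all add: definable_set_def)

lemma definable_set_var: "definable_set (\<lambda>v w. w j)"
  unfolding definable_set_def by (rule definable_var_mem_var)

lemma definable_set_const: "X \<in> \<S> \<Longrightarrow> definable_set (\<lambda>v w. X)"
  unfolding definable_set_def by (rule definable_var_mem_const)

lemma definable_set_shift:
  assumes "definable_set t"
  shows "definable_set (\<lambda>v w. t (\<lambda>i. v (Suc i)) w)"
proof -
  have "inj (case_nat 0 (\<lambda>i. Suc (Suc i)))"
    by (auto simp: inj_def split: nat.splits)
  from definable_rename[OF assms[unfolded definable_set_def] this] show ?thesis
    unfolding definable_set_def by simp
qed

lemma definable_set_Collect:
  assumes "definable (\<lambda>v w. P (v 0) (\<lambda>i. v (Suc i)) w)"
  shows "definable_set (\<lambda>v w. {a. P a v w})"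
  using assms by (simp add: definable_set_def)

lemma definable_if:
  assumes "definable P" "definable Q" "definable R"
  shows "definable (\<lambda>v w. if P v w then Q v w else R v w)"
proof -
  have "definable (\<lambda>v w. (P v w \<and> Q v w) \<or> (\<not> P v w \<and> R v w))"
    by (intro definable_disj definable_conj definable_not assms)
  moreover have "(\<lambda>v w. (P v w \<and> Q v w) \<or> (\<not> P v w \<and> R v w)) = (\<lambda>v w. if P v w then Q v w else R v w)"
    by auto
  ultimately show ?thesis by simp
qed

lemma definable_term_if:
  assumes "definable P" "definable_term s" "definable_term t"
  shows "definable_term (\<lambda>v w. if P v w then s v w else t v w)"
  using definable_if[OF definable_shift[OF assms(1)] assms(2,3)[unfolded definable_term_def]]
  by (simp add: definable_term_def if_distrib)

lemma definable_ball:
  assumes "definable_set U" "definable (\<lambda>v w. P (v 0) (\<lambda>i. v (Suc i)) w)"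
  shows "definable (\<lambda>v w. \<forall>a\<in>U v w. P a v w)"
  unfolding Ball_def
  by (intro definable_all definable_imp assms(2) definable_mem definable_term_var definable_set_shift assms(1))

lemma definable_bex:
  assumes "definable_set U" "definable (\<lambda>v w. P (v 0) (\<lambda>i. v (Suc i)) w)"
  shows "definable (\<lambda>v w. \<exists>a\<in>U v w. P a v w)"
  unfolding Bex_def
  by (intro definable_ex definable_conj assms(2) definable_mem definable_term_var definable_set_shift assms(1))

lemma definable_set_eq:
  assumes "definable_set U" "definable_set V"
  shows "definable (\<lambda>v w. U v w = V v w)"
  unfolding set_eq_iff
  by (intro definable_all definable_iff definable_mem definable_term_var definable_set_shift assms)

lemma definable_ex1:
  assumes "definable (\<lambda>v w. P (v 0) (\<lambda>i. v (Suc i)) w)"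
  shows "definable (\<lambda>v w. \<exists>!a. P a v w)"
proof -
  have "inj (case_nat 0 (\<lambda>i. Suc (Suc i)))"
    by (auto simp: inj_def split: nat.splits)
  from definable_rename[OF assms this] show ?thesis
    unfolding Ex1_def
    by (intro definable_ex definable_conj definable_all definable_imp definable_eq definable_term_var assms) simp
qed

lemmas [definable_intros] = definable_not definable_conj definable_disj definable_imp definable_iff
  definable_all definable_ex definable_ball definable_bex definable_ex1 definable_if
  definable_const definable_eq definable_less definable_mem
  definable_term_var definable_term_const definable_term_add definable_term_mul definable_term_if
  definable_set_var definable_set_const definable_set_Collect

lemma definable_tval:
  "(\<And>i. definable_term (\<lambda>v w. \<epsilon> v w i)) \<Longrightarrow> definable_term (\<lambda>v w. tval M (\<epsilon> v w) t)"
  by (induction t) (auto intro: definable_term_const definable_term_add definable_term_mul)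

text \<open>Does the work of substituting terms and sets into a formula, but on the semantic side:
  under a number quantifier the new variable is position 0 and the substituted items are shifted, so
  capture cannot arise.\<close>

lemma definable_sat:
  assumes "arithmetical \<phi>"
    and "\<And>i. definable_term (\<lambda>v w. \<epsilon> v w i)" and "\<And>j. definable_set (\<lambda>v w. \<E> v w j)"
  shows "definable (\<lambda>v w. sat M (\<epsilon> v w) (\<E> v w) \<phi>)"
  using assms
proof (induction \<phi> arbitrary: \<epsilon> \<E>)
  case (AllN x \<phi>)
  have "definable (\<lambda>v w. sat M ((\<epsilon> (\<lambda>i. v (Suc i)) w)(x := v 0)) (\<E> (\<lambda>i. v (Suc i)) w) \<phi>)"
  proof (rule AllN.IH)
    show "definable_term (\<lambda>v w. ((\<epsilon> (\<lambda>i. v (Suc i)) w)(x := v 0)) i)" for i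
      using definable_term_shift[OF AllN.prems(2)[of i]] by (cases "i = x") (simp_all add: definable_term_var)
  qed (use AllN.prems in \<open>auto intro: definable_set_shift\<close>)
  then show ?case by (simp add: definable_all)
next
  case (ExN x \<phi>)
  have "definable (\<lambda>v w. sat M ((\<epsilon> (\<lambda>i. v (Suc i)) w)(x := v 0)) (\<E> (\<lambda>i. v (Suc i)) w) \<phi>)"
  proof (rule ExN.IH)
    show "definable_term (\<lambda>v w. ((\<epsilon> (\<lambda>i. v (Suc i)) w)(x := v 0)) i)" for i
      using definable_term_shift[OF ExN.prems(2)[of i]] by (cases "i = x") (simp_all add: definable_term_var)
  qed (use ExN.prems in \<open>auto intro: definable_set_shift\<close>)
  then show ?case by (simp add: definable_ex)
qed (simp_all add: definable_intros definable_tval)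

lemma definable_subst:
  assumes "definable P"
    and "\<And>i. definable_term (\<lambda>v w. \<epsilon> v w i)" and "\<And>j. definable_set (\<lambda>v w. \<E> v w j)"
  shows "definable (\<lambda>v w. P (\<epsilon> v w) (\<E> v w))"
proof -
  from assms(1) obtain \<phi> e E where 1: "arithmetical \<phi>" "range E \<subseteq> \<S>"
    "\<forall>v w. sat M (mix v e) (mix w E) \<phi> = P v w" by (rule definableE)
  have "definable (\<lambda>v w. sat M (mix (\<epsilon> v w) e) (mix (\<E> v w) E) \<phi>)"
  proof (rule definable_sat[OF 1(1)])
    show "definable_term (\<lambda>v w. mix (\<epsilon> v w) e i)" for i
      using assms(2) by (cases "even i") (simp_all add: mix_def definable_term_const)
    show "definable_set (\<lambda>v w. mix (\<E> v w) E j)" for j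
    proof -
      have "E (j div 2) \<in> \<S>" using 1(2) by auto
      then show ?thesis using assms(3) by (cases "even j") (simp_all add: mix_def definable_set_const)
    qed
  qed
  then show ?thesis by (simp add: 1)
qed

lemma comprehension:
  assumes "definable (\<lambda>v w. P (v 0))"
  shows "{x. P x} \<in> \<S>"
proof -
  from assms(1) obtain \<phi> e E where 1: "arithmetical \<phi>" "range E \<subseteq> \<S>"
    "\<forall>v w. sat M (mix v e) (mix w E) \<phi> = P (v 0)" by (rule definableE)
  \<comment> \<open>Comprehension needs full assignments; \<open>e\<close> and \<open>E\<close> also
    fill the even slots, which keeps the set assignment inside \<open>\<S>\<close>.\<close>
  have "range (mix E E) \<subseteq> \<S>" using 1 by (simp add: range_mix)
  with 1(1) ACA0 have "\<exists>Z \<in> \<S>. \<forall>n. n \<in> Z \<longleftrightarrow> sat M ((mix e e)(0 := n)) (mix E E) \<phi>"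
    by (auto simp: ACA0_def arithmetical_comprehension_def)
  then have "\<exists>Z \<in> \<S>. \<forall>n. n \<in> Z \<longleftrightarrow> P n"
    by (simp add: mix_upd_0 1)
  moreover have "Z = {x. P x}" if "\<forall>n. n \<in> Z \<longleftrightarrow> P n" for Z using that by auto
  ultimately show ?thesis by metis
qed

lemma definable_set_in: "definable_set (\<lambda>v w. U) \<Longrightarrow> U \<in> \<S>"
  using comprehension[of "\<lambda>x. x \<in> U"] by (simp add: definable_set_def)

text \<open>The induction rule for a possibly nonstandard number sort: the predicate has to define a
  set of the structure. Hence each use below also discharges a definability goal.\<close>

lemma definable_induct [case_names def zero step]:
  assumes "definable (\<lambda>v w. P (v 0))" "P \<zero>" "\<And>n. P n \<Longrightarrow> P (n \<oplus> \<one>)"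
  shows "P n"
  using comprehension[OF assms(1)] ACA0 assms(2,3) by (auto simp: ACA0_def induction_axiom_def)

lemma Sigma11_AC_D:
  assumes "Sigma11_AC M" and "definable (\<lambda>v w. P (v 0) (w 0) (w 1))"
    and ex: "\<And>n. \<exists>X\<in>\<S>. \<exists>Y\<in>\<S>. P n X Y"
  obtains Z where "Z \<in> \<S>" "\<And>n. \<exists>Y\<in>\<S>. P n (nth_set M Z n) Y"
proof -
  from assms(2) obtain \<phi> e E where 1: "arithmetical \<phi>" "range E \<subseteq> \<S>"
    "\<forall>v w. sat M (mix v e) (mix w E) \<phi> = P (v 0) (w 0) (w 1)" by (rule definableE)
  \<comment> \<open>Variables 0 and 2 of the formula are positions 0 and 1 of \<open>w\<close>: the
    first is the set to be chosen, the second the set bound by \<open>ExS\<close>.\<close>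
  have 2: "(mix (E(0 := X)) E)(2 := Y) = mix (E(0 := X, 1 := Y)) E" for X Y
    by (auto simp: fun_eq_iff mix_def elim!: evenE)
  have *: "sat M ((mix e e)(0 := n)) ((mix E E)(0 := X)) (ExS 2 \<phi>) \<longleftrightarrow> (\<exists>Y\<in>\<S>. P n X Y)" for n X
    by (simp add: 2 mix_upd_0 1)
  have "sigma11 (ExS 2 \<phi>)" using 1 by (simp add: sigma11_def)
  moreover have "range (mix E E) \<subseteq> \<S>" using 1 by (simp add: range_mix)
  ultimately show ?thesis
    using assms(1)[unfolded Sigma11_AC_def, rule_format, of "ExS 2 \<phi>" "mix E E" "mix e e" 0 0] ex that
    unfolding * by blast
qed

section \<open>Arithmetic\<close>

abbreviation less_eq (infix "\<preceq>" 50) where "a \<preceq> b \<equiv> l2_le M a b"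

lemma
  succ_neq_zero: "n \<oplus> \<one> \<noteq> \<zero>" and
  succ_inject: "m \<oplus> \<one> = n \<oplus> \<one> \<Longrightarrow> m = n" and
  add_zero: "m \<oplus> \<zero> = m" and
  add_succ: "m \<oplus> (n \<oplus> \<one>) = (m \<oplus> n) \<oplus> \<one>" and
  mul_zero: "m \<otimes> \<zero> = \<zero>" and
  mul_succ: "m \<otimes> (n \<oplus> \<one>) = (m \<otimes> n) \<oplus> m" and
  not_less_zero: "\<not> m \<prec> \<zero>" and
  less_succ: "m \<prec> n \<oplus> \<one> \<longleftrightarrow> m \<prec> n \<or> m = n"
  using ACA0 unfolding ACA0_def basic_axioms_def by blast+

lemma add_assoc: "(a \<oplus> b) \<oplus> c = a \<oplus> (b \<oplus> c)"
  by (induction c rule: definable_induct) (intro definable_intros, auto simp: add_zero add_succ)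

lemma zero_add: "\<zero> \<oplus> a = a"
  by (induction a rule: definable_induct) (intro definable_intros, auto simp: add_zero add_succ)

lemma one_add: "\<one> \<oplus> a = a \<oplus> \<one>"
  by (induction a rule: definable_induct) (intro definable_intros, auto simp: add_zero zero_add add_succ)

lemma succ_add: "(a \<oplus> \<one>) \<oplus> b = (a \<oplus> b) \<oplus> \<one>"
  by (metis add_assoc one_add)

lemma add_comm: "a \<oplus> b = b \<oplus> a"
  by (induction b rule: definable_induct) (intro definable_intros, auto simp: add_zero zero_add add_succ succ_add)

lemma zero_mul: "\<zero> \<otimes> a = \<zero>"
  by (induction a rule: definable_induct) (intro definable_intros, auto simp: mul_zero mul_succ add_zero)

lemma one_mul: "\<one> \<otimes> a = a"
  by (induction a rule: definable_induct) (intro definable_intros, auto simp: mul_zero mul_succ)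

lemma add_mul: "(a \<oplus> b) \<otimes> c = a \<otimes> c \<oplus> b \<otimes> c"
proof (induction c rule: definable_induct)
  case (step c)
  then show ?case by (simp add: mul_succ) (metis add_assoc add_comm)
qed (intro definable_intros, auto simp: mul_zero add_zero)

lemma mul_comm: "a \<otimes> b = b \<otimes> a"
  by (induction b rule: definable_induct) (intro definable_intros, auto simp: mul_zero zero_mul mul_succ add_mul one_mul)

lemma mul_assoc: "(a \<otimes> b) \<otimes> c = a \<otimes> (b \<otimes> c)"
proof (induction c rule: definable_induct)
  case (step c)
  then show ?case using add_mul[of _ _ a] by (simp add: mul_succ mul_comm[of a])
qed (intro definable_intros, simp add: mul_zero)

lemma add_right_cancel: "a \<oplus> c = b \<oplus> c \<Longrightarrow> a = b"
  by (induction c rule: definable_induct) (intro definable_intros, auto simp: add_zero add_succ dest: succ_inject)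

lemma zero_or_succ: "a = \<zero> \<or> (\<exists>b. a = b \<oplus> \<one>)"
  by (induction a rule: definable_induct) (intro definable_intros, auto)

text \<open>The axioms give \<open>\<prec>\<close> only through recursion in its right argument;
  with this form order facts reduce to equations between sums.\<close>

lemma less_iff_add: "a \<prec> b \<longleftrightarrow> (\<exists>c. b = a \<oplus> (c \<oplus> \<one>))"
proof (induction b rule: definable_induct)
  case zero
  then show ?case by (metis add_succ not_less_zero succ_neq_zero)
next
  case (step b)
  show ?case
  proof
    assume "a \<prec> b \<oplus> \<one>"
    then consider "a \<prec> b" | "a = b" by (auto simp: less_succ)
    then show "\<exists>c. b \<oplus> \<one> = a \<oplus> (c \<oplus> \<one>)"
    proof cases
      case 1
      then show ?thesis using step by (metis add_succ)
    next
      case 2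
      then show ?thesis by (metis zero_add)
    qed
  next
    assume "\<exists>c. b \<oplus> \<one> = a \<oplus> (c \<oplus> \<one>)"
    then obtain c where "b = a \<oplus> c" by (metis add_succ succ_inject)
    then show "a \<prec> b \<oplus> \<one>" using step zero_or_succ[of c] by (auto simp: less_succ add_zero)
  qed
qed (intro definable_intros)

lemma le_iff_add: "a \<preceq> b \<longleftrightarrow> (\<exists>c. b = a \<oplus> c)"
  unfolding l2_le_def less_iff_add using zero_or_succ by (metis add_zero)

lemma less_cases: "a \<prec> b \<or> a = b \<or> b \<prec> a"
proof (induction a rule: definable_induct)
  case zero
  then show ?case by (metis less_iff_add zero_add zero_or_succ)
next
  case (step a)
  consider "a = b" | "b \<prec> a" | c where "b = a \<oplus> (c \<oplus> \<one>)"
    using step less_iff_add by blast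
  then show ?case
  proof cases
    case 3
    then have "b = (a \<oplus> \<one>) \<oplus> c" by (metis add_assoc add_comm)
    then show ?thesis using zero_or_succ[of c] less_iff_add add_zero by auto
  qed (auto simp: less_succ)
qed (intro definable_intros)

lemma add_succ_neq: "a \<oplus> (c \<oplus> \<one>) \<noteq> a"
  by (metis add_comm add_right_cancel succ_neq_zero zero_add)

lemma less_irrefl: "\<not> a \<prec> a"
  using less_iff_add add_succ_neq by metis

lemma less_trans: "a \<prec> b \<Longrightarrow> b \<prec> c \<Longrightarrow> a \<prec> c"
  unfolding less_iff_add by (metis add_assoc)

definition diff :: "'m \<Rightarrow> 'm \<Rightarrow> 'm" (infixl "\<ominus>" 65) where
  "a \<ominus> b = (if b \<preceq> a then THE c. c \<oplus> b = a else \<zero>)"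

lemma add_diff_cancel_right: "a \<oplus> b \<ominus> b = a"
proof -
  have "b \<preceq> a \<oplus> b" using add_comm le_iff_add by metis
  moreover have "(THE c. c \<oplus> b = a \<oplus> b) = a" by (rule the_equality) (auto dest: add_right_cancel)
  ultimately show ?thesis by (simp add: diff_def)
qed

text \<open>Eliminates the definite description in \<open>diff\<close>, which is what makes the
  graph of truncated subtraction definable.\<close>

lemma diff_eq_iff: "c = a \<ominus> b \<longleftrightarrow> (b \<preceq> a \<and> c \<oplus> b = a) \<or> (a \<prec> b \<and> c = \<zero>)"
proof (cases "b \<preceq> a")
  case True
  then obtain d where "a = d \<oplus> b" using le_iff_add add_comm by metis
  then show ?thesis using True add_diff_cancel_right add_right_cancel less_trans less_irrefl
    by (metis l2_le_def)
next
  case False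
  then show ?thesis using less_cases by (auto simp: diff_def l2_le_def)
qed

text \<open>The HOL lemmas on ordered semidomains become available for the number sort under the
  prefix \<open>N\<close>; \<open>\<ominus>\<close> was introduced because this class asks for a
  subtraction.\<close>

sublocale N: linordered_semidom where plus = "(\<oplus>)" and zero = "\<zero>" and minus = diff
  and times = "(\<otimes>)" and one = "\<one>" and less_eq = "l2_le M" and less = "(\<prec>)"
proof
  fix a b c :: 'm
  show "a \<otimes> b \<otimes> c = a \<otimes> (b \<otimes> c)" by (rule mul_assoc)
  show "a \<otimes> b = b \<otimes> a" by (rule mul_comm)
  show "\<one> \<otimes> a = a" by (rule one_mul)
  show "a \<oplus> b \<oplus> c = a \<oplus> (b \<oplus> c)" by (rule add_assoc)
  show "a \<oplus> b = b \<oplus> a" by (rule add_comm)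
  show "\<zero> \<oplus> a = a" by (rule zero_add)
  show "(a \<oplus> b) \<otimes> c = a \<otimes> c \<oplus> b \<otimes> c" by (rule add_mul)
  show "\<zero> \<otimes> a = \<zero>" by (rule zero_mul)
  show "a \<otimes> \<zero> = \<zero>" by (rule mul_zero)
  show "\<zero> \<noteq> \<one>" by (metis zero_add succ_neq_zero)
  show "a \<oplus> b \<ominus> a = b" by (metis add_comm add_diff_cancel_right)
  show "a \<ominus> b \<ominus> c = a \<ominus> (b \<oplus> c)"
  proof (cases "b \<oplus> c \<preceq> a")
    case True
    then obtain d where "a = d \<oplus> c \<oplus> b" by (metis le_iff_add add_comm add_assoc)
    then show ?thesis by (metis add_diff_cancel_right add_comm add_assoc)
  next
    case False
    then have 1: "a \<ominus> (b \<oplus> c) = \<zero>" by (simp add: diff_def)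
    show ?thesis
    proof (cases "b \<preceq> a")
      case True
      then obtain e where e: "a = e \<oplus> b" by (metis le_iff_add add_comm)
      have "\<not> c \<preceq> e" using False e le_iff_add add_assoc add_comm by metis
      then have "e \<ominus> c = \<zero>" by (simp add: diff_def)
      then show ?thesis using 1 e add_diff_cancel_right by metis
    next
      case False
      then have "a \<ominus> b = \<zero>" by (simp add: diff_def)
      moreover have "\<zero> \<ominus> c = \<zero>"
        by (metis diff_def add_diff_cancel_right add_zero l2_le_def not_less_zero)
      ultimately show ?thesis using 1 by simp
    qed
  qed
  show "a \<preceq> a" by (simp add: l2_le_def)
  show "(a \<prec> b) = (a \<preceq> b \<and> \<not> b \<preceq> a)" using less_irrefl less_trans by (auto simp: l2_le_def)
  show "a \<preceq> b \<Longrightarrow> b \<preceq> c \<Longrightarrow> a \<preceq> c" using less_trans by (auto simp: l2_le_def)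
  show "a \<preceq> b \<Longrightarrow> b \<preceq> a \<Longrightarrow> a = b" using less_irrefl less_trans by (auto simp: l2_le_def)
  show "a \<preceq> b \<or> b \<preceq> a" using less_cases by (auto simp: l2_le_def)
  show "a \<preceq> b \<Longrightarrow> c \<oplus> a \<preceq> c \<oplus> b" by (metis le_iff_add add_assoc)
  show "\<zero> \<prec> \<one>" by (metis less_iff_add zero_add)
  show "a \<prec> b \<Longrightarrow> \<zero> \<prec> c \<Longrightarrow> c \<otimes> a \<prec> c \<otimes> b"
  proof -
    assume "a \<prec> b" "\<zero> \<prec> c"
    then obtain d e where "b = a \<oplus> (d \<oplus> \<one>)" "c = e \<oplus> \<one>" unfolding less_iff_add zero_add by blast
    then have "b \<otimes> c = a \<otimes> c \<oplus> ((d \<otimes> c \<oplus> e) \<oplus> \<one>)"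
      by (simp only: add_mul one_mul add_assoc)
    then show "c \<otimes> a \<prec> c \<otimes> b" unfolding less_iff_add mul_comm[of c] by blast
  qed
  show "b \<preceq> a \<Longrightarrow> a \<ominus> b \<oplus> b = a" using diff_eq_iff less_irrefl less_trans l2_le_def by metis
  show "a \<noteq> \<zero> \<Longrightarrow> b \<noteq> \<zero> \<Longrightarrow> a \<otimes> b \<noteq> \<zero>" 
    by (metis zero_or_succ mul_succ add_succ succ_neq_zero)
  show mul_add: "a \<otimes> (b \<oplus> c) = a \<otimes> b \<oplus> a \<otimes> c" for a b c by (metis add_mul mul_comm)
  show "a \<otimes> (b \<ominus> c) = a \<otimes> b \<ominus> a \<otimes> c"
  proof (cases "c \<preceq> b")
    case True
    then obtain d where "b = d \<oplus> c" by (metis le_iff_add add_comm)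
    then show ?thesis using mul_add add_diff_cancel_right by metis
  next
    case False
    then have "b \<ominus> c = \<zero>" by (simp add: diff_def)
    moreover from False obtain d where "c = b \<oplus> d" using less_cases less_iff_add by (metis l2_le_def)
    then have "a \<otimes> b \<preceq> a \<otimes> c" using mul_add le_iff_add by metis
    then have "a \<otimes> b \<ominus> a \<otimes> c = \<zero>"
      by (metis l2_le_def diff_eq_iff zero_add)
    ultimately show ?thesis by (simp add: mul_zero)
  qed
qed


lemma zero_le [simp]: "\<zero> \<preceq> a"
  by (metis le_iff_add zero_add)

lemma less_succ_iff_le: "a \<prec> b \<oplus> \<one> \<longleftrightarrow> a \<preceq> b"
  by (simp add: less_succ l2_le_def)

lemma succ_le_iff_less: "a \<oplus> \<one> \<preceq> b \<longleftrightarrow> a \<prec> b"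
  by (metis N.not_less less_succ_iff_le)

lemma definable_le [definable_intros]:
  assumes "definable_term s" "definable_term t"
  shows "definable (\<lambda>v w. s v w \<preceq> t v w)"
  unfolding l2_le_def by (intro definable_intros assms)

lemma definable_term_diff [definable_intros]:
  assumes "definable_term s" "definable_term t"
  shows "definable_term (\<lambda>v w. s v w \<ominus> t v w)"
  unfolding definable_term_def diff_eq_iff by (intro definable_intros definable_term_shift assms)

lemma definable_term_pair [definable_intros]:
  assumes "definable_term s" "definable_term t"
  shows "definable_term (\<lambda>v w. pair M (s v w) (t v w))"
  unfolding pair_def by (intro definable_intros assms)

lemma definable_set_nth_set [definable_intros]:
  assumes "definable_set U" "definable_term t"
  shows "definable_set (\<lambda>v w. nth_set M (U v w) (t v w))"
  unfolding nth_set_def by (intro definable_intros definable_set_shift definable_term_shift assms)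

lemma definable_set_coded_set [definable_intros]:
  assumes "definable_term t"
  shows "definable_set (\<lambda>v w. coded_set M (t v w))"
  unfolding coded_set_def by (intro definable_intros definable_term_shift assms)

lemma definable_is_code [definable_intros]:
  assumes "definable_term t"
  shows "definable (\<lambda>v w. is_code M (t v w))"
  unfolding is_code_def by (intro definable_intros definable_set_eq definable_term_shift assms)

lemma definable_is_seq [definable_intros]:
  assumes "definable_term s" "definable_term t"
  shows "definable (\<lambda>v w. is_seq M (s v w) (t v w))"
  unfolding is_seq_def by (intro definable_intros definable_term_shift assms)

lemma definable_is_bin_seq [definable_intros]:
  assumes "definable_term s" "definable_term t"
  shows "definable (\<lambda>v w. is_bin_seq M (s v w) (t v w))"
  unfolding is_bin_seq_def by (intro definable_intros definable_term_shift assms)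

text \<open>With s = i + j the pair lies between s^2 and s^2 + s, and s^2 + s is below (s+1)^2. So
  the blocks of pairs with different sums are disjoint and ordered by the sum.\<close>

lemma pair_less_pairI:
  assumes "i \<oplus> j \<prec> i' \<oplus> j'"
  shows "pair M i j \<prec> pair M i' j'"
proof -
  let ?s = "i \<oplus> j" and ?t = "i' \<oplus> j'"
  have "?s \<oplus> \<one> \<preceq> ?t" using assms by (simp add: succ_le_iff_less)
  then have "(?s \<oplus> \<one>) \<otimes> (?s \<oplus> \<one>) \<preceq> ?t \<otimes> ?t" by (intro N.mult_mono) auto
  moreover have "?t \<otimes> ?t \<preceq> pair M i' j'" unfolding pair_def using le_iff_add by blast
  moreover have "(?s \<oplus> \<one>) \<otimes> (?s \<oplus> \<one>) = ?s \<otimes> ?s \<oplus> ?s \<oplus> (?s \<oplus> \<one>)"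
    by (simp add: N.distrib_left N.distrib_right N.add_ac)
  moreover have "pair M i j \<preceq> ?s \<otimes> ?s \<oplus> ?s"
    unfolding pair_def using le_iff_add by (intro N.add_left_mono) blast
  moreover have "?s \<otimes> ?s \<oplus> ?s \<prec> ?s \<otimes> ?s \<oplus> ?s \<oplus> (?s \<oplus> \<one>)" using less_iff_add by blast
  ultimately show ?thesis by (metis N.le_less_trans N.less_le_trans)
qed

lemma pair_inject [simp]: "pair M i j = pair M i' j' \<longleftrightarrow> i = i' \<and> j = j'"
proof
  assume eq: "pair M i j = pair M i' j'"
  then have *: "i \<oplus> j = i' \<oplus> j'" using pair_less_pairI less_cases less_irrefl by metis
  then have "i = i'" using eq unfolding pair_def by simp
  then show "i = i' \<and> j = j'" using * by simp
qed auto

lemma pair_strict_mono: "i \<prec> i' \<Longrightarrow> pair M i j \<prec> pair M i' j"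
  by (intro pair_less_pairI) simp

lemma least_number:
  assumes "definable (\<lambda>v w. P (v 0))" "P n"
  obtains m where "P m" "\<And>k. k \<prec> m \<Longrightarrow> \<not> P k"
proof (rule ccontr)
  note obtain_least = that
  assume "\<not> thesis"
  then have *: "\<exists>k. k \<prec> m \<and> P k" if "P m" for m using that obtain_least by blast
  have "\<forall>k. k \<prec> m \<longrightarrow> \<not> P k" for m
  proof (induction m rule: definable_induct)
    case def
    show ?case by (intro definable_intros assms(1))
  next
    case (step m)
    then show ?case using * by (auto simp: less_succ)
  qed (simp add: not_less_zero)
  then show False using assms(2) less_succ by blast
qed

text \<open>Least witnesses replace \<open>SOME\<close>, since their graph is arithmetical in
  \<open>R\<close>. The existence test fixes the value for every \<open>R\<close>: a predicate that
  defines no set of the structure may be satisfiable without a least witness, and then the value is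
  \<zero>.\<close>

definition mu :: "('m \<Rightarrow> bool) \<Rightarrow> 'm" where
  "mu R = (if \<exists>a. R a \<and> (\<forall>k. k \<prec> a \<longrightarrow> \<not> R k) then THE a. R a \<and> (\<forall>k. k \<prec> a \<longrightarrow> \<not> R k) else \<zero>)"

lemma mu_eqI:
  assumes "R a" "\<And>k. k \<prec> a \<Longrightarrow> \<not> R k"
  shows "mu R = a"
proof -
  have "(THE a. R a \<and> (\<forall>k. k \<prec> a \<longrightarrow> \<not> R k)) = a"
    using assms less_cases by (intro the_equality) blast+
  then show ?thesis using assms by (auto simp: mu_def)
qed

lemma mu_unique: "R a \<Longrightarrow> (\<And>b. R b \<Longrightarrow> b = a) \<Longrightarrow> mu R = a"
  using less_irrefl by (intro mu_eqI) blast+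

lemma mu_holds:
  assumes "definable (\<lambda>v w. R (v 0))" "R n"
  shows "R (mu R)"
  using least_number[OF assms] mu_eqI[of R] by metis

lemma eq_mu_iff: "y = mu R \<longleftrightarrow> (R y \<and> (\<forall>k. k \<prec> y \<longrightarrow> \<not> R k)) \<or>
    (\<not> (\<exists>a. R a \<and> (\<forall>k. k \<prec> a \<longrightarrow> \<not> R k)) \<and> y = \<zero>)"
proof (cases "\<exists>a. R a \<and> (\<forall>k. k \<prec> a \<longrightarrow> \<not> R k)")
  case True
  then show ?thesis using mu_eqI by metis
next
  case False
  then show ?thesis unfolding mu_def if_not_P[OF False] by blast
qed

lemma definable_term_mu [definable_intros]:
  assumes "definable (\<lambda>v w. R (v 0) (\<lambda>i. v (Suc i)) w)"
  shows "definable_term (\<lambda>v w. mu (\<lambda>a. R a v w))"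
proof -
  have "inj (case_nat 0 (\<lambda>i. Suc (Suc i)))" "inj (case_nat 0 (\<lambda>i. Suc (Suc (Suc i))))"
    by (auto simp: inj_def split: nat.splits)
  from this[THEN definable_rename[OF assms]] assms show ?thesis
    unfolding definable_term_def eq_mu_iff by (intro definable_intros) simp_all
qed

text \<open>Bounded collection: it ensures that the values of a definable function below
  \<open>k\<close> fit into a coded finite set.\<close>

lemma image_bounded:
  assumes "definable_term (\<lambda>v w. f (v 0))"
  shows "\<exists>b. \<forall>i. i \<prec> k \<longrightarrow> f i \<prec> b"
proof (induction k rule: definable_induct)
  case def
  show ?case by (intro definable_intros assms)
next
  case (step k)
  then obtain b where "\<And>i. i \<prec> k \<Longrightarrow> f i \<prec> b" by blast
  then have "f i \<prec> N.max b (f k \<oplus> \<one>)" if "i \<prec> k \<oplus> \<one>" for i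
    using that by (auto simp: less_succ N.less_max_iff_disj)
  then show ?case by blast
qed (simp add: not_less_zero)

section \<open>Coding of finite sets and sequences\<close>

definition divides :: "'m \<Rightarrow> 'm \<Rightarrow> bool" (infix "dvd\<^sub>M" 50)
  where "d dvd\<^sub>M n \<longleftrightarrow> (\<exists>q. n = d \<otimes> q)"

lemma definable_divides [definable_intros]:
  assumes "definable_term s" "definable_term t"
  shows "definable (\<lambda>v w. s v w dvd\<^sub>M t v w)"
  unfolding divides_def by (intro definable_intros definable_term_shift assms)

lemma divides_mult: "d dvd\<^sub>M n \<Longrightarrow> d dvd\<^sub>M n \<otimes> a"
  unfolding divides_def by (metis mul_assoc)

lemma divides_add_cancel: "d dvd\<^sub>M a \<Longrightarrow> d dvd\<^sub>M a \<oplus> b \<Longrightarrow> d dvd\<^sub>M b"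
  unfolding divides_def by (metis N.add_diff_cancel_left' N.right_diff_distrib')

definition godel_mod :: "'m \<Rightarrow> 'm \<Rightarrow> 'm" where
  "godel_mod m i = m \<otimes> (i \<oplus> \<one>) \<oplus> \<one>"

lemma definable_term_godel_mod [definable_intros]:
  assumes "definable_term s" "definable_term t"
  shows "definable_term (\<lambda>v w. godel_mod (s v w) (t v w))"
  unfolding godel_mod_def by (intro definable_intros assms)

text \<open>Modulo \<open>godel_mod m j\<close> the number \<open>m\<close> is invertible, with inverse \<open>- (j + 1)\<close>.\<close>

lemma godel_mod_cancel: 
  assumes "godel_mod m j dvd\<^sub>M n \<otimes> m"
  shows "godel_mod m j dvd\<^sub>M n"
proof (rule divides_add_cancel)
  show "godel_mod m j dvd\<^sub>M n \<otimes> m \<otimes> (j \<oplus> \<one>)" by (rule divides_mult[OF assms])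
  have "n \<otimes> m \<otimes> (j \<oplus> \<one>) \<oplus> n = godel_mod m j \<otimes> n"
    by (simp add: godel_mod_def N.distrib_left N.distrib_right N.add_ac N.mult_ac)
  then show "godel_mod m j dvd\<^sub>M n \<otimes> m \<otimes> (j \<oplus> \<one>) \<oplus> n" unfolding divides_def by metis
qed

lemma godel_mod_add: "godel_mod m (i \<oplus> r) = godel_mod m i \<oplus> m \<otimes> r"
  by (simp add: godel_mod_def N.distrib_left N.add_ac N.mult_ac)

text \<open>Coprimality is phrased as cancellation, which avoids primes and gcds. The two moduli
  differ by \<open>m \<otimes> r\<close> with 0 < r < k, so \<open>?d\<close> divides
  \<open>n \<otimes> (m \<otimes> r)\<close>. As r divides m, it divides
  \<open>n \<otimes> m \<otimes> m\<close>, and both factors m are cancelled because m is invertible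
  modulo \<open>?d\<close>.\<close>

lemma godel_mod_coprime:
  assumes m: "\<And>r. r \<noteq> \<zero> \<Longrightarrow> r \<prec> k \<Longrightarrow> r dvd\<^sub>M m"
    and "i \<prec> k" "j \<prec> k" "i \<noteq> j" and d: "godel_mod m j dvd\<^sub>M n \<otimes> godel_mod m i"
  shows "godel_mod m j dvd\<^sub>M n"
proof -
  let ?d = "godel_mod m j"
  have "?d dvd\<^sub>M n" if r: "r \<noteq> \<zero>" "r \<prec> k" and *: "?d dvd\<^sub>M n \<otimes> (m \<otimes> r)" for r
  proof -
    obtain q where q: "m = r \<otimes> q" using m[OF r] unfolding divides_def by blast
    have "?d dvd\<^sub>M n \<otimes> (m \<otimes> r) \<otimes> q" by (rule divides_mult[OF *])
    also have "n \<otimes> (m \<otimes> r) \<otimes> q = n \<otimes> m \<otimes> m" unfolding q by (simp only: N.mult_ac)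
    finally show ?thesis by (rule godel_mod_cancel[OF godel_mod_cancel])
  qed
  note 1 = this
  consider (less) r where "j = i \<oplus> r" "r \<noteq> \<zero>" | (greater) r where "i = j \<oplus> r" "r \<noteq> \<zero>"
    using less_cases[of i j] \<open>i \<noteq> j\<close> unfolding less_iff_add using succ_neq_zero by blast
  then show ?thesis
  proof cases
    case less
    have "?d dvd\<^sub>M n \<otimes> godel_mod m i \<oplus> n \<otimes> (m \<otimes> r)"
      using less(1) godel_mod_add unfolding divides_def by (metis N.distrib_left mul_comm)
    then have "?d dvd\<^sub>M n \<otimes> (m \<otimes> r)" by (rule divides_add_cancel[OF d])
    moreover have "r \<prec> k" using less \<open>j \<prec> k\<close> by (metis N.le_less_trans le_iff_add add_comm)
    ultimately show ?thesis using 1 less by blast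
  next
    case greater
    have "?d dvd\<^sub>M n \<otimes> ?d" unfolding divides_def using mul_comm by blast
    moreover have "n \<otimes> godel_mod m i = n \<otimes> ?d \<oplus> n \<otimes> (m \<otimes> r)"
      using greater(1) godel_mod_add N.distrib_left by metis
    ultimately have "?d dvd\<^sub>M n \<otimes> (m \<otimes> r)" using d divides_add_cancel by metis
    moreover have "r \<prec> k" using greater \<open>i \<prec> k\<close> by (metis N.le_less_trans le_iff_add add_comm)
    ultimately show ?thesis using 1 greater by blast
  qed
qed

text \<open>Plays the part of the factorial, which is not definable by recursion yet: recursion
  itself will rest on the coding for which this multiple is needed.\<close>

lemma common_multiple: "\<exists>m. m \<noteq> \<zero> \<and> (\<forall>r. r \<noteq> \<zero> \<longrightarrow> r \<prec> k \<longrightarrow> r dvd\<^sub>M m)"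
proof (induction k rule: definable_induct)
  case def
  show ?case by (intro definable_intros)
next
  case zero
  then show ?case using not_less_zero N.one_neq_zero by blast
next
  case (step k)
  then obtain m where m: "m \<noteq> \<zero>" "\<And>r. r \<noteq> \<zero> \<Longrightarrow> r \<prec> k \<Longrightarrow> r dvd\<^sub>M m" by blast
  show ?case
  \<comment> \<open>For \<open>k = \<zero>\<close> there is no new r to take care of, and
    multiplying by \<open>k\<close> would destroy \<open>m \<noteq> \<zero>\<close>.\<close>
  proof (cases "k = \<zero>")
    case True
    have "r dvd\<^sub>M m" if "r \<noteq> \<zero>" "r \<prec> k \<oplus> \<one>" for r
      using that True less_succ not_less_zero by metis
    then show ?thesis using m(1) by blast
  next
    case False
    have "r dvd\<^sub>M m \<otimes> k" if "r \<noteq> \<zero>" "r \<prec> k \<oplus> \<one>" for r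
      using that m(2) divides_mult by (auto simp: less_succ) (metis divides_def mul_comm)
    moreover have "m \<otimes> k \<noteq> \<zero>" using False m(1) by simp
    ultimately show ?thesis by blast
  qed
qed

text \<open>Makes \<one> a description of the empty set, from which \<open>coded_set_exists\<close>
  starts; the condition on \<open>m\<close> excludes the modulus \<one>.\<close>

lemma not_divides_one:
  assumes "m \<noteq> \<zero>"
  shows "\<not> godel_mod m i dvd\<^sub>M \<one>"
proof
  assume "godel_mod m i dvd\<^sub>M \<one>"
  then obtain q where q: "\<one> = godel_mod m i \<otimes> q" unfolding divides_def by blast
  obtain a where a: "godel_mod m i = a \<oplus> \<one>" "a \<noteq> \<zero>"
    using assms succ_neq_zero by (auto simp: godel_mod_def)
  obtain b where "q = b \<oplus> \<one>" using q mul_zero N.zero_neq_one zero_or_succ by metis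
  then have "\<zero> \<oplus> \<one> = (a \<oplus> \<one>) \<otimes> (b \<oplus> \<one>)" using q a(1) zero_add by metis
  also have "\<dots> = (a \<otimes> b \<oplus> a \<oplus> b) \<oplus> \<one>"
    by (simp add: N.distrib_left N.distrib_right N.add_ac)
  finally have "\<zero> \<oplus> \<one> = (a \<otimes> b \<oplus> a \<oplus> b) \<oplus> \<one>" .
  then have "\<zero> = a \<otimes> b \<oplus> a \<oplus> b" by (rule succ_inject)
  then show False using a(2) by (metis add_succ succ_neq_zero zero_or_succ add_zero)
qed

lemma coded_set_pair:
  "coded_set M (pair M k (pair M m n)) = {i. i \<prec> k \<and> godel_mod m i dvd\<^sub>M n}"
  unfolding coded_set_def godel_mod_def divides_def by auto

text \<open>The number \<open>n\<close> is the product of the moduli \<open>godel_mod m j\<close>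
  for the j in \<open>A\<close> below \<open>k\<close>, built up one factor at a time; by
  coprimality no modulus of another index below \<open>k\<close> divides it.\<close>

lemma coded_set_exists:
  assumes A: "definable_set (\<lambda>v w. A)"
  shows "\<exists>c. coded_set M c = {i\<in>A. i \<prec> k}"
proof -
  obtain m where m: "m \<noteq> \<zero>" "\<And>r. r \<noteq> \<zero> \<Longrightarrow> r \<prec> k \<Longrightarrow> r dvd\<^sub>M m"
    using common_multiple by blast
  have A': "A \<in> \<S>" using A by (rule definable_set_in)
  have "\<exists>n. \<forall>j. j \<prec> k \<longrightarrow> (godel_mod m j dvd\<^sub>M n \<longleftrightarrow> j \<in> A \<and> j \<prec> l)" for l
  proof (induction l rule: definable_induct)
    case def
    show ?case using A' by (intro definable_intros)
  next
    case zero
    then show ?case using not_divides_one[OF m(1)] not_less_zero by blast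
  next
    case (step l)
    then obtain n where n: "\<And>j. j \<prec> k \<Longrightarrow> godel_mod m j dvd\<^sub>M n \<longleftrightarrow> j \<in> A \<and> j \<prec> l" by blast
    show ?case
    proof (cases "l \<in> A \<and> l \<prec> k")
      case True
      have "godel_mod m j dvd\<^sub>M n \<otimes> godel_mod m l \<longleftrightarrow> j \<in> A \<and> j \<prec> l \<oplus> \<one>" if j: "j \<prec> k" for j
      proof (cases "j = l")
        case True
        then have "godel_mod m j dvd\<^sub>M n \<otimes> godel_mod m l" unfolding divides_def using mul_comm by blast
        then show ?thesis using True \<open>l \<in> A \<and> l \<prec> k\<close> by (simp add: less_succ)
      next
        case False
        then have "godel_mod m j dvd\<^sub>M n \<otimes> godel_mod m l \<longleftrightarrow> godel_mod m j dvd\<^sub>M n"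
          using godel_mod_coprime[OF m(2)] True j divides_mult by blast
        then show ?thesis using n[OF j] False by (auto simp: less_succ)
      qed
      then show ?thesis by blast
    next
      case False
      then show ?thesis using n by (metis less_succ)
    qed
  qed
  from this[of k] obtain n where "\<forall>j. j \<prec> k \<longrightarrow> (godel_mod m j dvd\<^sub>M n \<longleftrightarrow> j \<in> A \<and> j \<prec> k)" by blast
  then have "coded_set M (pair M k (pair M m n)) = {i\<in>A. i \<prec> k}"
    unfolding coded_set_pair by blast
  then show ?thesis by blast
qed

lemma coded_set_bounded: "\<exists>k. \<forall>i\<in>coded_set M c. i \<prec> k"
  unfolding coded_set_def by (cases "\<exists>k m n. c = pair M k (pair M m n)") auto

definition code_of :: "'m set \<Rightarrow> 'm" where
  "code_of A = mu (\<lambda>c. coded_set M c = A)"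

lemma definable_term_code_of [definable_intros]:
  assumes "definable_set U"
  shows "definable_term (\<lambda>v w. code_of (U v w))"
  unfolding code_of_def by (intro definable_intros definable_set_eq definable_set_shift assms)

lemma
  assumes "definable_set (\<lambda>v w. A)" "\<And>i. i \<in> A \<Longrightarrow> i \<prec> k"
  shows coded_set_code_of: "coded_set M (code_of A) = A"
    and is_code_code_of: "is_code M (code_of A)"
proof -
  have "{i\<in>A. i \<prec> k} = A" using assms(2) by auto
  then obtain c where "coded_set M c = A"
    using coded_set_exists[OF assms(1), of k] by metis
  moreover have "definable (\<lambda>v w. coded_set M (v 0) = A)"
    by (intro definable_intros definable_set_eq assms)
  ultimately obtain c where "coded_set M c = A" "\<And>d. d \<prec> c \<Longrightarrow> coded_set M d \<noteq> A"
    using least_number[of "\<lambda>c. coded_set M c = A"] by blast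
  then show "coded_set M (code_of A) = A" "is_code M (code_of A)"
    using mu_eqI[of "\<lambda>c. coded_set M c = A" c] unfolding code_of_def is_code_def by auto
qed

section \<open>Functions of the structure and their definability\<close>

definition graph :: "('m \<Rightarrow> 'm) \<Rightarrow> 'm set" where
  "graph g = range (\<lambda>i. pair M i (g i))"

text \<open>Total for arbitrary \<open>G\<close>, so that coded finite sets of pairs, which are not
  graphs of total functions, can stand for functions as well.\<close>

definition fn :: "'m set \<Rightarrow> 'm \<Rightarrow> 'm" where
  "fn G i = mu (\<lambda>y. pair M i y \<in> G)"

lemma pair_mem_graph [simp]: "pair M i y \<in> graph g \<longleftrightarrow> y = g i"
  by (auto simp: graph_def)

lemma fn_eqI: "pair M i y \<in> G \<Longrightarrow> (\<And>z. pair M i z \<in> G \<Longrightarrow> z = y) \<Longrightarrow> fn G i = y"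
  unfolding fn_def by (rule mu_unique)

lemma fn_graph [simp]: "fn (graph g) = g"
proof
  show "fn (graph g) i = g i" for i by (rule fn_eqI) simp_all
qed

lemma funs_iff_graph: "f \<in> funs M \<longleftrightarrow> graph f \<in> \<S>"
  by (simp add: funs_def graph_def)

lemma definable_term_fn [definable_intros]:
  assumes "definable_set G" "definable_term t"
  shows "definable_term (\<lambda>v w. fn (G v w) (t v w))"
  unfolding fn_def
  by (intro definable_intros definable_set_shift definable_term_shift assms)

definition definable_fun :: "((nat \<Rightarrow> 'm) \<Rightarrow> (nat \<Rightarrow> 'm set) \<Rightarrow> 'm \<Rightarrow> 'm) \<Rightarrow> bool" where
  "definable_fun g \<longleftrightarrow> definable_term (\<lambda>v w. g (\<lambda>i. v (Suc i)) w (v 0))"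

lemma definable_term_subst:
  assumes "definable_term t" "definable_term (\<lambda>v w. u (v 0) (\<lambda>i. v (Suc i)) w)"
  shows "definable_term (\<lambda>v w. u (t v w) v w)"
  unfolding definable_term_def
proof (rule definable_subst_term[OF definable_term_shift[OF assms(1)]])
  have "inj (case_nat 1 (case_nat 0 (\<lambda>i. Suc (Suc i))))"
    by (auto simp: inj_def split: nat.splits)
  from definable_rename[OF assms(2)[unfolded definable_term_def] this]
  show "definable (\<lambda>v w. v (Suc 0) = u (v 0) (\<lambda>i. v (Suc (Suc i))) w)" by simp
qed

lemma definable_term_comp:
  "definable_term (\<lambda>v w. f (v 0)) \<Longrightarrow> definable_term t \<Longrightarrow> definable_term (\<lambda>v w. f (t v w))"
  by (rule definable_term_subst)

lemma definable_term_fun: "definable_fun g \<Longrightarrow> definable_term t \<Longrightarrow> definable_term (\<lambda>v w. g v w (t v w))"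
  unfolding definable_fun_def by (rule definable_term_subst)

lemma definable_fun_shift:
  assumes "definable_fun g"
  shows "definable_fun (\<lambda>v w. g (\<lambda>i. v (Suc i)) w)"
proof -
  have "inj (case_nat 0 (case_nat 1 (\<lambda>i. Suc (Suc (Suc i)))))"
    by (auto simp: inj_def split: nat.splits)
  from definable_rename[OF assms[unfolded definable_fun_def definable_term_def] this]
  show ?thesis by (simp add: definable_fun_def definable_term_def)
qed

lemma definable_set_graph [definable_intros]:
  assumes "definable_fun g"
  shows "definable_set (\<lambda>v w. graph (g v w))"
proof -
  have "definable_set (\<lambda>v w. {p. \<exists>i y. p = pair M i y \<and> y = g v w i})"
    by (rule definable_set_Collect, rule definable_ex, rule definable_ex, rule definable_conj,
        (intro definable_intros)[1], rule definable_eq[OF definable_term_var],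
        rule definable_term_fun[OF definable_fun_shift[OF definable_fun_shift[OF definable_fun_shift[OF assms]]]
          definable_term_var])
  moreover have "graph h = {p. \<exists>i y. p = pair M i y \<and> y = h i}" for h
    by (auto simp: graph_def)
  ultimately show ?thesis by simp
qed

lemma funs_definable: "definable_fun (\<lambda>v w. f) \<longleftrightarrow> f \<in> funs M"
proof
  assume "definable_fun (\<lambda>v w. f)"
  then have "definable_set (\<lambda>v w. graph f)" by (rule definable_set_graph)
  then show "f \<in> funs M" by (simp add: funs_iff_graph definable_set_in)
next
  assume "f \<in> funs M"
  then have "definable_fun (\<lambda>v w. fn (graph f))"
    unfolding definable_fun_def funs_iff_graph by (intro definable_intros)
  then show "definable_fun (\<lambda>v w. f)" by simp
qed

lemma definable_term_funs: "f \<in> funs M \<Longrightarrow> definable_term t \<Longrightarrow> definable_term (\<lambda>v w. f (t v w))"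
  using definable_term_fun[of "\<lambda>v w. f"] funs_definable by blast

lemma definable_term_subst_env:
  assumes "definable_term t"
    and "\<And>i. definable_term (\<lambda>v w. \<epsilon> v w i)" and "\<And>j. definable_set (\<lambda>v w. \<E> v w j)"
  shows "definable_term (\<lambda>v w. t (\<epsilon> v w) (\<E> v w))"
proof -
  have "definable (\<lambda>v w. (case_nat (v 0) (\<epsilon> (\<lambda>i. v (Suc i)) w)) 0
      = t (\<lambda>i. (case_nat (v 0) (\<epsilon> (\<lambda>i. v (Suc i)) w)) (Suc i)) (\<E> (\<lambda>i. v (Suc i)) w))"
  proof (rule definable_subst[OF assms(1)[unfolded definable_term_def]])
    show "definable_term (\<lambda>v w. case_nat (v 0) (\<epsilon> (\<lambda>i. v (Suc i)) w) i)" for i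
      using definable_term_shift[OF assms(2)] by (cases i) (simp_all add: definable_term_var)
    show "definable_set (\<lambda>v w. \<E> (\<lambda>i. v (Suc i)) w j)" for j
      by (rule definable_set_shift[OF assms(3)])
  qed
  then show ?thesis by (simp add: definable_term_def)
qed

text \<open>By \<open>image_bounded\<close> the pairs lie below a common bound, so the finite graph
  has a code.\<close>

lemma is_seq_code_of:
  fixes k :: 'm
  assumes f: "definable_term (\<lambda>v w. f (v 0))"
  defines "A \<equiv> {p. \<exists>i. i \<prec> k \<and> p = pair M i (f i)}"
  shows "is_seq M (code_of A) k" "coded_set M (code_of A) = A"
proof -
  obtain b where b: "\<And>i. i \<prec> k \<Longrightarrow> pair M i (f i) \<prec> b"
    using image_bounded[of "\<lambda>i. pair M i (f i)" k] definable_term_pair[OF definable_term_var f] by blast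
  have "definable_set (\<lambda>v w. A)"
    unfolding A_def by (intro definable_intros definable_term_comp[OF f])
  note A = coded_set_code_of[OF this] is_code_code_of[OF this]
  from A(1)[of b] b show eq: "coded_set M (code_of A) = A" unfolding A_def by blast
  have "is_code M (code_of A)" using A(2)[of b] b unfolding A_def by blast
  then show "is_seq M (code_of A) k" unfolding is_seq_def eq unfolding A_def by auto
qed

lemma is_initial_exists:
  assumes f: "definable_term (\<lambda>v w. f (v 0))"
  shows "\<exists>s. is_initial M f k s"
  using is_seq_code_of[OF assms] unfolding is_initial_def by blast

lemma is_seq_length_unique:
  assumes "is_seq M s k" "is_seq M s l"
  shows "k = l"
proof -
  have "i \<prec> k \<longleftrightarrow> i \<prec> l" for i
    using assms unfolding is_seq_def by (metis pair_inject)
  then show ?thesis using less_cases less_irrefl by metis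
qed

lemma is_initialD:
  assumes "is_initial M f k s" "i \<prec> k"
  shows "pair M i x \<in> coded_set M s \<longleftrightarrow> x = f i"
  using assms unfolding is_initial_def is_seq_def by blast

lemma definable_chi [definable_intros]:
  assumes "definable_set U" "definable_term t"
  shows "definable_term (\<lambda>v w. chi M (U v w) (t v w))"
  unfolding chi_def by (intro definable_intros assms)

section \<open>Primitive recursion\<close>

text \<open>The recursion is approximated by coded finite computations. Any two of them agree where
  both are defined (\<open>unique\<close>), and every argument is reached by one
  (\<open>ex\<close>), so \<open>R\<close> is defined by a number quantifier over codes and stays
  arithmetical.\<close>

lemma prim_rec:
  assumes a: "definable_term (\<lambda>v w. a v)"
    and h: "definable_term (\<lambda>v w. h (\<lambda>i. v (Suc (Suc i))) (v 1) (v 0))"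
  obtains R where "definable_fun (\<lambda>v w. R v)"
    "\<And>v. R v \<zero> = a v" "\<And>v i. R v (i \<oplus> \<one>) = h v i (R v i)"
proof -
  have a': "definable_term (\<lambda>v w. a (\<epsilon> v w))" if "\<And>i. definable_term (\<lambda>v w. \<epsilon> v w i)" for \<epsilon>
    by (rule definable_term_subst_env[OF a that definable_set_var])
  have h': "definable_term (\<lambda>v w. h (\<epsilon> v w) (s v w) (t v w))" 
    if "\<And>i. definable_term (\<lambda>v w. \<epsilon> v w i)" "definable_term s" "definable_term t" for \<epsilon> s t
  proof -
    have "definable_term (\<lambda>v w. case_nat (t v w) (case_nat (s v w) (\<epsilon> v w)) i)" for i
      using that by (cases i; cases "i - 1") simp_all
    from definable_term_subst_env[where \<epsilon> = "\<lambda>v w. case_nat (t v w) (case_nat (s v w) (\<epsilon> v w))", OF h this definable_set_var]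
    show ?thesis by simp
  qed
  \<comment> \<open>A coded set of pairs is a computation if each entry is the start value or arises
    from an entry at the preceding argument. That its entries are single-valued is derived in
    \<open>unique\<close>.\<close>
  define good where "good v c \<longleftrightarrow> (\<forall>i y. pair M i y \<in> coded_set M c \<longrightarrow>
    (i = \<zero> \<and> y = a v) \<or> (\<exists>j x. i = j \<oplus> \<one> \<and> pair M j x \<in> coded_set M c \<and> y = h v j x))" for v c
  have good: "definable (\<lambda>v w. good (\<epsilon> v w) (t v w))"
    if "\<And>i. definable_term (\<lambda>v w. \<epsilon> v w i)" "definable_term t" for \<epsilon> t
    unfolding good_def by (intro definable_intros a' h' definable_term_shift that)
  have unique: "\<forall>y z. pair M i y \<in> coded_set M c \<longrightarrow> pair M i z \<in> coded_set M d \<longrightarrow> y = z"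
    if "good v c" "good v d" for v c d i
  proof (induction i rule: definable_induct)
    case def
    show ?case by (intro definable_intros)
  next
    case zero
    then show ?case using that succ_neq_zero unfolding good_def by metis
  next
    case (step i)
    have "\<exists>x. pair M i x \<in> coded_set M c \<and> y = h v i x" if "good v c" "pair M (i \<oplus> \<one>) y \<in> coded_set M c" for c y
      using that succ_neq_zero succ_inject unfolding good_def by metis
    then show ?case using step that by metis
  qed
  have ex: "\<exists>c y. good v c \<and> pair M i y \<in> coded_set M c" for v i
  proof (induction i rule: definable_induct)
    case def
    show ?case by (intro definable_intros good)
  next
    case zero
    have "definable_set (\<lambda>v' w. {p. p = pair M \<zero> (a v)})" by (intro definable_intros)
    from coded_set_code_of[OF this, of "pair M \<zero> (a v) \<oplus> \<one>"]
    have "coded_set M (code_of {p. p = pair M \<zero> (a v)}) = {p. p = pair M \<zero> (a v)}" by simp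
    then have "good v (code_of {p. p = pair M \<zero> (a v)})" unfolding good_def by simp
    then show ?case using \<open>coded_set M _ = _\<close> by blast
  next
    case (step i)
    then obtain c y where c: "good v c" "pair M i y \<in> coded_set M c" by blast
    obtain k where k: "\<And>p. p \<in> coded_set M c \<Longrightarrow> p \<prec> k" using coded_set_bounded by blast
    let ?p = "pair M (i \<oplus> \<one>) (h v i y)"
    let ?A = "{p. p \<in> coded_set M c \<or> p = ?p}"
    have "definable_set (\<lambda>v' w. ?A)" by (intro definable_intros)
    moreover have "p \<prec> N.max k (?p \<oplus> \<one>)" if "p \<in> ?A" for p
      using that k by (auto simp: N.less_max_iff_disj)
    ultimately have A: "coded_set M (code_of ?A) = ?A" by (rule coded_set_code_of)
    have "good v (code_of ?A)"
      using c unfolding good_def A by auto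
    then show ?case using A by blast
  qed
  define R where "R v i = mu (\<lambda>y. \<exists>c. good v c \<and> pair M i y \<in> coded_set M c)" for v i
  have R: "R v i = y" if "good v c" "pair M i y \<in> coded_set M c" for v i c y
    unfolding R_def by (rule mu_unique) (use that unique in blast)+
  show thesis
  proof (rule that)
    show "definable_fun (\<lambda>v w. R v)"
      unfolding definable_fun_def R_def by (intro definable_intros good)
    show "R v \<zero> = a v" for v
    proof -
      obtain c y where c: "good v c" "pair M \<zero> y \<in> coded_set M c" using ex by blast
      then have "y = a v" using succ_neq_zero unfolding good_def by metis
      then show ?thesis using R[OF c] by simp
    qed
    show "R v (i \<oplus> \<one>) = h v i (R v i)" for v i
    proof -
      obtain c y where c: "good v c" "pair M (i \<oplus> \<one>) y \<in> coded_set M c" using ex by blast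
      then obtain x where "pair M i x \<in> coded_set M c" "y = h v i x"
        using succ_neq_zero succ_inject unfolding good_def by metis
      then show ?thesis using R[OF c] R[OF c(1)] by simp
    qed
  qed
qed

section \<open>Analytic codes from definitions\<close>

definition proj1 :: "'m \<Rightarrow> 'm" where "proj1 p = mu (\<lambda>i. \<exists>j. p = pair M i j)"
definition proj2 :: "'m \<Rightarrow> 'm" where "proj2 p = mu (\<lambda>j. \<exists>i. p = pair M i j)"

lemma proj_pair [simp]: "proj1 (pair M i j) = i" "proj2 (pair M i j) = j"
  unfolding proj1_def proj2_def by (rule mu_unique; auto)+

lemma definable_term_proj [definable_intros]:
  assumes "definable_term t"
  shows "definable_term (\<lambda>v w. proj1 (t v w))" "definable_term (\<lambda>v w. proj2 (t v w))"
  unfolding proj1_def proj2_def by (intro definable_intros definable_term_shift assms)+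

section \<open>Normal forms with a continuous matrix\<close>

definition section_of :: "('m \<Rightarrow> 'm) \<Rightarrow> 'm \<Rightarrow> 'm \<Rightarrow> 'm" where
  "section_of g a i = g (pair M i a)"

lemma definable_fun_fn [definable_intros]:
  "definable_set G \<Longrightarrow> definable_fun (\<lambda>v w. fn (G v w))"
  unfolding definable_fun_def by (intro definable_intros definable_set_shift)

lemma definable_fun_section_of [definable_intros]:
  assumes "definable_fun g" "definable_term t"
  shows "definable_fun (\<lambda>v w. section_of (g v w) (t v w))"
  unfolding section_of_def definable_fun_def
  by (rule definable_term_fun[OF definable_fun_shift[OF assms(1)]])
    (intro definable_intros definable_term_shift assms)

lemma definable_term_section_of [definable_intros]:
  assumes "definable_fun g" "definable_term t" "definable_term s"
  shows "definable_term (\<lambda>v w. section_of (g v w) (t v w) (s v w))"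
  by (rule definable_term_fun[OF definable_fun_section_of[OF assms(1,2)] assms(3)])

lemma definable_term_upd [definable_intros]:
  assumes "definable_term (\<lambda>v w. \<epsilon> v w i)" "definable_term t"
  shows "definable_term (\<lambda>v w. ((\<epsilon> v w)(x := t v w)) i)"
  using assms by (cases "i = x") simp_all

definition agree :: "'m \<Rightarrow> (nat \<Rightarrow> 'm set) \<Rightarrow> (nat \<Rightarrow> 'm set) \<Rightarrow> ('m \<Rightarrow> 'm) \<Rightarrow> ('m \<Rightarrow> 'm) \<Rightarrow> bool" where
  "agree b E E' g g' \<longleftrightarrow> (\<forall>i. i \<prec> b \<longrightarrow> g' i = g i \<and> (\<forall>j. i \<in> E' j \<longleftrightarrow> i \<in> E j))"

lemma agree_mono: "agree b E E' g g' \<Longrightarrow> b' \<preceq> b \<Longrightarrow> agree b' E E' g g'"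
  unfolding agree_def using N.less_le_trans by blast

lemma le_pair1: "i \<preceq> pair M i j"
  unfolding pair_def using le_iff_add add_comm by metis

text \<open>For i below b the entry at \<open>pair M i a\<close> is below \<open>pair M b a\<close>,
  and so is i itself; a single bound therefore controls both the section and the sets.\<close>

lemma agree_section_of: "agree (pair M b a) E E' g g' \<Longrightarrow> agree b E E' (section_of g a) (section_of g' a)"
  unfolding agree_def section_of_def using pair_strict_mono le_pair1 N.less_le_trans by metis

text \<open>\<open>P\<close> has the normal form \<open>\<exists>g. \<forall>k. Q k g\<close>, where each \<open>Q k\<close> inspects only finitely much of
  the sets and of the function \<open>g\<close>.  The definable Skolem function \<open>F\<close> replaces choice when the
  normal form is pushed through a universal number quantifier.\<close>

definition normal_form :: "((nat \<Rightarrow> 'm) \<Rightarrow> (nat \<Rightarrow> 'm set) \<Rightarrow> bool) \<Rightarrow>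
    ('m \<Rightarrow> (nat \<Rightarrow> 'm) \<Rightarrow> (nat \<Rightarrow> 'm set) \<Rightarrow> ('m \<Rightarrow> 'm) \<Rightarrow> bool) \<Rightarrow>
    ((nat \<Rightarrow> 'm) \<Rightarrow> (nat \<Rightarrow> 'm set) \<Rightarrow> 'm \<Rightarrow> 'm) \<Rightarrow> bool" where
  "normal_form P Q F \<longleftrightarrow> definable P \<and> definable_fun F \<and>
     definable (\<lambda>v w. Q (v 0) (\<lambda>i. v (Suc i)) (\<lambda>j. w (Suc j)) (fn (w 0))) \<and>
     (\<forall>k e E g. \<exists>b. \<forall>E' g'. agree b E E' g g' \<longrightarrow> Q k e E' g' = Q k e E g) \<and>
     (\<forall>e E. range E \<subseteq> \<S> \<longrightarrow> P e E \<longrightarrow> (\<forall>k. Q k e E (F e E))) \<and>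
     (\<forall>e E g. (\<forall>k. Q k e E g) \<longrightarrow> P e E)"

lemma normal_formI:
  assumes "definable P" "definable_fun F"
    "definable (\<lambda>v w. Q (v 0) (\<lambda>i. v (Suc i)) (\<lambda>j. w (Suc j)) (fn (w 0)))"
    "\<And>k e E g. \<exists>b. \<forall>E' g'. agree b E E' g g' \<longrightarrow> Q k e E' g' = Q k e E g"
    "\<And>e E k. range E \<subseteq> \<S> \<Longrightarrow> P e E \<Longrightarrow> Q k e E (F e E)"
    "\<And>e E g. (\<And>k. Q k e E g) \<Longrightarrow> P e E"
  shows "normal_form P Q F"
  unfolding normal_form_def
proof (intro conjI allI impI)
  show "P e E" if "\<forall>k. Q k e E g" for e E g by (rule assms(6)[of e E g]) (simp add: that)
qed (simp_all add: assms)

lemma normal_formD: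
  assumes "normal_form P Q F"
  shows "definable P" "definable_fun F"
    "\<exists>b. \<forall>E' g'. agree b E E' g g' \<longrightarrow> Q k e E' g' = Q k e E g"
    "range E \<subseteq> \<S> \<Longrightarrow> P e E \<Longrightarrow> Q k e E (F e E)"
    "\<forall>k. Q k e E g \<Longrightarrow> P e E"
  using assms unfolding normal_form_def by (simp_all, metis)

lemma normal_form_definable_matrix:
  assumes "normal_form P Q F" "definable_term t" "\<And>i. definable_term (\<lambda>v w. \<epsilon> v w i)"
    "\<And>j. definable_set (\<lambda>v w. \<E> v w j)" "definable_fun g"
  shows "definable (\<lambda>v w. Q (t v w) (\<epsilon> v w) (\<E> v w) (g v w))"
proof -
  have "definable (\<lambda>v w. Q (v 0) (\<lambda>i. v (Suc i)) (\<lambda>j. w (Suc j)) (fn (w 0)))"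
    using assms(1) unfolding normal_form_def by blast
  moreover have "definable_term (\<lambda>v w. case_nat (t v w) (\<epsilon> v w) i)" for i
    using assms(2,3) by (cases i) simp_all
  moreover have "definable_set (\<lambda>v w. case_nat (graph (g v w)) (\<E> v w) j)" for j
    using definable_set_graph[OF assms(5)] assms(4) by (cases j) simp_all
  ultimately show ?thesis
    using definable_subst[where \<epsilon> = "\<lambda>v w. case_nat (t v w) (\<epsilon> v w)" and \<E> = "\<lambda>v w. case_nat (graph (g v w)) (\<E> v w)"]
    by fastforce
qed

lemma definable_skolem:
  assumes "definable_fun F" "\<And>i. definable_term (\<lambda>v w. \<epsilon> v w i)"
    "\<And>j. definable_set (\<lambda>v w. \<E> v w j)" "definable_term t"
  shows "definable_term (\<lambda>v w. F (\<epsilon> v w) (\<E> v w) (t v w))"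
proof -
  have *: "definable_term (\<lambda>v w. case_nat (t v w) (\<epsilon> v w) i)" for i
    using assms(2,4) by (cases i) simp_all
  show ?thesis
    using definable_term_subst_env[where \<epsilon> = "\<lambda>v w. case_nat (t v w) (\<epsilon> v w)", OF assms(1)[unfolded definable_fun_def] * assms(3)]
    by simp
qed

lemma normal_form_literal:
  assumes "definable P" "\<And>e E. \<exists>b. \<forall>E' g. agree b E E' g g \<longrightarrow> P e E' = P e E"
  shows "\<exists>Q F. normal_form P Q F"
proof -
  have "normal_form P (\<lambda>k e E g. P e E) (\<lambda>e E i. \<zero>)"
  proof (rule normal_formI)
    show "definable_fun (\<lambda>e E i. \<zero>)" unfolding definable_fun_def by (intro definable_intros)
    show "definable (\<lambda>v w. P (\<lambda>i. v (Suc i)) (\<lambda>j. w (Suc j)))"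
      by (rule definable_subst[OF assms(1)]) (intro definable_intros)+
    show "\<exists>b. \<forall>E' g'. agree b E E' g g' \<longrightarrow> P e E' = P e E" for k e E and g :: "'m \<Rightarrow> 'm"
    proof -
      obtain b where b: "\<And>E' g. agree b E E' g g \<Longrightarrow> P e E' = P e E" using assms(2) by metis
      have "agree b E E' g g" if "agree b E E' g g'" for E' g' using that by (simp add: agree_def)
      with b show ?thesis by metis
    qed
  qed (use assms in auto)
  then show ?thesis by blast
qed

text \<open>The witness for each a is stored as section a of one function, and \<open>k\<close>
  codes a pair consisting of an old index and a. The glued witness is definable because the Skolem
  function is definable uniformly in a.\<close>

lemma normal_form_all:
  assumes "normal_form P Q F"
  shows "\<exists>Q F. normal_form (\<lambda>e E. \<forall>a. P (e(x := a)) E) Q F"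
proof -
  note nf = normal_formD[OF assms]
  have "normal_form (\<lambda>e E. \<forall>a. P (e(x := a)) E)
      (\<lambda>k e E g. Q (proj1 k) (e(x := proj2 k)) E (section_of g (proj2 k)))
      (\<lambda>e E p. F (e(x := proj2 p)) E (proj1 p))" (is "normal_form ?P ?Q ?F")
  proof (rule normal_formI)
    show "definable ?P"
      by (rule definable_all, rule definable_subst[OF nf(1)]) (intro definable_intros)+
    show "definable_fun ?F"
      unfolding definable_fun_def by (rule definable_skolem[OF nf(2)]) (intro definable_intros)+
    show "definable (\<lambda>v w. ?Q (v 0) (\<lambda>i. v (Suc i)) (\<lambda>j. w (Suc j)) (fn (w 0)))"
      by (rule normal_form_definable_matrix[OF assms]) (intro definable_intros)+
    show "\<exists>b. \<forall>E' g'. agree b E E' g g' \<longrightarrow> ?Q k e E' g' = ?Q k e E g" for k e E g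
      using nf(3)[of E "section_of g (proj2 k)"] agree_section_of by metis
    show "?Q k e E (?F e E)" if "range E \<subseteq> \<S>" "?P e E" for k e E
    proof -
      have "section_of (?F e E) (proj2 k) = F (e(x := proj2 k)) E"
        by (simp add: fun_eq_iff section_of_def)
      then show ?thesis using nf(4)[OF that(1)] that(2) by simp
    qed
    show "?P e E" if *: "\<And>k. ?Q k e E g" for e E g
    proof
      show "P (e(x := a)) E" for a
        using *[of "pair M k a" for k] by (intro nf(5)[where g = "section_of g a"] allI) simp
    qed
  qed
  then show ?thesis by blast
qed

text \<open>The new function stores the number witness at \<open>pair M \<zero> \<zero>\<close> and
  the old witness function in section \<one>. The Skolem function uses the least number
  witness.\<close>

lemma normal_form_ex:
  assumes "normal_form P Q F"
  shows "\<exists>Q F. normal_form (\<lambda>e E. \<exists>a. P (e(x := a)) E) Q F"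
proof -
  note nf = normal_formD[OF assms]
  define wit where "wit e E = mu (\<lambda>a. P (e(x := a)) E)" for e E
  have def_P: "definable (\<lambda>v w. P ((\<epsilon> v w)(x := t v w)) (\<E> v w))"
    if "\<And>i. definable_term (\<lambda>v w. \<epsilon> v w i)" "\<And>j. definable_set (\<lambda>v w. \<E> v w j)" "definable_term t" for \<epsilon> \<E> t
    by (rule definable_subst[OF nf(1)]) (intro definable_intros that)+
  have def_wit: "definable_term (\<lambda>v w. wit (\<lambda>i. v (Suc i)) w)"
    unfolding wit_def by (intro definable_intros def_P)
  \<comment> \<open>Here the condition \<open>range E \<subseteq> \<S>\<close> enters: it lets the
    predicate define a set of the structure, so that a least witness exists.\<close>
  have wit: "P (e(x := wit e E)) E" if E: "range E \<subseteq> \<S>" and a: "P (e(x := a)) E" for e E a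
    unfolding wit_def
  proof (rule mu_holds)
    show "definable (\<lambda>v w. P (e(x := v 0)) E)"
      using E by (intro def_P definable_intros) auto
  qed (rule a)
  have "normal_form (\<lambda>e E. \<exists>a. P (e(x := a)) E)
      (\<lambda>k e E g. Q k (e(x := section_of g \<zero> \<zero>)) E (section_of g \<one>))
      (\<lambda>e E p. if proj2 p = \<zero> then wit e E else F (e(x := wit e E)) E (proj1 p))" (is "normal_form ?P ?Q ?F")
  proof (rule normal_formI)
    show "definable ?P" by (rule definable_ex, rule def_P) (intro definable_intros)+
    show "definable_fun ?F"
      unfolding definable_fun_def
      by (intro definable_intros def_wit definable_skolem[OF nf(2)])
    show "definable (\<lambda>v w. ?Q (v 0) (\<lambda>i. v (Suc i)) (\<lambda>j. w (Suc j)) (fn (w 0)))"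
      by (rule normal_form_definable_matrix[OF assms]) (intro definable_intros)+
    show "\<exists>b. \<forall>E' g'. agree b E E' g g' \<longrightarrow> ?Q k e E' g' = ?Q k e E g" for k e E g
    proof -
      obtain b where b: "\<And>E' g'. agree b E E' (section_of g \<one>) g' \<Longrightarrow>
          Q k (e(x := section_of g \<zero> \<zero>)) E' g' = ?Q k e E g" using nf(3) by blast
      \<comment> \<open>The second bound protects the number stored at
        \<open>pair M \<zero> \<zero>\<close>, the first the section passed on to
        \<open>Q\<close>.\<close>
      let ?b = "N.max (pair M b \<one>) (pair M \<zero> \<zero> \<oplus> \<one>)"
      have "?Q k e E' g' = ?Q k e E g" if *: "agree ?b E E' g g'" for E' g'
      proof -
        have "section_of g' \<zero> \<zero> = section_of g \<zero> \<zero>"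
          using * unfolding agree_def section_of_def by (simp add: N.less_max_iff_disj)
        moreover have "agree (pair M b \<one>) E E' g g'"
          by (rule agree_mono[OF *]) simp
        ultimately show ?thesis using b agree_section_of by simp
      qed
      then show ?thesis by blast
    qed
    show "?Q k e E (?F e E)" if "range E \<subseteq> \<S>" "?P e E" for k e E
    proof -
      have "section_of (?F e E) \<one> = F (e(x := wit e E)) E" "section_of (?F e E) \<zero> \<zero> = wit e E"
        by (simp_all add: fun_eq_iff section_of_def)
      then show ?thesis using that nf(4)[OF that(1) wit] by auto
    qed
    show "?P e E" if "\<And>k. ?Q k e E g" for e E g
      using nf(5) that by blast
  qed
  then show ?thesis by blast
qed

lemma normal_form_conj:
  assumes "normal_form P Q F" "normal_form P' Q' F'"
  shows "\<exists>Q F. normal_form (\<lambda>e E. P e E \<and> P' e E) Q F"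
proof -
  note nf = normal_formD[OF assms(1)] and nf' = normal_formD[OF assms(2)]
  have "normal_form (\<lambda>e E. P e E \<and> P' e E)
      (\<lambda>k e E g. Q k e E (section_of g \<zero>) \<and> Q' k e E (section_of g \<one>))
      (\<lambda>e E p. if proj2 p = \<zero> then F e E (proj1 p) else F' e E (proj1 p))" (is "normal_form ?P ?Q ?F")
  proof (rule normal_formI)
    show "definable ?P" by (intro definable_conj nf nf')
    show "definable_fun ?F"
      unfolding definable_fun_def
      by (intro definable_intros definable_skolem[OF nf(2)] definable_skolem[OF nf'(2)])
    show "definable (\<lambda>v w. ?Q (v 0) (\<lambda>i. v (Suc i)) (\<lambda>j. w (Suc j)) (fn (w 0)))"
      by (intro definable_conj normal_form_definable_matrix[OF assms(1)] normal_form_definable_matrix[OF assms(2)] 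
          definable_intros)
    show "\<exists>b. \<forall>E' g'. agree b E E' g g' \<longrightarrow> ?Q k e E' g' = ?Q k e E g" for k e E g
    proof -
      obtain b where b: "\<And>E' g'. agree b E E' (section_of g \<zero>) g' \<Longrightarrow>
          Q k e E' g' = Q k e E (section_of g \<zero>)" using nf(3) by blast
      obtain b' where b': "\<And>E' g'. agree b' E E' (section_of g \<one>) g' \<Longrightarrow>
          Q' k e E' g' = Q' k e E (section_of g \<one>)" using nf'(3) by blast
      let ?b = "N.max (pair M b \<zero>) (pair M b' \<one>)"
      have "?Q k e E' g' = ?Q k e E g" if *: "agree ?b E E' g g'" for E' g'
      proof -
        have "agree (pair M b \<zero>) E E' g g'" "agree (pair M b' \<one>) E E' g g'"
          by (rule agree_mono[OF *], simp)+
        then show ?thesis using b b' agree_section_of by simp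
      qed
      then show ?thesis by blast
    qed
    show "?Q k e E (?F e E)" if "range E \<subseteq> \<S>" "?P e E" for k e E
    proof -
      have "section_of (?F e E) \<zero> = F e E" "section_of (?F e E) \<one> = F' e E"
        by (simp_all add: fun_eq_iff section_of_def)
      then show ?thesis using that nf(4) nf'(4) by simp
    qed
    show "?P e E" if "\<And>k. ?Q k e E g" for e E g
      using nf(5) nf'(5) that by blast
  qed
  then show ?thesis by blast
qed

text \<open>The entry at \<open>pair M \<zero> \<zero>\<close> is a flag naming a true disjunct, and
  section \<one> is the witness for it. The Skolem function may set the flag because the truth of
  \<open>P\<close> is definable.\<close>

lemma normal_form_disj:
  assumes "normal_form P Q F" "normal_form P' Q' F'"
  shows "\<exists>Q F. normal_form (\<lambda>e E. P e E \<or> P' e E) Q F"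
proof -
  note nf = normal_formD[OF assms(1)] and nf' = normal_formD[OF assms(2)]
  have "normal_form (\<lambda>e E. P e E \<or> P' e E)
      (\<lambda>k e E g. if section_of g \<zero> \<zero> = \<zero> then Q k e E (section_of g \<one>) else Q' k e E (section_of g \<one>))
      (\<lambda>e E p. if proj2 p = \<zero> then (if P e E then \<zero> else \<one>)
         else (if P e E then F e E (proj1 p) else F' e E (proj1 p)))" (is "normal_form ?P ?Q ?F")
  proof (rule normal_formI)
    show "definable ?P" by (intro definable_disj nf nf')
    show "definable_fun ?F"
      unfolding definable_fun_def
      by (intro definable_intros definable_skolem[OF nf(2)] definable_skolem[OF nf'(2)] definable_shift[OF nf(1)])
    show "definable (\<lambda>v w. ?Q (v 0) (\<lambda>i. v (Suc i)) (\<lambda>j. w (Suc j)) (fn (w 0)))"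
      by (intro definable_if normal_form_definable_matrix[OF assms(1)] normal_form_definable_matrix[OF assms(2)] 
          definable_intros)
    show "\<exists>b. \<forall>E' g'. agree b E E' g g' \<longrightarrow> ?Q k e E' g' = ?Q k e E g" for k e E g
    proof -
      obtain b where b: "\<And>E' g'. agree b E E' (section_of g \<one>) g' \<Longrightarrow>
          Q k e E' g' = Q k e E (section_of g \<one>)" using nf(3) by blast
      obtain b' where b': "\<And>E' g'. agree b' E E' (section_of g \<one>) g' \<Longrightarrow>
          Q' k e E' g' = Q' k e E (section_of g \<one>)" using nf'(3) by blast
      let ?b = "N.max (N.max (pair M b \<one>) (pair M b' \<one>)) (pair M \<zero> \<zero> \<oplus> \<one>)"
      have "?Q k e E' g' = ?Q k e E g" if *: "agree ?b E E' g g'" for E' g'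
      proof -
        have "section_of g' \<zero> \<zero> = section_of g \<zero> \<zero>"
          using * unfolding agree_def section_of_def by (simp add: N.less_max_iff_disj)
        moreover have "agree (pair M b \<one>) E E' g g'" "agree (pair M b' \<one>) E E' g g'"
          by (rule agree_mono[OF *], simp add: N.le_max_iff_disj)+
        ultimately show ?thesis using b b' agree_section_of by simp
      qed
      then show ?thesis by blast
    qed
    show "?Q k e E (?F e E)" if "range E \<subseteq> \<S>" "?P e E" for k e E
    proof -
      have "section_of (?F e E) \<zero> \<zero> = (if P e E then \<zero> else \<one>)"
        "section_of (?F e E) \<one> = (if P e E then F e E else F' e E)"
        by (simp_all add: fun_eq_iff section_of_def)
      then show ?thesis using that nf(4) nf'(4) by (cases "P e E") simp_all
    qed
    show "?P e E" if "\<And>k. ?Q k e E g" for e E g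
      using nf(5) nf'(5) that by (cases "section_of g \<zero> \<zero> = \<zero>") (simp, blast)+
  qed
  then show ?thesis by blast
qed

text \<open>Both polarities are carried along, because the shape "exists g, for all k" is not closed
  under negation while the induction passes through \<open>Neg\<close>, \<open>Imp\<close> and
  \<open>Iff\<close>.\<close>

lemma normal_form_arithmetical:
  assumes "arithmetical \<phi>"
  shows "(\<exists>Q F. normal_form (\<lambda>e E. sat M e E \<phi>) Q F) \<and> (\<exists>Q F. normal_form (\<lambda>e E. \<not> sat M e E \<phi>) Q F)"
  using assms
proof (induction \<phi>)
  case (Eq s t)
  have "definable (\<lambda>v w. tval M v s = tval M v t)" by (intro definable_intros definable_tval)
  from this definable_not[OF this] show ?case by (intro conjI normal_form_literal) simp_all
next
  case (Less s t)
  have "definable (\<lambda>v w. tval M v s \<prec> tval M v t)" by (intro definable_intros definable_tval)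
  from this definable_not[OF this] show ?case by (intro conjI normal_form_literal) simp_all
next
  case (Mem t X)
  have 1: "definable (\<lambda>v w. tval M v t \<in> w X)" by (intro definable_intros definable_tval)
  have 2: "\<exists>b. \<forall>E' g. agree b E E' g g \<longrightarrow> (tval M e t \<in> E' X) = (tval M e t \<in> E X)" for e E
    by (rule exI[of _ "tval M e t \<oplus> \<one>"]) (simp add: agree_def)
  from 1 definable_not[OF 1] 2 show ?case by (intro conjI normal_form_literal) simp_all
next
  case (And \<phi> \<psi>)
  then obtain Q F Q' F' R G R' G' where nf:
      "normal_form (\<lambda>e E. sat M e E \<phi>) Q F" "normal_form (\<lambda>e E. sat M e E \<psi>) Q' F'"
      "normal_form (\<lambda>e E. \<not> sat M e E \<phi>) R G" "normal_form (\<lambda>e E. \<not> sat M e E \<psi>) R' G'" by auto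
  show ?case using normal_form_conj[OF nf(1,2)] normal_form_disj[OF nf(3,4)] by simp
next
  case (Or \<phi> \<psi>)
  then obtain Q F Q' F' R G R' G' where nf:
      "normal_form (\<lambda>e E. sat M e E \<phi>) Q F" "normal_form (\<lambda>e E. sat M e E \<psi>) Q' F'"
      "normal_form (\<lambda>e E. \<not> sat M e E \<phi>) R G" "normal_form (\<lambda>e E. \<not> sat M e E \<psi>) R' G'" by auto
  show ?case using normal_form_disj[OF nf(1,2)] normal_form_conj[OF nf(3,4)] by simp
next
  case (Imp \<phi> \<psi>)
  then obtain Q F Q' F' R G R' G' where nf:
      "normal_form (\<lambda>e E. sat M e E \<phi>) Q F" "normal_form (\<lambda>e E. sat M e E \<psi>) Q' F'"
      "normal_form (\<lambda>e E. \<not> sat M e E \<phi>) R G" "normal_form (\<lambda>e E. \<not> sat M e E \<psi>) R' G'" by auto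
  show ?case unfolding sat.simps imp_conv_disj de_Morgan_disj not_not
    by (intro conjI normal_form_disj[OF nf(3,2)] normal_form_conj[OF nf(1,4)])
next
  case (Iff \<phi> \<psi>)
  then obtain Q F Q' F' R G R' G' where nf:
      "normal_form (\<lambda>e E. sat M e E \<phi>) Q F" "normal_form (\<lambda>e E. sat M e E \<psi>) Q' F'"
      "normal_form (\<lambda>e E. \<not> sat M e E \<phi>) R G" "normal_form (\<lambda>e E. \<not> sat M e E \<psi>) R' G'" by auto
  obtain S H where 1: "normal_form (\<lambda>e E. sat M e E \<phi> \<and> sat M e E \<psi>) S H"
    using normal_form_conj[OF nf(1,2)] by (elim exE)
  obtain S' H' where 2: "normal_form (\<lambda>e E. \<not> sat M e E \<phi> \<and> \<not> sat M e E \<psi>) S' H'"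
    using normal_form_conj[OF nf(3,4)] by (elim exE)
  obtain T I where 3: "normal_form (\<lambda>e E. sat M e E \<phi> \<and> \<not> sat M e E \<psi>) T I"
    using normal_form_conj[OF nf(1,4)] by (elim exE)
  obtain T' I' where 4: "normal_form (\<lambda>e E. \<not> sat M e E \<phi> \<and> sat M e E \<psi>) T' I'"
    using normal_form_conj[OF nf(3,2)] by (elim exE)
  have *: "(a \<longleftrightarrow> b) = ((a \<and> b) \<or> (\<not> a \<and> \<not> b))" "(\<not> (a \<longleftrightarrow> b)) = ((a \<and> \<not> b) \<or> (\<not> a \<and> b))" for a b by auto
  show ?case
    unfolding sat.simps *(2) unfolding *(1)
    by (intro conjI normal_form_disj[OF 1 2] normal_form_disj[OF 3 4])
next
  case (AllN x \<phi>)
  then show ?case using normal_form_all normal_form_ex[of "\<lambda>e E. \<not> sat M e E \<phi>"] by auto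
next
  case (ExN x \<phi>)
  then show ?case using normal_form_ex normal_form_all[of "\<lambda>e E. \<not> sat M e E \<phi>"] by auto
qed simp_all

text \<open>Merges the quantified set and the Skolem witness into one function: section \<zero>
  encodes \<open>Z\<close> by its nonzero values, section \<one> carries the witness. Continuity is
  then needed only in this function and in the remaining set \<open>Y\<close>.\<close>

lemma Sigma11_matrix:
  assumes "definable (\<lambda>v w. P (v 0) (w 0) (w 1))"
  obtains Q where
    "\<And>t n U g. definable_term t \<Longrightarrow> definable_term n \<Longrightarrow> definable_set U \<Longrightarrow> definable_fun g \<Longrightarrow>
       definable (\<lambda>v w. Q (t v w) (n v w) (U v w) (g v w))"
    "\<And>k n Y g. \<exists>b. \<forall>Y' g'. (\<forall>i. i \<prec> b \<longrightarrow> g' i = g i \<and> (i \<in> Y' \<longleftrightarrow> i \<in> Y)) \<longrightarrow> Q k n Y' g' = Q k n Y g"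
    "\<And>n Y. Y \<in> \<S> \<Longrightarrow> (\<exists>Z\<in>\<S>. P n Y Z) \<longleftrightarrow> (\<exists>g\<in>funs M. \<forall>k. Q k n Y g)"
proof -
  from assms obtain \<phi> E e where rep: "arithmetical \<phi>" "range E \<subseteq> \<S>"
    "\<forall>v w. sat M (mix v e) (mix w E) \<phi> = P (v 0) (w 0) (w 1)" by (rule definableE)
  obtain Q F where "normal_form (\<lambda>e E. sat M e E \<phi>) Q F"
    using normal_form_arithmetical[OF rep(1)] by (elim conjE exE)
  note nf = normal_formD[OF this] normal_form_definable_matrix[OF this]
  define ev where "ev n = mix (\<lambda>_. n) e" for n
  define Ev where "Ev Y Z = mix (\<lambda>j. if j = 0 then Y else Z) E" for Y Z
  define Z where "Z g = {i. section_of g \<zero> i \<noteq> \<zero>}" for g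
  have sat: "sat M (ev n) (Ev Y Z) \<phi> = P n Y Z" for n Y Z
    by (simp add: rep(3) ev_def Ev_def)
  have ev: "definable_term (\<lambda>v w. ev (n v w) i)" if "definable_term n" for n i
    using that by (cases "even i") (simp_all add: ev_def mix_def definable_term_const)
  have E: "E i \<in> \<S>" for i using rep(2) by auto
  have Ev: "definable_set (\<lambda>v w. Ev (U v w) (V v w) i)" if "definable_set U" "definable_set V" for U V i
    using that E by (cases "even i"; cases "i div 2") (simp_all add: Ev_def mix_def definable_set_const)
  have Z: "definable_set (\<lambda>v w. Z (g v w))" if "definable_fun g" for g
    unfolding Z_def by (intro definable_intros definable_fun_shift[OF that])
  show thesis
  proof (rule that[of "\<lambda>k n Y g. Q k (ev n) (Ev Y (Z g)) (section_of g \<one>)"])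
    show "definable (\<lambda>v w. Q (t v w) (ev (n v w)) (Ev (U v w) (Z (g v w))) (section_of (g v w) \<one>))"
      if "definable_term t" "definable_term n" "definable_set U" "definable_fun g" for t n U g
      by (intro nf(6) ev Ev Z definable_fun_section_of definable_term_const that)
    show "\<exists>b. \<forall>Y' g'. (\<forall>i. i \<prec> b \<longrightarrow> g' i = g i \<and> (i \<in> Y' \<longleftrightarrow> i \<in> Y)) \<longrightarrow>
        Q k (ev n) (Ev Y' (Z g')) (section_of g' \<one>) = Q k (ev n) (Ev Y (Z g)) (section_of g \<one>)" for k n Y g
    proof -
      obtain b where b: "\<And>E' g'. agree b (Ev Y (Z g)) E' (section_of g \<one>) g' \<Longrightarrow>
          Q k (ev n) E' g' = Q k (ev n) (Ev Y (Z g)) (section_of g \<one>)" using nf(3) by metis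
      let ?b = "N.max (pair M b \<zero>) (pair M b \<one>)"
      have "agree b (Ev Y (Z g)) (Ev Y' (Z g')) (section_of g \<one>) (section_of g' \<one>)"
        if *: "\<forall>i. i \<prec> ?b \<longrightarrow> g' i = g i \<and> (i \<in> Y' \<longleftrightarrow> i \<in> Y)" for Y' g'
        unfolding agree_def
      proof (intro allI impI conjI)
        fix i j assume i: "i \<prec> b"
        then have "pair M i \<zero> \<prec> ?b" "pair M i \<one> \<prec> ?b"
          using pair_strict_mono[OF i] by (simp_all add: N.less_max_iff_disj)
        moreover from this have "i \<prec> ?b" using le_pair1 N.le_less_trans by blast
        ultimately show "section_of g' \<one> i = section_of g \<one> i"
          "i \<in> Ev Y' (Z g') j \<longleftrightarrow> i \<in> Ev Y (Z g) j"
          using * by (simp_all add: section_of_def Ev_def Z_def mix_def)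
      qed
      then show ?thesis using b by metis
    qed
    show "(\<exists>Z\<in>\<S>. P n Y Z) \<longleftrightarrow> (\<exists>g\<in>funs M. \<forall>k. Q k (ev n) (Ev Y (Z g)) (section_of g \<one>))" if Y: "Y \<in> \<S>" for n Y
    proof
      assume "\<exists>X\<in>\<S>. P n Y X"
      then obtain X where X: "X \<in> \<S>" "P n Y X" by blast
      \<comment> \<open>Section \<zero> is the characteristic function of \<open>X\<close>, section
        \<one> the Skolem function; both are definable, so \<open>g\<close> is a function of the
        structure.\<close>
      define g where "g p = (if proj2 p = \<zero> then if proj1 p \<in> X then \<one> else \<zero> else F (ev n) (Ev Y X) (proj1 p))" for p
      have "definable_fun (\<lambda>v w. g)"
        unfolding definable_fun_def g_def
        by (intro definable_intros definable_skolem[OF nf(2)] ev Ev X Y)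
      then have "g \<in> funs M" by (simp add: funs_definable)
      moreover have "section_of g \<one> = F (ev n) (Ev Y X)" "Z g = X"
        by (auto simp: fun_eq_iff section_of_def Z_def g_def)
      moreover have "range (Ev Y X) \<subseteq> \<S>" using X(1) Y rep(2) by (auto simp: Ev_def range_mix)
      ultimately show "\<exists>g\<in>funs M. \<forall>k. Q k (ev n) (Ev Y (Z g)) (section_of g \<one>)"
        using nf(4) sat X(2) by metis
    next
      assume "\<exists>g\<in>funs M. \<forall>k. Q k (ev n) (Ev Y (Z g)) (section_of g \<one>)"
      then obtain g where g: "g \<in> funs M" "\<forall>k. Q k (ev n) (Ev Y (Z g)) (section_of g \<one>)" by blast
      have "Z g \<in> \<S>" using Z[of "\<lambda>v w. g"] g(1) by (simp add: funs_definable definable_set_in)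
      moreover have "P n Y (Z g)" using nf(5)[OF g(2)] sat by simp
      ultimately show "\<exists>X\<in>\<S>. P n Y X" by blast
    qed
  qed
qed

section \<open>Finite approximations and the tree of a Sigma^1_1 class\<close>

lemma coded_set_initial:
  assumes "is_initial M (chi M X) k s" "i \<prec> k"
  shows "pair M i \<one> \<in> coded_set M s \<longleftrightarrow> i \<in> X"
  using is_initialD[OF assms] by (simp add: chi_def)

lemma is_initial_chi_bin: "is_initial M (chi M X) k s \<Longrightarrow> is_bin_seq M s k"
  unfolding is_bin_seq_def is_initial_def chi_def by (auto split: if_splits)

lemma is_bin_seq_subset:
  assumes "is_bin_seq M s l" "is_seq M s' k" "k \<preceq> l" "coded_set M s' \<subseteq> coded_set M s"
  shows "is_bin_seq M s' k"
  unfolding is_bin_seq_def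
proof (intro conjI allI impI)
  fix i assume i: "i \<prec> k"
  then obtain x where x: "pair M i x \<in> coded_set M s'" using assms(2) unfolding is_seq_def by blast
  have "i \<prec> l" using i assms(3) by (rule N.less_le_trans)
  then have "x = \<zero> \<or> x = \<one>" using assms(1,4) x unfolding is_bin_seq_def is_seq_def by blast
  then show "pair M i \<zero> \<in> coded_set M s' \<or> pair M i \<one> \<in> coded_set M s'" using x by blast
qed (rule assms)

lemma is_seq_subset:
  assumes "is_seq M s l" "is_seq M s' k" "k \<preceq> l" "coded_set M s' \<subseteq> coded_set M s" "i \<prec> k"
  shows "pair M i x \<in> coded_set M s' \<longleftrightarrow> pair M i x \<in> coded_set M s"
  using assms N.less_le_trans[of i k l] unfolding is_seq_def by blast

text \<open>A node \<open>(s, t)\<close> of length \<open>l\<close> is put into the tree iff every \<open>Q k\<close> with \<open>k < l\<close> holds at some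
  finite extension of it.  This needs no bound on how much of its arguments \<open>Q k\<close> inspects.\<close>

lemma analytic_code_of_Sigma11:
  assumes "definable (\<lambda>v w. P (v 0) (w 0) (w 1))"
  obtains A where "analytic_code_seq M A"
    "\<And>n. points M (nth_set M A n) = {Y \<in> \<S>. \<exists>Z\<in>\<S>. P n Y Z}"
proof -
  obtain Q where def_Q: "\<And>t n U g. definable_term t \<Longrightarrow> definable_term n \<Longrightarrow> definable_set U \<Longrightarrow> definable_fun g \<Longrightarrow>
       definable (\<lambda>v w. Q (t v w) (n v w) (U v w) (g v w))"
    and cont: "\<And>k n Y g. \<exists>b. \<forall>Y' g'. (\<forall>i. i \<prec> b \<longrightarrow> g' i = g i \<and> (i \<in> Y' \<longleftrightarrow> i \<in> Y)) \<longrightarrow> Q k n Y' g' = Q k n Y g"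
    and iff: "\<And>n Y. Y \<in> \<S> \<Longrightarrow> (\<exists>Z\<in>\<S>. P n Y Z) \<longleftrightarrow> (\<exists>g\<in>funs M. \<forall>k. Q k n Y g)"
    using Sigma11_matrix[OF assms] by blast
  \<comment> \<open>The codes \<open>c\<close> and \<open>d\<close> give a set and a finite partial
    function extending the node; beyond length \<open>l\<close> they are arbitrary, as
    \<open>Q k\<close> may look further than \<open>l\<close>.\<close>
  define good where "good n s t l \<longleftrightarrow> (\<forall>k. k \<prec> l \<longrightarrow> (\<exists>c d.
      (\<forall>i. i \<prec> l \<longrightarrow> (i \<in> coded_set M c \<longleftrightarrow> pair M i \<one> \<in> coded_set M s)) \<and>
      (\<forall>i x. i \<prec> l \<longrightarrow> (pair M i x \<in> coded_set M d \<longleftrightarrow> pair M i x \<in> coded_set M t)) \<and>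
      Q k n (coded_set M c) (fn (coded_set M d))))" for n s t l
  define node where "node n p \<longleftrightarrow>
    (\<exists>s t l. p = pair M s t \<and> is_bin_seq M s l \<and> is_seq M t l \<and> good n s t l)" for n p
  have def_node: "definable (\<lambda>v w. node (v i) (v j))" for i j
    unfolding node_def good_def by (intro definable_intros def_Q)
  define A where "A = {q. \<exists>p n. q = pair M p n \<and> node n p}"
  have nth_A: "nth_set M A n = {p. node n p}" for n
    by (auto simp: A_def nth_set_def)
  have A: "A \<in> \<S>" unfolding A_def by (rule comprehension) (intro definable_intros def_node)
  have node_iff: "node n (pair M s t) \<longleftrightarrow> (\<exists>l. is_bin_seq M s l \<and> is_seq M t l \<and> good n s t l)" for n s t
    by (auto simp: node_def)
  have "analytic_code M {p. node n p}" for n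
    unfolding analytic_code_def
  proof (intro conjI ballI)
    have "definable (\<lambda>v w. node n (v 0))"
      unfolding node_def good_def by (intro definable_intros def_Q)
    then show "{p. node n p} \<in> \<S>" by (rule comprehension)
    fix p assume "p \<in> {p. node n p}"
    then obtain s t l where p: "p = pair M s t" "is_bin_seq M s l" "is_seq M t l" "good n s t l"
      unfolding node_def by blast
    have "node n (pair M s' t')"
      if *: "k \<preceq> l" "is_seq M s' k" "is_seq M t' k" "coded_set M s' \<subseteq> coded_set M s" "coded_set M t' \<subseteq> coded_set M t" for k s' t'
    proof -
      have s: "is_seq M s l" using p(2) by (simp add: is_bin_seq_def)
      note [simp] = is_seq_subset[OF s *(2,1,4)] is_seq_subset[OF p(3) *(3,1,5)]
      \<comment> \<open>A shorter node imposes fewer conditions \<open>Q j\<close> and less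
        agreement, so the same \<open>c\<close> and \<open>d\<close> serve as witnesses.\<close>
      have "good n s' t' k"
        unfolding good_def
      proof (intro allI impI)
        fix j assume "j \<prec> k"
        then have "j \<prec> l" using *(1) by (rule N.less_le_trans)
        then obtain c d where "\<forall>i. i \<prec> l \<longrightarrow> (i \<in> coded_set M c \<longleftrightarrow> pair M i \<one> \<in> coded_set M s)"
          "\<forall>i x. i \<prec> l \<longrightarrow> (pair M i x \<in> coded_set M d \<longleftrightarrow> pair M i x \<in> coded_set M t)"
          "Q j n (coded_set M c) (fn (coded_set M d))"
          using p(4)[unfolded good_def, rule_format, OF \<open>j \<prec> l\<close>] by (elim exE conjE)
        moreover have "i \<prec> l" if "i \<prec> k" for i using that *(1) by (rule N.less_le_trans)
        ultimately show "\<exists>c d.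
          (\<forall>i. i \<prec> k \<longrightarrow> (i \<in> coded_set M c \<longleftrightarrow> pair M i \<one> \<in> coded_set M s')) \<and>
          (\<forall>i x. i \<prec> k \<longrightarrow> (pair M i x \<in> coded_set M d \<longleftrightarrow> pair M i x \<in> coded_set M t')) \<and>
          Q j n (coded_set M c) (fn (coded_set M d))"
          by (intro exI[of _ c] exI[of _ d]) simp
      qed
      then show ?thesis
        using is_bin_seq_subset[OF p(2) *(2,1,4)] *(3) node_iff by blast
    qed
    then show "\<exists>s t l. p = pair M s t \<and> is_bin_seq M s l \<and> is_seq M t l \<and>
        (\<forall>k s' t'. k \<preceq> l \<and> is_seq M s' k \<and> is_seq M t' k \<and>
           coded_set M s' \<subseteq> coded_set M s \<and> coded_set M t' \<subseteq> coded_set M t \<longrightarrow> pair M s' t' \<in> {p. node n p})"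
      using p(1-3) by blast
  qed
  then have "analytic_code_seq M A" by (simp add: analytic_code_seq_def A nth_A)
  moreover have "points M (nth_set M A n) = {Y \<in> \<S>. \<exists>Z\<in>\<S>. P n Y Z}" for n
  proof -
    have "(\<forall>k. Q k n Y g) \<longleftrightarrow> (\<forall>l. \<exists>s t. is_initial M (chi M Y) l s \<and> is_initial M g l t \<and> node n (pair M s t))"
      if Y: "Y \<in> \<S>" and g: "g \<in> funs M" for Y g
    proof (intro iffI allI)
      fix l assume Q: "\<forall>k. Q k n Y g"
      have "definable_term (\<lambda>v w. chi M Y (v 0))" "definable_term (\<lambda>v w. g (v 0))"
        by (intro definable_intros Y definable_term_funs[OF g])+
      then obtain s t where st: "is_initial M (chi M Y) l s" "is_initial M g l t"
        using is_initial_exists by metis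
      have "\<exists>c d.
          (\<forall>i. i \<prec> l \<longrightarrow> (i \<in> coded_set M c \<longleftrightarrow> pair M i \<one> \<in> coded_set M s)) \<and>
          (\<forall>i x. i \<prec> l \<longrightarrow> (pair M i x \<in> coded_set M d \<longleftrightarrow> pair M i x \<in> coded_set M t)) \<and>
          Q k n (coded_set M c) (fn (coded_set M d))" for k
      proof -
        obtain b where b: "\<And>Y' g'. (\<And>i. i \<prec> b \<Longrightarrow> g' i = g i \<and> (i \<in> Y' \<longleftrightarrow> i \<in> Y)) \<Longrightarrow> Q k n Y' g' = Q k n Y g"
          using cont[of g Y k n] by auto
        \<comment> \<open>Cutting \<open>Y\<close> and \<open>g\<close> off at \<open>?m\<close>
          extends the node of length \<open>l\<close> and, by continuity at \<open>b\<close>, leaves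
          the truth of \<open>Q k\<close> unchanged.\<close>
        let ?m = "N.max b l"
        obtain c where c: "coded_set M c = {i\<in>Y. i \<prec> ?m}"
          using coded_set_exists definable_set_const[OF Y] by blast
        obtain d where d: "is_initial M g ?m d"
          using is_initial_exists definable_term_funs[OF g definable_term_var] by blast
        have fn_d: "fn (coded_set M d) i = g i" if "i \<prec> ?m" for i
          by (rule fn_eqI) (simp_all add: is_initialD[OF d that])
        have "Q k n (coded_set M c) (fn (coded_set M d))"
          using b[of "fn (coded_set M d)" "coded_set M c"] Q fn_d c by (simp add: N.less_max_iff_disj)
        moreover have "i \<in> coded_set M c \<longleftrightarrow> pair M i \<one> \<in> coded_set M s" if "i \<prec> l" for i
          using that c coded_set_initial[OF st(1) that] by (simp add: N.less_max_iff_disj)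
        moreover have "pair M i x \<in> coded_set M d \<longleftrightarrow> pair M i x \<in> coded_set M t" if "i \<prec> l" for i x
          using is_initialD[OF d] is_initialD[OF st(2) that] that by (simp add: N.less_max_iff_disj)
        ultimately show ?thesis by blast
      qed
      then have "good n s t l" unfolding good_def by blast
      then show "\<exists>s t. is_initial M (chi M Y) l s \<and> is_initial M g l t \<and> node n (pair M s t)"
        using st is_initial_chi_bin node_iff unfolding is_initial_def by blast
    next
      fix k
      assume *: "\<forall>l. \<exists>s t. is_initial M (chi M Y) l s \<and> is_initial M g l t \<and> node n (pair M s t)"
      obtain b where b: "\<And>Y' g'. (\<And>i. i \<prec> b \<Longrightarrow> g' i = g i \<and> (i \<in> Y' \<longleftrightarrow> i \<in> Y)) \<Longrightarrow> Q k n Y' g' = Q k n Y g"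
        using cont[of g Y k n] by auto
      \<comment> \<open>A length above \<open>k\<close> makes the node speak about
        \<open>Q k\<close>; a length of at least \<open>b\<close> forces every extension to agree
        with \<open>Y\<close> and \<open>g\<close> up to the continuity bound.\<close>
      let ?l = "N.max b (k \<oplus> \<one>)"
      obtain s t where st: "is_initial M (chi M Y) ?l s" "is_initial M g ?l t" "node n (pair M s t)"
        using * by blast
      then obtain l' where l': "is_seq M t l'" "good n s t l'" using node_iff by blast
      then have l: "l' = ?l" using is_seq_length_unique st(2) unfolding is_initial_def by blast
      have kl: "k \<prec> ?l" by (simp add: N.less_max_iff_disj)
      obtain c d where cd: "\<forall>i. i \<prec> ?l \<longrightarrow> (i \<in> coded_set M c \<longleftrightarrow> pair M i \<one> \<in> coded_set M s)"
          "\<forall>i x. i \<prec> ?l \<longrightarrow> (pair M i x \<in> coded_set M d \<longleftrightarrow> pair M i x \<in> coded_set M t)"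
          "Q k n (coded_set M c) (fn (coded_set M d))"
        using l'(2)[unfolded l good_def, rule_format, OF kl] by (elim exE conjE)
      have "fn (coded_set M d) i = g i \<and> (i \<in> coded_set M c \<longleftrightarrow> i \<in> Y)" if "i \<prec> b" for i
      proof
        have i: "i \<prec> ?l" using that by (simp add: N.less_max_iff_disj)
        show "fn (coded_set M d) i = g i"
          by (rule fn_eqI) (simp_all add: cd(2)[rule_format, OF i] is_initialD[OF st(2) i])
        show "i \<in> coded_set M c \<longleftrightarrow> i \<in> Y"
          by (simp add: cd(1)[rule_format, OF i] coded_set_initial[OF st(1) i])
      qed
      then show "Q k n Y g" using b cd(3) by blast
    qed
    note eq = this
    have "(\<exists>g\<in>funs M. \<forall>l. \<exists>s t. is_initial M (chi M Y) l s \<and> is_initial M g l t \<and> node n (pair M s t))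
        \<longleftrightarrow> (\<exists>Z\<in>\<S>. P n Y Z)" if "Y \<in> \<S>" for Y
      unfolding iff[OF that] by (intro bex_cong refl) (rule eq[OF that, symmetric])
    then show ?thesis unfolding points_def nth_A mem_Collect_eq
      by (intro Collect_cong conj_cong refl)
  qed
  ultimately show thesis using that by blast
qed

section \<open>Cantor space is not null\<close>

text \<open>Characterized by exactly the properties that \<open>sum_bounded\<close> asks of its
  function \<open>e\<close>, so that \<open>pow2_unique\<close> can identify the two.\<close>

definition pow2 :: "'m \<Rightarrow> 'm" where
  "pow2 = (SOME e. e \<in> funs M \<and> e \<zero> = \<one> \<and> (\<forall>n. e (n \<oplus> \<one>) = e n \<oplus> e n))"

lemma pow2: "pow2 \<in> funs M \<and> pow2 \<zero> = \<one> \<and> (\<forall>n. pow2 (n \<oplus> \<one>) = pow2 n \<oplus> pow2 n)"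
proof -
  have "definable_term (\<lambda>v w. \<one>)" "definable_term (\<lambda>v w. v 0 \<oplus> v 0)" by (intro definable_intros)+
  from prim_rec[of "\<lambda>v. \<one>" "\<lambda>v i x. x \<oplus> x", OF this]
  obtain R where R: "definable_fun (\<lambda>v w. R v)" "\<And>v. R v \<zero> = \<one>" "\<And>v i. R v (i \<oplus> \<one>) = R v i \<oplus> R v i"
    by metis
  have "definable_fun (\<lambda>v w. R (\<lambda>_. \<zero>))"
    unfolding definable_fun_def
    by (rule definable_skolem[OF R(1) definable_term_const definable_set_var definable_term_var])
  then have "R (\<lambda>_. \<zero>) \<in> funs M" by (simp add: funs_definable)
  then have "\<exists>e. e \<in> funs M \<and> e \<zero> = \<one> \<and> (\<forall>n. e (n \<oplus> \<one>) = e n \<oplus> e n)"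
    using R(2,3) by (intro exI[of _ "R (\<lambda>_. \<zero>)"]) simp
  from someI_ex[OF this] show ?thesis unfolding pow2_def .
qed

lemma pow2_zero [simp]: "pow2 \<zero> = \<one>" and pow2_succ: "pow2 (n \<oplus> \<one>) = pow2 n \<oplus> pow2 n"
  using pow2 by auto

lemma definable_term_pow2 [definable_intros]: "definable_term t \<Longrightarrow> definable_term (\<lambda>v w. pow2 (t v w))"
  using pow2 definable_term_funs by blast

lemma pow2_unique:
  assumes "e \<in> funs M" "e \<zero> = \<one>" "\<And>n. e (n \<oplus> \<one>) = e n \<oplus> e n"
  shows "e = pow2"
proof
  show "e n = pow2 n" for n
  proof (induction n rule: definable_induct)
    case def
    show ?case by (intro definable_intros definable_term_funs[OF assms(1)])
  qed (simp_all add: assms pow2_succ)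
qed

lemma pow2_pos: "\<zero> \<prec> pow2 n"
proof (induction n rule: definable_induct)
  case def
  show ?case by (intro definable_intros)
next
  case (step n)
  then show ?case by (simp add: pow2_succ N.add_pos_pos)
qed simp

lemma pow2_add: "pow2 (m \<oplus> n) = pow2 m \<otimes> pow2 n"
proof (induction n rule: definable_induct)
  case def
  show ?case by (intro definable_intros)
next
  case (step n)
  then show ?case by (simp add: add_succ pow2_succ N.distrib_left)
qed simp

lemma succ_diff: "b \<preceq> a \<Longrightarrow> a \<oplus> \<one> \<ominus> b = (a \<ominus> b) \<oplus> \<one>"
  using le_iff_add add_diff_cancel_right add_comm add_assoc by metis

lemma pow2_succ_diff: "b \<preceq> a \<Longrightarrow> pow2 (a \<oplus> \<one> \<ominus> b) = pow2 (a \<ominus> b) \<oplus> pow2 (a \<ominus> b)"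
  by (simp add: succ_diff pow2_succ)

lemma pow2_diff_less: "b \<prec> a \<Longrightarrow> pow2 (a \<ominus> b) = pow2 (a \<ominus> (b \<oplus> \<one>)) \<oplus> pow2 (a \<ominus> (b \<oplus> \<one>))"
proof -
  assume "b \<prec> a"
  then obtain c where c: "a = c \<oplus> \<one> \<oplus> b" using less_iff_add add_comm by metis
  then have "a \<ominus> b = c \<oplus> \<one>" by (simp only: add_diff_cancel_right)
  moreover have "a \<ominus> (b \<oplus> \<one>) = c" using c by (metis add_diff_cancel_right add_comm add_assoc)
  ultimately show ?thesis by (simp add: pow2_succ)
qed

lemma max_eq1: "b \<preceq> a \<Longrightarrow> N.max a b = a" and max_eq2: "a \<preceq> b \<Longrightarrow> N.max a b = b"
  using less_irrefl less_trans by (auto simp: N.max_def l2_le_def)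

lemma definable_term_max [definable_intros]:
  assumes "definable_term s" "definable_term t"
  shows "definable_term (\<lambda>v w. N.max (s v w) (t v w))"
  unfolding N.max_def by (intro definable_intros assms)

definition ins :: "'m \<Rightarrow> 'm \<Rightarrow> 'm" where
  "ins x r = code_of {i. i \<in> coded_set M x \<or> i = r}"

lemma definable_term_ins [definable_intros]:
  assumes "definable_term s" "definable_term t"
  shows "definable_term (\<lambda>v w. ins (s v w) (t v w))"
  unfolding ins_def by (intro definable_intros definable_term_shift assms)

lemma coded_set_ins: "coded_set M (ins x r) = {i. i \<in> coded_set M x \<or> i = r}"
proof -
  obtain k where "\<And>i. i \<in> coded_set M x \<Longrightarrow> i \<prec> k" using coded_set_bounded by blast
  then show ?thesis
    unfolding ins_def
    by (intro coded_set_code_of[of _ "N.max k (r \<oplus> \<one>)"] definable_intros) (auto simp: N.less_max_iff_disj)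
qed

lemma coded_empty: "\<exists>c. coded_set M c = {}"
proof -
  have "definable_set (\<lambda>v w. {i. False})" by (intro definable_intros)
  from coded_set_exists[OF this, of \<zero>] show ?thesis by simp
qed

text \<open>Given intervals of total length at most 1/4, a point \<open>Y\<close> outside of them with prescribed
  first bit is found bit by bit.  The measure of the intervals relative to the cone above the current
  initial segment is kept at most 1/2; this is stated for all finite subsequences of the intervals, since
  their infinite sum need not exist.\<close>

lemma not_covered:
  assumes \<sigma>: "basic_open_seq M \<sigma>" and sum: "\<And>l. sum_bounded M \<sigma> l (\<one> \<oplus> \<one>)"
  shows "\<exists>Y\<in>\<S>. (\<zero> \<in> Y \<longleftrightarrow> b) \<and> Y \<notin> open_union M \<sigma>"
proof -
  have \<sigma>_fun: "\<sigma> \<in> funs M" using \<sigma> by (simp add: basic_open_seq_def)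
  define len where "len i = mu (\<lambda>d. is_seq M (\<sigma> i) d)" for i
  have len_eq: "len i = d" if "is_seq M (\<sigma> i) d" for i d
    unfolding len_def by (rule mu_unique) (use that is_seq_length_unique in blast)+
  have len: "is_seq M (\<sigma> i) (len i)" for i
  proof -
    obtain d where "is_seq M (\<sigma> i) d" using \<sigma> unfolding basic_open_seq_def is_bin_seq_def by blast
    then show ?thesis using len_eq by simp
  qed
  note def_\<sigma> = definable_term_funs[OF \<sigma>_fun]
  have def_len: "definable_term (\<lambda>v w. len (t v w))" if "definable_term t" for t
    unfolding len_def by (intro definable_intros def_\<sigma> definable_term_shift that)
  \<comment> \<open>Compatibility of interval \<open>i\<close> with the cone of length
    \<open>j\<close> described by \<open>c\<close>: they agree at all positions that both determine,
    so one contains the other.\<close>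
  define compat where "compat i c j \<longleftrightarrow> (\<forall>r. r \<prec> len i \<longrightarrow> r \<prec> j \<longrightarrow>
      (r \<in> coded_set M c \<longleftrightarrow> pair M r \<one> \<in> coded_set M (\<sigma> i)))" for i c j
  \<comment> \<open>This is \<open>2^K\<close> times the measure of the intersection of interval
    \<open>i\<close> with the cone; \<open>U\<close> below adds these numerators over the first
    intervals.\<close>
  define summand where "summand K c j i = (if compat i c j then pow2 (K \<ominus> N.max (len i) j) else \<zero>)" for K c j i
  have def_summand: "definable_term (\<lambda>v w. summand (t v w) (u v w) (x v w) (y v w))"
    if "definable_term t" "definable_term u" "definable_term x" "definable_term y" for t u x y
    unfolding summand_def compat_def
    by (intro definable_intros def_\<sigma> def_len definable_term_shift that)
  have "definable_term (\<lambda>v w. v 0 \<oplus> summand (v (Suc (Suc 0))) (v (Suc (Suc 1))) (v (Suc (Suc 2))) (v 1))"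
    by (intro definable_intros def_summand)
  from prim_rec[of "\<lambda>v. \<zero>" "\<lambda>v i x. x \<oplus> summand (v 0) (v 1) (v 2) i", OF definable_term_const this]
  obtain R where R: "definable_fun (\<lambda>v w. R v)" "\<And>v. R v \<zero> = \<zero>"
      "\<And>v i. R v (i \<oplus> \<one>) = R v i \<oplus> summand (v 0) (v 1) (v 2) i"
    by metis
  define U where "U K c j = R (case_nat K (case_nat c (\<lambda>_. j)))" for K c j
  have U_zero: "U K c j \<zero> = \<zero>" and U_succ: "U K c j (i \<oplus> \<one>) = U K c j i \<oplus> summand K c j i" for K c j i
    by (simp_all add: U_def R numeral_2_eq_2)
  have def_U: "definable_term (\<lambda>v w. U (t v w) (u v w) (x v w) (y v w))"
    if "definable_term t" "definable_term u" "definable_term x" "definable_term y" for t u x y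
    unfolding U_def
  proof (rule definable_skolem[OF R(1) _ definable_set_var that(4)])
    show "definable_term (\<lambda>v w. (case i of 0 \<Rightarrow> t v w | Suc j \<Rightarrow> (case j of 0 \<Rightarrow> u v w | Suc _ \<Rightarrow> x v w)))" for i
      using that by (cases i; cases "i - 1") simp_all
  qed
  define lens where "lens l K \<longleftrightarrow> (\<forall>i. i \<prec> l \<longrightarrow> len i \<preceq> K)" for l K
  have lens_mono: "lens l K" if "lens l' K'" "l \<preceq> l'" "K' \<preceq> K" for l l' K K'
    using that unfolding lens_def by (meson N.less_le_trans N.order_trans)
  have le_if_succ_le: "i \<preceq> l" if "i \<oplus> \<one> \<preceq> l" for i l
    using that by (simp add: succ_le_iff_less N.less_imp_le)

  \<comment> \<open>Doubling the common denominator doubles every numerator, so comparisons do not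
    depend on which large \<open>K\<close> is chosen.\<close>
  have scale: "U (K \<oplus> \<one>) c j l = U K c j l \<oplus> U K c j l" if "j \<preceq> K" "lens l K" for K c j l
  proof -
    have "i \<preceq> l \<longrightarrow> U (K \<oplus> \<one>) c j i = U K c j i \<oplus> U K c j i" for i
    proof (induction i rule: definable_induct)
      case def
      show ?case by (intro definable_intros def_U)
    next
      case (step i)
      show ?case
      proof
        assume i: "i \<oplus> \<one> \<preceq> l"
        then have "N.max (len i) j \<preceq> K" using that unfolding lens_def by (simp add: succ_le_iff_less)
        then have "summand (K \<oplus> \<one>) c j i = summand K c j i \<oplus> summand K c j i"
          unfolding summand_def by (simp add: pow2_succ_diff)
        then show "U (K \<oplus> \<one>) c j (i \<oplus> \<one>) = U K c j (i \<oplus> \<one>) \<oplus> U K c j (i \<oplus> \<one>)"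
          using step le_if_succ_le[OF i] by (simp add: U_succ N.add_ac)
      qed
    qed (simp add: U_zero)
    then show ?thesis by simp
  qed

  \<comment> \<open>The cone of length \<open>j\<close> is the disjoint union of its two extensions.
    An interval of length at most \<open>j\<close> meets both in equal parts; a longer one lies in
    the extension that its bit at \<open>j\<close> selects. With \<open>j \<prec> K\<close> the
    halving is exact.\<close>
  have split: "U K c j l = U K c0 (j \<oplus> \<one>) l \<oplus> U K c1 (j \<oplus> \<one>) l"
    if "j \<prec> K" and c0: "\<And>r. r \<prec> j \<Longrightarrow> r \<in> coded_set M c0 \<longleftrightarrow> r \<in> coded_set M c" "j \<notin> coded_set M c0"
      and c1: "\<And>r. r \<prec> j \<Longrightarrow> r \<in> coded_set M c1 \<longleftrightarrow> r \<in> coded_set M c" "j \<in> coded_set M c1" for K c c0 c1 j l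
  proof -
    have summand_split: "summand K c j i = summand K c0 (j \<oplus> \<one>) i \<oplus> summand K c1 (j \<oplus> \<one>) i" for i
    proof (cases "len i \<preceq> j")
      case True
      then have "r \<prec> j" if "r \<prec> len i" for r using that by (rule N.less_le_trans[rotated])
      then have "compat i c0 (j \<oplus> \<one>) \<longleftrightarrow> compat i c j" "compat i c1 (j \<oplus> \<one>) \<longleftrightarrow> compat i c j"
        unfolding compat_def using c0 c1 by (auto simp: less_succ)
      moreover have "N.max (len i) j = j" "N.max (len i) (j \<oplus> \<one>) = j \<oplus> \<one>"
        using True by (simp_all add: max_eq2 N.add_increasing2)
      ultimately show ?thesis unfolding summand_def using pow2_diff_less[OF \<open>j \<prec> K\<close>] by simp
    next
      case False
      then have j: "j \<prec> len i" by (simp add: N.not_le)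
      then have "N.max (len i) j = len i" "N.max (len i) (j \<oplus> \<one>) = len i"
        by (simp_all add: max_eq1 succ_le_iff_less N.less_imp_le)
      moreover have "compat i c0 (j \<oplus> \<one>) \<longleftrightarrow> compat i c j \<and> pair M j \<one> \<notin> coded_set M (\<sigma> i)"
        "compat i c1 (j \<oplus> \<one>) \<longleftrightarrow> compat i c j \<and> pair M j \<one> \<in> coded_set M (\<sigma> i)"
        unfolding compat_def less_succ using j c0 c1 by blast+
      ultimately show ?thesis unfolding summand_def by simp
    qed
    show ?thesis
    proof (induction l rule: definable_induct)
      case def
      show ?case by (intro definable_intros def_U)
    next
      case (step l)
      then show ?case by (simp add: U_succ summand_split N.add_ac)
    qed (simp add: U_zero)
  qed

  have U_mono: "U K c j l \<preceq> U K c j l'" if l: "l \<preceq> l'" for K c j l l'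
  proof -
    have "U K c j l \<preceq> U K c j (l \<oplus> r)" for r
    proof (induction r rule: definable_induct)
      case def
      show ?case by (intro definable_intros def_U)
    next
      case (step r)
      then show ?case unfolding add_succ U_succ by (simp add: N.add_increasing2)
    qed simp
    then show ?thesis using l le_iff_add by metis
  qed

  \<comment> \<open>The cone of length \<zero> is the whole space, so \<open>U\<close> agrees with
    the partial sums \<open>p\<close> of \<open>sum_bounded\<close>; the exponent 2 there gives the
    factor 4.\<close>
  have total: "\<exists>K. lens l K \<and> (U K c \<zero> l \<oplus> U K c \<zero> l) \<oplus> (U K c \<zero> l \<oplus> U K c \<zero> l) \<preceq> pow2 K" for c l
  proof -
    obtain K e p where e: "e \<in> funs M" "e \<zero> = \<one>" "\<forall>n. e (n \<oplus> \<one>) = e n \<oplus> e n"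
      and p: "p \<in> funs M" "p \<zero> = \<zero>"
        "\<forall>i. i \<prec> l \<longrightarrow> (\<exists>d. is_seq M (\<sigma> i) d \<and> d \<preceq> K)"
        "\<forall>i d r. i \<prec> l \<and> is_seq M (\<sigma> i) r \<and> d \<oplus> r = K \<longrightarrow> p (i \<oplus> \<one>) = p i \<oplus> e d"
        "e (\<one> \<oplus> \<one>) \<otimes> p l \<preceq> e K"
      using sum[of l] unfolding sum_bounded_def by (elim exE bexE conjE)
    have e: "e = pow2" using e by (intro pow2_unique) auto
    have lens: "lens l K" unfolding lens_def using p(3) len_eq by metis
    have "i \<preceq> l \<longrightarrow> p i = U K c \<zero> i" for i
    proof (induction i rule: definable_induct)
      case def
      show ?case by (intro definable_intros def_U definable_term_funs[OF p(1)])
    next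
      case (step i)
      show ?case
      proof
        assume i: "i \<oplus> \<one> \<preceq> l"
        then have "i \<prec> l" by (simp add: succ_le_iff_less)
        then have "(K \<ominus> len i) \<oplus> len i = K" using lens unfolding lens_def by simp
        then have "p (i \<oplus> \<one>) = p i \<oplus> pow2 (K \<ominus> len i)" using p(4) len \<open>i \<prec> l\<close> e by blast
        moreover have "summand K c \<zero> i = pow2 (K \<ominus> len i)"
          unfolding summand_def compat_def by (simp add: not_less_zero max_eq1)
        ultimately show "p (i \<oplus> \<one>) = U K c \<zero> (i \<oplus> \<one>)"
          using step le_if_succ_le[OF i] by (simp add: U_succ)
      qed
    qed (simp add: p U_zero)
    then have "p l = U K c \<zero> l" by simp
    moreover have "pow2 (\<one> \<oplus> \<one>) \<otimes> x = (x \<oplus> x) \<oplus> (x \<oplus> x)" for x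
    proof -
      have "pow2 \<one> = \<one> \<oplus> \<one>" using pow2_succ[of "\<zero>"] by (simp only: zero_add pow2_zero)
      then show ?thesis by (simp only: pow2_succ add_mul one_mul)
    qed
    ultimately show ?thesis using p(5) e lens by auto
  qed

  \<comment> \<open>The right side is the numerator of the cone itself, so this is the bound 1/2 on
    relative measure. \<open>K\<close> depends on \<open>l\<close> since it must bound the first
    \<open>l\<close> lengths.\<close>
  define good where "good c j \<longleftrightarrow>
      (\<forall>l. \<exists>K. j \<preceq> K \<and> lens l K \<and> U K c j l \<oplus> U K c j l \<preceq> pow2 (K \<ominus> j))" for c j
  have def_good: "definable (\<lambda>v w. good (t v w) (u v w))" if "definable_term t" "definable_term u" for t u
    unfolding good_def lens_def by (intro definable_intros def_U def_len definable_term_shift that)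

  have good_step: "good c0 (j \<oplus> \<one>) \<or> good c1 (j \<oplus> \<one>)"
    if good: "good c j" and c0: "\<And>r. r \<prec> j \<Longrightarrow> r \<in> coded_set M c0 \<longleftrightarrow> r \<in> coded_set M c" "j \<notin> coded_set M c0"
      and c1: "\<And>r. r \<prec> j \<Longrightarrow> r \<in> coded_set M c1 \<longleftrightarrow> r \<in> coded_set M c" "j \<in> coded_set M c1" for c c0 c1 j
  proof (rule ccontr)
    assume "\<not> ?thesis"
    then obtain l0 l1 where
      l0: "\<And>K. j \<oplus> \<one> \<preceq> K \<Longrightarrow> lens l0 K \<Longrightarrow> \<not> U K c0 (j \<oplus> \<one>) l0 \<oplus> U K c0 (j \<oplus> \<one>) l0 \<preceq> pow2 (K \<ominus> (j \<oplus> \<one>))" and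
      l1: "\<And>K. j \<oplus> \<one> \<preceq> K \<Longrightarrow> lens l1 K \<Longrightarrow> \<not> U K c1 (j \<oplus> \<one>) l1 \<oplus> U K c1 (j \<oplus> \<one>) l1 \<preceq> pow2 (K \<ominus> (j \<oplus> \<one>))"
      unfolding good_def by blast
    \<comment> \<open>By \<open>U_mono\<close> a violated bound stays violated for longer sums, so
      both violations can be compared at one common number of intervals.\<close>
    let ?l = "N.max l0 l1"
    obtain K where K: "j \<preceq> K" "lens ?l K" "U K c j ?l \<oplus> U K c j ?l \<preceq> pow2 (K \<ominus> j)"
      using good unfolding good_def by blast
    \<comment> \<open>\<open>good\<close> provides only \<open>j \<preceq> K\<close>, whereas
      \<open>split\<close> needs a strict inequality; \<open>scale\<close> later leads back from
      \<open>?K\<close> to \<open>K\<close>.\<close>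
    let ?K = "K \<oplus> \<one>" and ?P = "pow2 (K \<ominus> j)"
    have jK: "j \<prec> ?K" "j \<oplus> \<one> \<preceq> ?K" using K(1) by (simp_all add: less_succ_iff_le)
    have P: "pow2 (?K \<ominus> (j \<oplus> \<one>)) = ?P" by simp
    have "lens l0 ?K" "lens l1 ?K" using lens_mono[OF K(2)] by simp_all
    then have "?P \<prec> U ?K c0 (j \<oplus> \<one>) l0 \<oplus> U ?K c0 (j \<oplus> \<one>) l0" "?P \<prec> U ?K c1 (j \<oplus> \<one>) l1 \<oplus> U ?K c1 (j \<oplus> \<one>) l1"
      using l0[OF jK(2)] l1[OF jK(2)] by (simp_all add: P N.not_le)
    moreover have "U ?K c0 (j \<oplus> \<one>) l0 \<preceq> U ?K c0 (j \<oplus> \<one>) ?l" "U ?K c1 (j \<oplus> \<one>) l1 \<preceq> U ?K c1 (j \<oplus> \<one>) ?l"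
      by (rule U_mono, simp)+
    ultimately have "?P \<prec> U ?K c0 (j \<oplus> \<one>) ?l \<oplus> U ?K c0 (j \<oplus> \<one>) ?l" "?P \<prec> U ?K c1 (j \<oplus> \<one>) ?l \<oplus> U ?K c1 (j \<oplus> \<one>) ?l"
      by (meson N.add_mono N.less_le_trans)+
    then have "?P \<oplus> ?P \<prec> (U ?K c0 (j \<oplus> \<one>) ?l \<oplus> U ?K c0 (j \<oplus> \<one>) ?l) \<oplus> (U ?K c1 (j \<oplus> \<one>) ?l \<oplus> U ?K c1 (j \<oplus> \<one>) ?l)"
      by (rule N.add_strict_mono)
    also have "\<dots> = U ?K c j ?l \<oplus> U ?K c j ?l"
      using split[OF jK(1), of c0 c c1 ?l] c0 c1 by (simp add: N.add_ac)
    also have "\<dots> = (U K c j ?l \<oplus> U K c j ?l) \<oplus> (U K c j ?l \<oplus> U K c j ?l)"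
      by (simp add: scale[OF K(1,2)])
    also have "\<dots> \<preceq> ?P \<oplus> ?P" using K(3) by (intro N.add_mono)
    finally show False by simp
  qed

  obtain z where z: "coded_set M z = {}" using coded_empty by blast
  \<comment> \<open>The first bit is prescribed, so the better half cannot be chosen: the cone of
    length \<one> may contain the whole cover. As its own measure is 1/2, total measure 1/4 still
    gives relative measure at most 1/2.\<close>
  define start where "start = (if b then ins z \<zero> else z)"
  have good_start: "good start (\<zero> \<oplus> \<one>)"
    unfolding good_def
  proof
    fix l
    obtain K where K: "lens l K" "(U K z \<zero> l \<oplus> U K z \<zero> l) \<oplus> (U K z \<zero> l \<oplus> U K z \<zero> l) \<preceq> pow2 K"
      using total by blast
    have "U (K \<oplus> \<one>) z \<zero> l = U (K \<oplus> \<one>) z (\<zero> \<oplus> \<one>) l \<oplus> U (K \<oplus> \<one>) (ins z \<zero>) (\<zero> \<oplus> \<one>) l"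
      by (rule split) (simp_all add: less_succ_iff_le not_less_zero z coded_set_ins)
    then have "U (K \<oplus> \<one>) start (\<zero> \<oplus> \<one>) l \<preceq> U (K \<oplus> \<one>) z \<zero> l"
      by (cases b) (simp_all add: start_def N.add_increasing N.add_increasing2)
    then have "U (K \<oplus> \<one>) start (\<zero> \<oplus> \<one>) l \<preceq> U K z \<zero> l \<oplus> U K z \<zero> l"
      using scale[OF zero_le K(1)] by metis
    then have "U (K \<oplus> \<one>) start (\<zero> \<oplus> \<one>) l \<oplus> U (K \<oplus> \<one>) start (\<zero> \<oplus> \<one>) l \<preceq> pow2 K"
      using K(2) N.add_mono N.order_trans by meson
    then have "U (K \<oplus> \<one>) start (\<zero> \<oplus> \<one>) l \<oplus> U (K \<oplus> \<one>) start (\<zero> \<oplus> \<one>) l \<preceq> pow2 (K \<oplus> \<one> \<ominus> (\<zero> \<oplus> \<one>))"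
      by simp
    moreover have "lens l (K \<oplus> \<one>)" by (rule lens_mono[OF K(1)]) simp_all
    moreover have "\<zero> \<oplus> \<one> \<preceq> K \<oplus> \<one>" by simp
    ultimately show "\<exists>K. \<zero> \<oplus> \<one> \<preceq> K \<and> lens l K \<and>
        U K start (\<zero> \<oplus> \<one>) l \<oplus> U K start (\<zero> \<oplus> \<one>) l \<preceq> pow2 (K \<ominus> (\<zero> \<oplus> \<one>))" by blast
  qed

  \<comment> \<open>Greedy choice: bit j+1 stays 0 if \<open>good\<close> survives and becomes 1
    otherwise. The code \<open>f j\<close> below thus settles the bits 0 to j, and since
    \<open>good\<close> is definable, \<open>prim_rec\<close> applies.\<close>
  have "definable_term (\<lambda>v w. if good (v 0) (v 1 \<oplus> \<one> \<oplus> \<one>) then v 0 else ins (v 0) (v 1 \<oplus> \<one>))"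
    by (intro definable_intros def_good)
  from prim_rec[of "\<lambda>v. start" "\<lambda>v j x. if good x (j \<oplus> \<one> \<oplus> \<one>) then x else ins x (j \<oplus> \<one>)", OF definable_term_const this]
  obtain G where G: "definable_fun (\<lambda>v w. G v)" "\<And>v. G v \<zero> = start"
      "\<And>v j. G v (j \<oplus> \<one>) = (if good (G v j) (j \<oplus> \<one> \<oplus> \<one>) then G v j else ins (G v j) (j \<oplus> \<one>))"
    by metis
  define f where "f = G (\<lambda>_. \<zero>)"
  have f_zero: "f \<zero> = start"
    and f_succ: "f (j \<oplus> \<one>) = (if good (f j) (j \<oplus> \<one> \<oplus> \<one>) then f j else ins (f j) (j \<oplus> \<one>))" for j
    by (simp_all add: f_def G)
  have def_f: "definable_term (\<lambda>v w. f (t v w))" if "definable_term t" for t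
    unfolding f_def by (rule definable_skolem[OF G(1) definable_term_const definable_set_var that])
  have inv: "good (f j) (j \<oplus> \<one>) \<and> (\<forall>i\<in>coded_set M (f j). i \<preceq> j) \<and> (\<zero> \<in> coded_set M (f j) \<longleftrightarrow> b)" for j
  proof (induction j rule: definable_induct)
    case def
    show ?case by (intro definable_intros def_good def_f)
  next
    case zero
    then show ?case using good_start by (auto simp: f_zero start_def coded_set_ins z)
  next
    case (step j)
    then have bd: "\<And>i. i \<in> coded_set M (f j) \<Longrightarrow> i \<preceq> j" by blast
    then have "j \<oplus> \<one> \<notin> coded_set M (f j)" using less_irrefl succ_le_iff_less by blast
    then have "good (f j) (j \<oplus> \<one> \<oplus> \<one>) \<or> good (ins (f j) (j \<oplus> \<one>)) (j \<oplus> \<one> \<oplus> \<one>)"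
      using step less_irrefl by (intro good_step[of "f j" "j \<oplus> \<one>"]) (auto simp: coded_set_ins)
    moreover have "i \<preceq> j \<oplus> \<one>" if "i \<preceq> j" for i using that by (simp add: N.add_increasing2)
    ultimately show ?case using step succ_neq_zero[of j] by (auto simp: f_succ coded_set_ins)
  qed
  define Y where "Y = {i. i \<in> coded_set M (f i)}"
  have Y: "Y \<in> \<S>" unfolding Y_def by (rule comprehension) (intro definable_intros def_f)
  have Y_iff: "\<forall>r. r \<preceq> j \<longrightarrow> (r \<in> coded_set M (f j) \<longleftrightarrow> r \<in> Y)" for j
  proof (induction j rule: definable_induct)
    case def
    show ?case using Y by (intro definable_intros def_f)
  next
    case zero
    then show ?case by (auto simp: l2_le_def not_less_zero Y_def)
  next
    case (step j)
    show ?case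
    proof (intro allI impI)
      fix r assume r: "r \<preceq> j \<oplus> \<one>"
      show "r \<in> coded_set M (f (j \<oplus> \<one>)) \<longleftrightarrow> r \<in> Y"
      proof (cases "r = j \<oplus> \<one>")
        case False
        then have "r \<preceq> j" using r by (metis l2_le_def less_succ_iff_le)
        then show ?thesis using step False by (auto simp: f_succ coded_set_ins)
      qed (simp add: Y_def)
    qed
  qed
  have "Y \<notin> open_union M \<sigma>"
  proof
    assume "Y \<in> open_union M \<sigma>"
    then obtain i d where i: "is_initial M (chi M Y) d (\<sigma> i)" unfolding open_union_def by blast
    then have d: "len i = d" by (intro len_eq) (simp add: is_initial_def)
    \<comment> \<open>The cone of length d+1 around \<open>Y\<close> lies inside interval
      \<open>i\<close>, which alone has relative measure 1 there, against the bound 1/2. Summing up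
      to i+1 includes this interval.\<close>
    obtain K where K: "d \<oplus> \<one> \<preceq> K"
      "U K (f d) (d \<oplus> \<one>) (i \<oplus> \<one>) \<oplus> U K (f d) (d \<oplus> \<one>) (i \<oplus> \<one>) \<preceq> pow2 (K \<ominus> (d \<oplus> \<one>))"
      using inv[of d] unfolding good_def by blast
    have "compat i (f d) (d \<oplus> \<one>)"
      unfolding compat_def d
      using Y_iff coded_set_initial[OF i] by (simp add: l2_le_def)
    moreover have "N.max (len i) (d \<oplus> \<one>) = d \<oplus> \<one>" by (simp add: d max_eq2 N.add_increasing2)
    ultimately have "summand K (f d) (d \<oplus> \<one>) i = pow2 (K \<ominus> (d \<oplus> \<one>))" by (simp add: summand_def)
    then have le: "pow2 (K \<ominus> (d \<oplus> \<one>)) \<preceq> U K (f d) (d \<oplus> \<one>) (i \<oplus> \<one>)"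
      by (simp add: U_succ N.add_increasing)
    have "pow2 (K \<ominus> (d \<oplus> \<one>)) \<oplus> pow2 (K \<ominus> (d \<oplus> \<one>)) \<preceq> pow2 (K \<ominus> (d \<oplus> \<one>))"
      using N.add_mono[OF le le] K(2) by (rule N.order_trans)
    then show False using pow2_pos[of "K \<ominus> (d \<oplus> \<one>)"] by (simp add: N.not_le[symmetric])
  qed
  moreover have "\<zero> \<in> Y \<longleftrightarrow> b" using inv[of \<zero>] by (simp add: Y_def)
  ultimately show ?thesis using Y by blast
qed

section \<open>Choice principles\<close>

lemma definable_is_initial [definable_intros]:
  assumes "definable_fun f" "definable_term k" "definable_term s"
  shows "definable (\<lambda>v w. is_initial M (f v w) (k v w) (s v w))"
  unfolding is_initial_def
  by (intro definable_intros definable_term_shift assms definable_term_fun[OF definable_fun_shift[OF assms(1)]])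

lemma definable_fun_chi [definable_intros]:
  assumes "definable_set U"
  shows "definable_fun (\<lambda>v w. chi M (U v w))"
  unfolding definable_fun_def by (intro definable_intros definable_set_shift assms)

lemma nth_set_in: "Z \<in> \<S> \<Longrightarrow> nth_set M Z n \<in> \<S>"
  by (rule definable_set_in) (intro definable_intros)

lemma coded_set_in: "coded_set M c \<in> \<S>"
  by (rule definable_set_in) (intro definable_intros)

text \<open>Turns the quantifier over functions into one over sets, the shape to which Sigma^1_1
  choice applies.\<close>

lemma points_eq: "points M A = {X \<in> \<S>. \<exists>G\<in>\<S>. \<forall>k. \<exists>s t.
    is_initial M (chi M X) k s \<and> is_initial M (fn G) k t \<and> pair M s t \<in> A}"
proof -
  have "fn G \<in> funs M" if "G \<in> \<S>" for G
    using that definable_fun_fn[OF definable_set_const] by (simp add: funs_definable)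
  then have "(\<exists>f\<in>funs M. R f) \<longleftrightarrow> (\<exists>G\<in>\<S>. R (fn G))" for R
    using funs_iff_graph fn_graph by metis
  then show ?thesis unfolding points_def by simp
qed

text \<open>The path \<open>G\<close> witnessing membership is the inner existential set of the
  Sigma^1_1 formula; only the points themselves are collected in a sequence.\<close>

lemma choice_of_points:
  assumes AC: "Sigma11_AC M" and A: "analytic_code_seq M A"
    and nonempty: "\<And>n. points M (nth_set M A n) \<noteq> {}"
  obtains X where "X \<in> \<S>" "\<And>n. nth_set M X n \<in> points M (nth_set M A n)"
proof -
  define P where "P n X G \<longleftrightarrow> (\<forall>k. \<exists>s t.
      is_initial M (chi M X) k s \<and> is_initial M (fn G) k t \<and> pair M s t \<in> nth_set M A n)" for n X G
  have "A \<in> \<S>" using A by (simp add: analytic_code_seq_def)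
  then have "definable (\<lambda>v w. P (v 0) (w 0) (w 1))"
    unfolding P_def by (intro definable_intros)
  moreover have "\<exists>X\<in>\<S>. \<exists>G\<in>\<S>. P n X G" for n
    using nonempty[of n] unfolding points_eq P_def by blast
  ultimately obtain Z where Z: "Z \<in> \<S>" "\<And>n. \<exists>G\<in>\<S>. P n (nth_set M Z n) G"
    using Sigma11_AC_D[OF AC] by blast
  then have "nth_set M Z n \<in> points M (nth_set M A n)" for n
    unfolding points_eq P_def using nth_set_in by blast
  then show thesis using that Z(1) by blast
qed

text \<open>A member approximates itself: one index serves every precision \<open>k\<close>.\<close>

lemma subset_seq_closure:
  assumes "enumerable M C" "C \<subseteq> \<S>"
  shows "C \<subseteq> seq_closure M C"
proof
  fix X assume X: "X \<in> C"
  obtain Y where Y: "Y \<in> \<S>" "lists_all M Y C" using assms(1) unfolding enumerable_def by blast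
  then obtain m where "X = nth_set M Y m" using X unfolding lists_all_def by blast
  then show "X \<in> seq_closure M C"
    unfolding seq_closure_def using X Y assms(2) by blast
qed

lemma seq_closure_empty: "seq_closure M {} = {}"
  by (simp add: seq_closure_def)

lemma choice_of_closure:
  assumes "Sigma11_AC M" "analytic_code_seq M A"
    and "\<And>n. enumerable M (points M (nth_set M A n))" "\<And>n. points M (nth_set M A n) \<noteq> {}"
  shows "\<exists>X\<in>\<S>. \<forall>n. nth_set M X n \<in> seq_closure M (points M (nth_set M A n))"
proof -
  have "points M (nth_set M A n) \<subseteq> \<S>" for n by (auto simp: points_def)
  then show ?thesis
    using choice_of_points[OF assms(1,2,4)] subset_seq_closure[OF assms(3)] by (metis subsetD)
qed

lemma pow2_mono: "m \<preceq> n \<Longrightarrow> pow2 m \<preceq> pow2 n"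
proof -
  assume "m \<preceq> n"
  then obtain r where r: "n = m \<oplus> r" using le_iff_add by blast
  have "\<one> \<preceq> pow2 r" using pow2_pos[of r] succ_le_iff_less[of \<zero>] by simp
  then have "pow2 m \<otimes> \<one> \<preceq> pow2 m \<otimes> pow2 r" by (rule N.mult_left_mono) simp
  then show ?thesis by (simp add: r pow2_add)
qed

text \<open>A cover is a total sequence of intervals, so even the empty class needs genuine ones:
  with lengths k+i+1 every finite sum is below \<open>2^(-k)\<close>. This is what makes a class of
  positive measure non-empty.\<close>

lemma measure_zero_empty: "measure_zero M {}"
  unfolding measure_zero_def
proof (intro allI)
  fix k
  define zeros where "zeros L = code_of {p. \<exists>r. r \<prec> L \<and> p = pair M r \<zero>}" for L
  note zeros = is_seq_code_of[OF definable_term_const, of _ \<zero>, folded zeros_def]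
  have bin: "is_bin_seq M (zeros L) L" for L
    using zeros[of L] unfolding is_bin_seq_def by auto
  define \<sigma> where "\<sigma> i = zeros (k \<oplus> (i \<oplus> \<one>))" for i
  have "definable_fun (\<lambda>v w. \<sigma>)"
    unfolding definable_fun_def \<sigma>_def zeros_def by (intro definable_intros)
  then have open_seq: "basic_open_seq M \<sigma>"
    unfolding basic_open_seq_def funs_definable using bin by (auto simp: \<sigma>_def)
  have "sum_bounded M \<sigma> l k" for l
  proof -
    \<comment> \<open>The geometric sum of \<open>2^(l - r)\<close> over r < i in closed form, with
      common denominator exponent k+l+1.\<close>
    define p where "p i = pow2 (l \<oplus> \<one>) \<ominus> pow2 (l \<oplus> \<one> \<ominus> i)" for i
    have "definable_fun (\<lambda>v w. p)"
      unfolding definable_fun_def p_def by (intro definable_intros)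
    then have p: "p \<in> funs M" by (simp add: funs_definable)
    have p_le: "p l \<preceq> pow2 (l \<oplus> \<one>)"
      using diff_eq_iff[of "p l" "pow2 (l \<oplus> \<one>)"] le_iff_add unfolding p_def by (metis zero_le)
    have step: "p (i \<oplus> \<one>) = p i \<oplus> pow2 d"
      if "is_seq M (\<sigma> i) r" "d \<oplus> r = k \<oplus> (l \<oplus> \<one>)" for i d r
    proof -
      have "r = k \<oplus> (i \<oplus> \<one>)"
        using is_seq_length_unique[OF that(1)[unfolded \<sigma>_def] zeros(1)] .
      then have "k \<oplus> (d \<oplus> i \<oplus> \<one>) = k \<oplus> (l \<oplus> \<one>)" using that(2) by (simp add: N.add_ac)
      then have l: "l = d \<oplus> i" by simp
      have "l \<oplus> \<one> = d \<oplus> \<one> \<oplus> i" "l \<oplus> \<one> = d \<oplus> (i \<oplus> \<one>)" by (simp_all add: l N.add_ac)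
      then have 1: "l \<oplus> \<one> \<ominus> i = d \<oplus> \<one>" "l \<oplus> \<one> \<ominus> (i \<oplus> \<one>) = d"
        by (metis add_diff_cancel_right)+
      have "pow2 (d \<oplus> \<one>) \<preceq> pow2 (l \<oplus> \<one>)" by (rule pow2_mono) (simp add: l)
      then obtain c where c: "pow2 (l \<oplus> \<one>) = c \<oplus> (pow2 d \<oplus> pow2 d)"
        using le_iff_add add_comm pow2_succ by metis
      have "p i = c" unfolding p_def 1 pow2_succ[of d] c by (rule add_diff_cancel_right)
      moreover have "p (i \<oplus> \<one>) = c \<oplus> pow2 d"
        unfolding p_def 1 c by (metis add_assoc add_diff_cancel_right)
      ultimately show ?thesis by simp
    qed
    show ?thesis
      unfolding sum_bounded_def
    proof (rule exI[of _ "k \<oplus> (l \<oplus> \<one>)"], rule bexI[of _ pow2], rule bexI[of _ p], intro conjI allI impI)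
      show "\<exists>d. is_seq M (\<sigma> i) d \<and> d \<preceq> k \<oplus> (l \<oplus> \<one>)" if "i \<prec> l" for i
        using zeros(1)[of "k \<oplus> (i \<oplus> \<one>)"] that by (auto simp: \<sigma>_def N.less_imp_le)
      show "pow2 k \<otimes> p l \<preceq> pow2 (k \<oplus> (l \<oplus> \<one>))"
        unfolding pow2_add[of k] by (rule N.mult_left_mono[OF p_le zero_le])
    qed (use p pow2 step in \<open>auto simp: p_def\<close>)
  qed
  then show "\<exists>\<sigma>. basic_open_seq M \<sigma> \<and> {} \<subseteq> open_union M \<sigma> \<and> (\<forall>l. sum_bounded M \<sigma> l k)"
    using open_seq by blast
qed

lemma AC_imp_choices:
  assumes "Sigma11_AC M"
  shows "choice_nonempty M" "choice_positive_measure M" "choice_not_enumerable M" "choice_open M"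
proof -
  show "choice_nonempty M"
    unfolding choice_nonempty_def using choice_of_closure[OF assms] by blast
  have "points M (nth_set M A n) \<noteq> {}"
    if "positive_measure M (seq_closure M (points M (nth_set M A n)))" for A n
    using that measure_zero_empty seq_closure_empty unfolding positive_measure_def by metis
  then show "choice_positive_measure M"
    unfolding choice_positive_measure_def using choice_of_closure[OF assms] by blast
  have "enumerable M {}" using ex_set unfolding enumerable_def lists_all_def by blast
  then have "points M (nth_set M A n) \<noteq> {}"
    if "\<not> enumerable M (seq_closure M (points M (nth_set M A n)))" for A n
    using that seq_closure_empty by metis
  then show "choice_not_enumerable M"
    unfolding choice_not_enumerable_def using choice_of_closure[OF assms] by blast
  show "choice_open M"
    unfolding choice_open_def using choice_of_points[OF assms] by metis
qed

text \<open>Shared core of the four reversals. A bit of the unique solution is read off by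
  quantifying over solutions, so the classes have analytic codes for every definable side condition
  \<open>R\<close>: trivial for the open classes, finiteness when closures are used. Each principle
  then only has to supply a \<open>W\<close> listing the bits.\<close>

lemma weak_Sigma11_AC_I:
  assumes R: "definable (\<lambda>v w. R (w 0))"
    and bits: "\<And>A b. analytic_code_seq M A \<Longrightarrow>
      (\<And>m. points M (nth_set M A m) = {Y \<in> \<S>. R Y \<and> (\<zero> \<in> Y \<longleftrightarrow> b m)}) \<Longrightarrow>
      \<exists>W\<in>\<S>. \<forall>m. \<zero> \<in> nth_set M W m \<longleftrightarrow> b m"
  shows "weak_Sigma11_AC M"
  unfolding weak_Sigma11_AC_def
proof (intro allI impI)
  fix \<phi> x X e E
  assume \<phi>: "arithmetical \<phi>" and E: "range E \<subseteq> \<S>"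
    and unique: "\<forall>n. \<exists>!Z. Z \<in> \<S> \<and> sat M (e(x := n)) (E(X := Z)) \<phi>"
  define sol where "sol n Z = sat M (e(x := n)) (E(X := Z)) \<phi>" for n Z
  have def_sol: "definable (\<lambda>v w. sol (t v w) (U v w))" if "definable_term t" "definable_set U" for t U
    unfolding sol_def
  proof (rule definable_sat[OF \<phi>])
    show "definable_term (\<lambda>v w. (e(x := t v w)) i)" for i
      using that by (intro definable_intros)
    have "E j \<in> \<S>" for j using E by auto
    then show "definable_set (\<lambda>v w. (E(X := U v w)) j)" for j
      using that by (cases "j = X") (simp_all add: definable_set_const)
  qed
  have "\<forall>n. \<exists>Z. Z \<in> \<S> \<and> sol n Z \<and> (\<forall>Z'\<in>\<S>. sol n Z' \<longrightarrow> Z' = Z)"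
  proof
    fix n
    from unique[rule_format, of n, folded sol_def]
    show "\<exists>Z. Z \<in> \<S> \<and> sol n Z \<and> (\<forall>Z'\<in>\<S>. sol n Z' \<longrightarrow> Z' = Z)" by (elim ex1E conjE) blast
  qed
  \<comment> \<open>The map \<open>S\<close> exists in HOL; its values are sets of the structure,
    but that they form a sequence of the structure is what has to be shown.\<close>
  then obtain S where S: "\<And>n. S n \<in> \<S>" "\<And>n. sol n (S n)" "\<And>n Z. Z \<in> \<S> \<Longrightarrow> sol n Z \<Longrightarrow> Z = S n"
    by metis
  \<comment> \<open>The number m codes a position and an index. If it is not a pair, the projections
    take default values and its class is of the same kind.\<close>
  define b where "b m \<longleftrightarrow> proj1 m \<in> S (proj2 m)" for m
  define P where "P m Y Z \<longleftrightarrow> R Y \<and> sol (proj2 m) Z \<and> (\<zero> \<in> Y \<longleftrightarrow> proj1 m \<in> Z)" for m Y Z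
  have def_P: "definable (\<lambda>v w. P (v 0) (w 0) (w 1))"
    unfolding P_def by (intro definable_intros def_sol R)
  obtain A where A: "analytic_code_seq M A" "\<And>m. points M (nth_set M A m) = {Y \<in> \<S>. \<exists>Z\<in>\<S>. P m Y Z}"
    using analytic_code_of_Sigma11[OF def_P] by blast
  moreover have "(\<exists>Z\<in>\<S>. P m Y Z) \<longleftrightarrow> R Y \<and> (\<zero> \<in> Y \<longleftrightarrow> b m)" for m Y
  proof
    assume "\<exists>Z\<in>\<S>. P m Y Z"
    then obtain Z where Z: "Z \<in> \<S>" "P m Y Z" by blast
    then have "Z = S (proj2 m)" using S(3) unfolding P_def by blast
    then show "R Y \<and> (\<zero> \<in> Y \<longleftrightarrow> b m)" using Z(2) by (simp add: P_def b_def)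
  next
    assume "R Y \<and> (\<zero> \<in> Y \<longleftrightarrow> b m)"
    then have "P m Y (S (proj2 m))" by (simp add: P_def b_def S(2))
    then show "\<exists>Z\<in>\<S>. P m Y Z" using S(1) by blast
  qed
  ultimately have "points M (nth_set M A m) = {Y \<in> \<S>. R Y \<and> (\<zero> \<in> Y \<longleftrightarrow> b m)}" for m by simp
  from bits[OF A(1) this] obtain W where W: "W \<in> \<S>" "\<And>m. \<zero> \<in> nth_set M W m \<longleftrightarrow> b m" by blast
  \<comment> \<open>Arithmetical in \<open>W\<close>. The coding of m by position first and index
    second is the one used by \<open>nth_set\<close>, so member n of this sequence is
    \<open>S n\<close>.\<close>
  let ?Z = "{m. \<zero> \<in> nth_set M W m}"
  have "?Z \<in> \<S>" by (rule comprehension) (intro definable_intros W(1))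
  moreover have "nth_set M ?Z n = S n" for n
    unfolding W(2) by (simp add: nth_set_def b_def)
  ultimately show "\<exists>Z\<in>\<S>. \<forall>n. sat M (e(x := n)) (E(X := nth_set M Z n)) \<phi>"
    using S(2) unfolding sol_def by metis
qed

text \<open>One interval suffices, given by the sequence of length \<one> whose entry is the
  prescribed bit; it is repeated as a constant sequence because unions are indexed by all
  numbers.\<close>

lemma open_bit_class: "RM_open M {Y \<in> \<S>. \<zero> \<in> Y \<longleftrightarrow> b}"
proof -
  define c where "c = (if b then \<one> else \<zero>)"
  define s where "s = code_of {p. \<exists>i. i \<prec> \<one> \<and> p = pair M i c}"
  note s = is_seq_code_of[OF definable_term_const, of \<one> c, folded s_def]
  have mem: "pair M i y \<in> coded_set M s \<longleftrightarrow> i = \<zero> \<and> y = c" for i y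
    using s(2) less_succ_iff_le[of i \<zero>] by (auto simp: l2_le_def not_less_zero)
  have "(\<lambda>_. s) \<in> funs M"
    by (simp add: funs_definable[symmetric] definable_fun_def definable_term_const)
  moreover have "is_bin_seq M s \<one>"
    using s(1) less_succ_iff_le[of _ \<zero>] unfolding is_bin_seq_def mem
    by (auto simp: c_def l2_le_def not_less_zero)
  ultimately have "basic_open_seq M (\<lambda>_. s)" unfolding basic_open_seq_def by blast
  moreover have "(\<exists>k. is_initial M (chi M Y) k s) \<longleftrightarrow> (\<zero> \<in> Y \<longleftrightarrow> b)" for Y
  proof -
    have c: "chi M Y \<zero> = c \<longleftrightarrow> (\<zero> \<in> Y \<longleftrightarrow> b)" by (simp add: chi_def c_def)
    have "is_initial M (chi M Y) k s \<longleftrightarrow> k = \<one> \<and> chi M Y \<zero> = c" for k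
    proof
      assume "is_initial M (chi M Y) k s"
      moreover from this have "k = \<one>" using is_seq_length_unique s(1) unfolding is_initial_def by blast
      ultimately show "k = \<one> \<and> chi M Y \<zero> = c" unfolding is_initial_def mem by auto
    next
      assume "k = \<one> \<and> chi M Y \<zero> = c"
      then show "is_initial M (chi M Y) k s"
        using s(1) less_succ_iff_le[of _ \<zero>] unfolding is_initial_def mem
        by (simp add: l2_le_def not_less_zero)
    qed
    then show ?thesis using c by blast
  qed
  ultimately show ?thesis
    unfolding RM_open_def open_union_def by (intro exI[of _ "\<lambda>_. s"]) simp
qed

text \<open>With \<open>c\<close> equal to \<zero> this provides a member of either bit class: a
  singleton or the empty set.\<close>

lemma singleton_in: "{a. a = c \<and> b} \<in> \<S>"
  by (rule comprehension) (intro definable_intros)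

lemma choice_open_imp:
  assumes "choice_open M"
  shows "weak_Sigma11_AC M"
proof (rule weak_Sigma11_AC_I[of "\<lambda>_. True"])
  show "definable (\<lambda>v w. True)" by (rule definable_const)
  fix A b
  assume A: "analytic_code_seq M A"
    and "\<And>m. points M (nth_set M A m) = {Y \<in> \<S>. True \<and> (\<zero> \<in> Y \<longleftrightarrow> b m)}"
  then have pts: "points M (nth_set M A m) = {Y \<in> \<S>. \<zero> \<in> Y \<longleftrightarrow> b m}" for m by simp
  have "{Y \<in> \<S>. \<zero> \<in> Y \<longleftrightarrow> b m} \<noteq> {}" for m
    using singleton_in[of \<zero> "b m"] by blast
  then have "\<exists>W\<in>\<S>. \<forall>m. nth_set M W m \<in> points M (nth_set M A m)"
    using assms[unfolded choice_open_def, rule_format, of A] A open_bit_class by (simp only: pts) simp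
  then show "\<exists>W\<in>\<S>. \<forall>m. \<zero> \<in> nth_set M W m \<longleftrightarrow> b m" unfolding pts by blast
qed

text \<open>Finite in the sense of the structure; if the number sort is nonstandard, such sets may
  be infinite from outside.\<close>

definition finite_class :: "bool \<Rightarrow> 'm set set" where
  "finite_class b = {Y \<in> \<S>. (\<exists>c. Y = coded_set M c) \<and> (\<zero> \<in> Y \<longleftrightarrow> b)}"

text \<open>The sequence runs through all coded sets, whatever their bit at \<zero>;
  \<open>lists_all\<close> permits members outside the class.\<close>

lemma finite_class_enumeration:
  obtains Y where "Y \<in> \<S>" "\<And>c. nth_set M Y c = coded_set M c"
proof -
  have "{q. \<exists>i c. q = pair M i c \<and> i \<in> coded_set M c} \<in> \<S>"
    by (rule comprehension) (intro definable_intros)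
  moreover have "nth_set M {q. \<exists>i c. q = pair M i c \<and> i \<in> coded_set M c} c = coded_set M c" for c
    by (auto simp: nth_set_def)
  ultimately show thesis using that by blast
qed

lemma enumerable_finite_class: "enumerable M (finite_class b)"
  using finite_class_enumeration unfolding enumerable_def lists_all_def finite_class_def by (auto, metis)

lemma finite_class_nonempty: "finite_class b \<noteq> {}"
proof -
  obtain z where z: "coded_set M z = {}" using coded_empty by blast
  have "\<zero> \<in> coded_set M (if b then ins z \<zero> else z) \<longleftrightarrow> b" by (simp add: z coded_set_ins)
  then have "coded_set M (if b then ins z \<zero> else z) \<in> finite_class b"
    unfolding finite_class_def using coded_set_in by blast
  then show ?thesis by blast
qed

lemma seq_closure_finite_class: "seq_closure M (finite_class b) = {Y \<in> \<S>. \<zero> \<in> Y \<longleftrightarrow> b}"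
proof (intro equalityI subsetI)
  fix X assume "X \<in> seq_closure M (finite_class b)"
  then obtain Y where X: "X \<in> \<S>" and
    Y: "\<And>k. \<exists>l. (\<forall>i. i \<prec> k \<longrightarrow> (i \<in> X \<longleftrightarrow> i \<in> nth_set M Y l)) \<and> nth_set M Y l \<in> finite_class b"
    unfolding seq_closure_def by blast
  \<comment> \<open>Precision \<one> already fixes membership of \<zero>, the only bit in
    question.\<close>
  from Y[of \<one>] obtain l where "\<zero> \<in> X \<longleftrightarrow> \<zero> \<in> nth_set M Y l" "nth_set M Y l \<in> finite_class b" by auto
  then show "X \<in> {Y \<in> \<S>. \<zero> \<in> Y \<longleftrightarrow> b}" using X unfolding finite_class_def by blast
next
  fix X assume X: "X \<in> {Y \<in> \<S>. \<zero> \<in> Y \<longleftrightarrow> b}"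
  obtain Y where Y: "Y \<in> \<S>" "\<And>c. nth_set M Y c = coded_set M c"
    using finite_class_enumeration by blast
  have "\<exists>l. (\<forall>i. i \<prec> k \<longrightarrow> (i \<in> X \<longleftrightarrow> i \<in> nth_set M Y l)) \<and> nth_set M Y l \<in> finite_class b" for k
  proof -
    obtain c where c: "coded_set M c = {i \<in> X. i \<prec> k \<oplus> \<one>}"
      \<comment> \<open>Truncating at \<open>k \<oplus> \<one>\<close> instead of \<open>k\<close>
        keeps the bit at \<zero> even for \<open>k = \<zero>\<close>.\<close>
      using coded_set_exists[OF definable_set_const] X by blast
    have "\<zero> \<prec> k \<oplus> \<one>" by (simp add: less_succ_iff_le)
    then have "coded_set M c \<in> finite_class b"
      using X c coded_set_in unfolding finite_class_def by blast
    moreover have "i \<in> X \<longleftrightarrow> i \<in> coded_set M c" if "i \<prec> k" for i using that c by (simp add: less_succ)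
    ultimately show ?thesis unfolding Y(2) by blast
  qed
  moreover have "lists_all M Y (finite_class b)"
    unfolding lists_all_def finite_class_def using Y(2) by auto
  ultimately show "X \<in> seq_closure M (finite_class b)"
    unfolding seq_closure_def using X Y(1) by blast
qed

text \<open>A null class would have covers for every exponent; \<open>not_covered\<close> refutes
  the exponent 2.\<close>

lemma positive_measure_bit_class: "positive_measure M {Y \<in> \<S>. \<zero> \<in> Y \<longleftrightarrow> b}"
  unfolding positive_measure_def measure_zero_def
  using not_covered[of _ b] by blast

text \<open>Cantor's diagonal argument shifted by one place: the set with index m is avoided at
  position m+1, which leaves position \<zero> free for the prescribed bit.\<close>

lemma not_enumerable_bit_class: "\<not> enumerable M {Y \<in> \<S>. \<zero> \<in> Y \<longleftrightarrow> b}"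
proof
  assume "enumerable M {Y \<in> \<S>. \<zero> \<in> Y \<longleftrightarrow> b}"
  then obtain Y where Y: "Y \<in> \<S>" "\<And>X. X \<in> \<S> \<Longrightarrow> (\<zero> \<in> X \<longleftrightarrow> b) \<Longrightarrow> \<exists>m. X = nth_set M Y m"
    unfolding enumerable_def lists_all_def by blast
  let ?X = "{i. (i = \<zero> \<and> b) \<or> (\<exists>m. i = m \<oplus> \<one> \<and> m \<oplus> \<one> \<notin> nth_set M Y m)}"
  have "?X \<in> \<S>" by (rule comprehension) (intro definable_intros Y(1))
  moreover have "\<zero> \<in> ?X \<longleftrightarrow> b" by (simp add: succ_neq_zero[symmetric])
  ultimately obtain m where "?X = nth_set M Y m" using Y(2) by blast
  moreover have "m \<oplus> \<one> \<in> ?X \<longleftrightarrow> m \<oplus> \<one> \<notin> nth_set M Y m"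
    using succ_neq_zero[of m] succ_inject by auto
  ultimately show False by blast
qed

text \<open>The closures are the full bit classes, so any choice from them reveals the bits. The
  first three principles then differ only in the condition to be checked for
  \<open>finite_class\<close> or its closure.\<close>

lemma choice_closure_imp:
  assumes "\<And>A b. analytic_code_seq M A \<Longrightarrow> (\<And>m. points M (nth_set M A m) = finite_class (b m)) \<Longrightarrow>
    \<exists>X\<in>\<S>. \<forall>m. nth_set M X m \<in> seq_closure M (points M (nth_set M A m))"
  shows "weak_Sigma11_AC M"
proof (rule weak_Sigma11_AC_I[of "\<lambda>Y. \<exists>c. Y = coded_set M c"])
  show "definable (\<lambda>v w. \<exists>c. w 0 = coded_set M c)"
    by (intro definable_intros definable_set_eq)
  fix A b
  assume A: "analytic_code_seq M A"
    and "\<And>m. points M (nth_set M A m) = {Y \<in> \<S>. (\<exists>c. Y = coded_set M c) \<and> (\<zero> \<in> Y \<longleftrightarrow> b m)}"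
  then have pts: "points M (nth_set M A m) = finite_class (b m)" for m by (simp add: finite_class_def)
  from assms[OF A pts] show "\<exists>W\<in>\<S>. \<forall>m. \<zero> \<in> nth_set M W m \<longleftrightarrow> b m"
    unfolding pts seq_closure_finite_class by blast
qed

lemma choices_imp_weak:
  "choice_nonempty M \<Longrightarrow> weak_Sigma11_AC M"
  "choice_positive_measure M \<Longrightarrow> weak_Sigma11_AC M"
  "choice_not_enumerable M \<Longrightarrow> weak_Sigma11_AC M"
proof -
  show "weak_Sigma11_AC M" if "choice_nonempty M"
    by (rule choice_closure_imp, rule that[unfolded choice_nonempty_def, rule_format]) (simp add: enumerable_finite_class finite_class_nonempty)
  show "weak_Sigma11_AC M" if "choice_positive_measure M"
    by (rule choice_closure_imp, rule that[unfolded choice_positive_measure_def, rule_format]) (simp add: enumerable_finite_class seq_closure_finite_class positive_measure_bit_class)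
  show "weak_Sigma11_AC M" if "choice_not_enumerable M"
    by (rule choice_closure_imp, rule that[unfolded choice_not_enumerable_def, rule_format]) (simp add: enumerable_finite_class seq_closure_finite_class not_enumerable_bit_class)
qed

end

theorem theorem4p4:
  fixes M :: "'m l2"
  assumes "ACA0 M"
  shows "(Sigma11_AC M \<longrightarrow> choice_nonempty M) \<and>
         (choice_nonempty M \<longrightarrow> weak_Sigma11_AC M) \<and>
         (Sigma11_AC M \<longrightarrow> choice_positive_measure M) \<and>
         (choice_positive_measure M \<longrightarrow> weak_Sigma11_AC M) \<and>
         (Sigma11_AC M \<longrightarrow> choice_not_enumerable M) \<and>
         (choice_not_enumerable M \<longrightarrow> weak_Sigma11_AC M) \<and>
         (Sigma11_AC M \<longrightarrow> choice_open M) \<and>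
         (choice_open M \<longrightarrow> weak_Sigma11_AC M)"
proof -
  interpret aca M by unfold_locales (rule assms)
  show ?thesis using AC_imp_choices choices_imp_weak choice_open_imp by blast
qed

end
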